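(* For every $n\ge 2$ there exist $W,W'\in(\mathbb{C}^* )^{4n+4}$ such that exactly the same factors of the principal $A$-determinant $E_A$ vanish at $W$ and at $W'$ (i.e. for every factor $G$ of $E_A$, $G(W)=0$ if and only if $G(W')=0$), but $\chi(Y_{W,n})\neq\chi(Y_{W',n})$.
   Context: For $W=(w_{ijk})_{i,j\in\{0,1\},\,0\le k\le n}\in(\mathbb{C}^* )^{4n+4}$ put $f_k=w_{00k}+w_{10k}x_1+w_{01k}y_1+w_{11k}x_1y_1$ and let $Y_{W,n}\subset(\mathbb{C}^* )^{2+n}$ be the hypersurface $f_0+\sum_{k=1}^n z_kf_k=0$ in the coordinates $x_1,y_1,z_1,\dots,z_n$. $\chi$ is the topological Euler characteristic. The principal $A$-determinant $E_A$ of $\mathbb{P}^1\times\mathbb{P}^1\times\mathbb{P}^n$ (here $A$ is the set of lattice points of $\Delta_1\times\Delta_1\times\Delta_n$) is, ignoring the monomial factors $w_{ijk}$, the product of the following polynomials in the $w_{ijk}$, which are called its factors: (a) the 2-minors $F_{\bullet\bullet k}=w_{00k}w_{11k}-w_{01k}w_{10k}$ ($0\le k\le n$), $F_{i\bullet(k_1,k_2)}=w_{i0k_1}w_{i1k_2}-w_{i1k_1}w_{i0k_2}$ and $F_{\bullet j(k_1,k_2)}=w_{0jk_1}w_{1jk_2}-w_{1jk_1}w_{0jk_2}$ ($i,j\in\{0,1\}$, $0\le k_1<k_2\le n$); (b) the $2\times2\times2$ hyperdeterminants, for $0\le k_1<k_2\le n$, $$H_{k_1k_2}=\big[(w_{00k_1}w_{11k_2}-w_{00k_2}w_{11k_1})-(w_{01k_1}w_{10k_2}-w_{01k_2}w_{10k_1})\big]^2-4F_{0\bullet(k_1,k_2)}F_{1\bullet(k_1,k_2)};$$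 (c) the $2\times2\times3$ hyperdeterminants $H_{k_1k_2k_3}$, for $0\le k_1<k_2<k_3\le n$: the resultant of the three bilinear forms $q_{k_1},q_{k_2},q_{k_3}$, where $q_k=w_{00k}x_0y_0+w_{01k}x_0y_1+w_{10k}x_1y_0+w_{11k}x_1y_1$. It is an irreducible polynomial of degree 6, and it vanishes if and only if $q_{k_1}=q_{k_2}=q_{k_3}=0$ has a solution in $\mathbb{P}^1\times\mathbb{P}^1$. *)

theory Defs
  imports "HOL-Analysis.Analysis" "HOL-Homology.Homology"
begin

section \<open>Topological Euler characteristic\<close>

text \<open>\<open>HOL-Algebra\<close> has no notion of the rank of an abelian group. It is the largest number of
  \<open>\<int>\<close>-linearly independent elements; the group is written multiplicatively, as homology groups are
  in \<open>HOL-Homology\<close>.\<close>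

definition int_independent :: "('a, 'b) monoid_scheme \<Rightarrow> 'a set \<Rightarrow> bool" where
  "int_independent G S \<longleftrightarrow>
     finite S \<and> S \<subseteq> carrier G \<and>
     (\<forall>c :: 'a \<Rightarrow> int. (\<Otimes>\<^bsub>G\<^esub>x\<in>S. x [^]\<^bsub>G\<^esub> c x) = \<one>\<^bsub>G\<^esub> \<longrightarrow> (\<forall>x\<in>S. c x = 0))"

text \<open>Meaningful for groups of finite rank only (the supremum in \<^typ>\<open>nat\<close> of an unbounded set is
  not specified).\<close>

definition abelian_rank :: "('a, 'b) monoid_scheme \<Rightarrow> nat" where
  "abelian_rank G = Sup {card S | S. int_independent G S}"

definition betti_number :: "nat \<Rightarrow> 'a topology \<Rightarrow> nat" where
  "betti_number p X = abelian_rank (homology_group (int p) X)"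

text \<open>The usual alternating sum of Betti numbers, for spaces whose integral singular homology has
  finite total rank; complex algebraic varieties are such spaces.\<close>

definition euler_char :: "'a topology \<Rightarrow> int" where
  "euler_char X = (\<Sum>p | betti_number p X \<noteq> 0. (-1) ^ p * int (betti_number p X))"


section \<open>The hypersurface\<close>

text \<open>\<open>W i j k\<close> stands for $w_{ijk}$; only the values with \<open>i, j \<in> {0, 1}\<close> and \<open>k \<le> n\<close> are ever used.\<close>

type_synonym coeffs = "nat \<Rightarrow> nat \<Rightarrow> nat \<Rightarrow> complex"

definition in_torus :: "nat \<Rightarrow> coeffs \<Rightarrow> bool" where
  "in_torus n W \<longleftrightarrow> (\<forall>i\<in>{0, 1}. \<forall>j\<in>{0, 1}. \<forall>k\<in>{0..n}. W i j k \<noteq> 0)"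

definition f_form :: "coeffs \<Rightarrow> nat \<Rightarrow> complex \<Rightarrow> complex \<Rightarrow> complex" where
  "f_form W k x y = W 0 0 k + W 1 0 k * x + W 0 1 k * y + W 1 1 k * x * y"

text \<open>The points are triples \<open>(x, y, z)\<close> with \<open>z = (z\<^sub>1, \<dots>, z\<^sub>n)\<close> an extensional function on \<open>{1..n}\<close>.\<close>

definition Y_set :: "nat \<Rightarrow> coeffs \<Rightarrow> (complex \<times> complex \<times> (nat \<Rightarrow> complex)) set" where
  "Y_set n W =
     {(x, y, z). x \<noteq> 0 \<and> y \<noteq> 0 \<and> z \<in> (\<Pi>\<^sub>E k\<in>{1..n}. - {0}) \<and>
        f_form W 0 x y + (\<Sum>k=1..n. z k * f_form W k x y) = 0}"

definition Y_top :: "nat \<Rightarrow> coeffs \<Rightarrow> (complex \<times> complex \<times> (nat \<Rightarrow> complex)) topology" where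
  "Y_top n W =
     subtopology
       (prod_topology euclidean
         (prod_topology euclidean (product_topology (\<lambda>_. euclidean) {1..n})))
       (Y_set n W)"


section \<open>The factors of the principal A-determinant\<close>

definition F_bb :: "nat \<Rightarrow> coeffs \<Rightarrow> complex" where
  "F_bb k W = W 0 0 k * W 1 1 k - W 0 1 k * W 1 0 k"

definition F_ib :: "nat \<Rightarrow> nat \<Rightarrow> nat \<Rightarrow> coeffs \<Rightarrow> complex" where
  "F_ib i k1 k2 W = W i 0 k1 * W i 1 k2 - W i 1 k1 * W i 0 k2"

definition F_bj :: "nat \<Rightarrow> nat \<Rightarrow> nat \<Rightarrow> coeffs \<Rightarrow> complex" where
  "F_bj j k1 k2 W = W 0 j k1 * W 1 j k2 - W 1 j k1 * W 0 j k2"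

definition hyperdet222 :: "nat \<Rightarrow> nat \<Rightarrow> coeffs \<Rightarrow> complex" where
  "hyperdet222 k1 k2 W =
     ((W 0 0 k1 * W 1 1 k2 - W 0 0 k2 * W 1 1 k1) - (W 0 1 k1 * W 1 0 k2 - W 0 1 k2 * W 1 0 k1))\<^sup>2
     - 4 * F_ib 0 k1 k2 W * F_ib 1 k1 k2 W"

definition q_form :: "coeffs \<Rightarrow> nat \<Rightarrow> complex \<Rightarrow> complex \<Rightarrow> complex \<Rightarrow> complex \<Rightarrow> complex" where
  "q_form W k x0 x1 y0 y1 =
     W 0 0 k * x0 * y0 + W 0 1 k * x0 * y1 + W 1 0 k * x1 * y0 + W 1 1 k * x1 * y1"

text \<open>The maximal minor of the \<open>3 \<times> 4\<close> coefficient matrix of $q_{k_1}, q_{k_2}, q_{k_3}$ on the columns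
  \<open>a, b, c\<close>, a column being an index pair \<open>(i, j)\<close>.\<close>

definition minor3 ::
    "nat \<Rightarrow> nat \<Rightarrow> nat \<Rightarrow> nat \<times> nat \<Rightarrow> nat \<times> nat \<Rightarrow> nat \<times> nat \<Rightarrow> coeffs \<Rightarrow> complex" where
  "minor3 k1 k2 k3 a b c W =
     (let row = (\<lambda>k. vector [W (fst a) (snd a) k, W (fst b) (snd b) k, W (fst c) (snd c) k])
      in det (vector [row k1, row k2, row k3] :: complex ^ 3 ^ 3))"

text \<open>The resultant of three bilinear forms, i.e. the \<open>2 \<times> 2 \<times> 3\<close> hyperdeterminant, of degree 6. The signed
  maximal minors form a vector in the kernel of the coefficient matrix, and the resultant is the
  value on it of the quadratic form $v_{00} v_{11} - v_{01} v_{10}$ that cuts out the tensors $x \otimes y$.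
  Lemma \<open>hyperdet223_eq_0_iff\<close> below identifies its zero set, which determines the irreducible
  polynomial up to a scalar.\<close>

definition hyperdet223 :: "nat \<Rightarrow> nat \<Rightarrow> nat \<Rightarrow> coeffs \<Rightarrow> complex" where
  "hyperdet223 k1 k2 k3 W =
     minor3 k1 k2 k3 (0,0) (1,0) (1,1) W * minor3 k1 k2 k3 (0,0) (0,1) (1,1) W
     - minor3 k1 k2 k3 (0,1) (1,0) (1,1) W * minor3 k1 k2 k3 (0,0) (0,1) (1,0) W"

definition EA_factors :: "nat \<Rightarrow> (coeffs \<Rightarrow> complex) set" where
  "EA_factors n =
     {F_bb k | k. k \<le> n} \<union>
     {F_ib i k1 k2 | i k1 k2. i \<in> {0, 1} \<and> k1 < k2 \<and> k2 \<le> n} \<union>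
     {F_bj j k1 k2 | j k1 k2. j \<in> {0, 1} \<and> k1 < k2 \<and> k2 \<le> n} \<union>
     {hyperdet222 k1 k2 | k1 k2. k1 < k2 \<and> k2 \<le> n} \<union>
     {hyperdet223 k1 k2 k3 | k1 k2 k3. k1 < k2 \<and> k2 < k3 \<and> k3 \<le> n}"


section \<open>The zero set of the resultant\<close>

lemma minor3_expand:
  "minor3 k1 k2 k3 a b c W =
     (let u = (\<lambda>k p. W (fst p) (snd p) k) in
        u k1 a * (u k2 b * u k3 c - u k2 c * u k3 b)
      - u k1 b * (u k2 a * u k3 c - u k2 c * u k3 a)
      + u k1 c * (u k2 a * u k3 b - u k2 b * u k3 a))"
  by (simp add: minor3_def Let_def det_3 algebra_simps)

lemma linear2_zero:
  fixes a b c d :: complex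
  assumes "a * d - b * c = 0"
  shows "\<exists>x0 x1. (x0, x1) \<noteq> (0, 0) \<and> a * x0 + b * x1 = 0 \<and> c * x0 + d * x1 = 0"
proof (cases "a = 0 \<and> b = 0")
  case True
  show ?thesis
  proof (cases "c = 0 \<and> d = 0")
    case True
    with \<open>a = 0 \<and> b = 0\<close> show ?thesis by (intro exI[of _ 1]) auto
  next
    case False
    with \<open>a = 0 \<and> b = 0\<close> show ?thesis
      by (intro exI[of _ d] exI[of _ "- c"]) auto
  qed
next
  case False
  then have "(b, - a) \<noteq> (0, 0)" by auto
  moreover have "a * b + b * (- a) = 0" by simp
  moreover have "c * b + d * (- a) = 0" using assms by (simp add: algebra_simps)
  ultimately show ?thesis by blast
qed

lemma binary_quadratic_zero:
  fixes a b c :: complex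
  shows "\<exists>y0 y1. (y0, y1) \<noteq> (0, 0) \<and> a * y0\<^sup>2 + b * y0 * y1 + c * y1\<^sup>2 = 0"
proof (cases "a = 0")
  case True
  then show ?thesis by (intro exI[of _ 1] exI[of _ 0]) auto
next
  case False
  define s where "s = csqrt (b\<^sup>2 - 4 * a * c)"
  have s: "s\<^sup>2 = b\<^sup>2 - 4 * a * c" by (simp add: s_def)
  have "a * (s - b)\<^sup>2 + b * (s - b) * (2 * a) + c * (2 * a)\<^sup>2 = a * (s\<^sup>2 - (b\<^sup>2 - 4 * a * c))"
    by (simp add: power2_eq_square algebra_simps)
  also have "\<dots> = 0" by (simp add: s)
  finally have "a * (s - b)\<^sup>2 + b * (s - b) * (2 * a) + c * (2 * a)\<^sup>2 = 0" .
  moreover have "(s - b, 2 * a) \<noteq> (0, 0)" using False by simp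
  ultimately show ?thesis by blast
qed

lemma two_bilinear_zero:
  "\<exists>x0 x1 y0 y1. (x0, x1) \<noteq> (0, 0) \<and> (y0, y1) \<noteq> (0, 0) \<and>
     q_form W k x0 x1 y0 y1 = 0 \<and> q_form W l x0 x1 y0 y1 = 0"
proof -
  obtain y0 y1 where y: "(y0, y1) \<noteq> (0, 0)" and eq:
    "(W 0 0 k * W 1 0 l - W 1 0 k * W 0 0 l) * y0\<^sup>2
     + (W 0 0 k * W 1 1 l + W 0 1 k * W 1 0 l - W 1 0 k * W 0 1 l - W 1 1 k * W 0 0 l) * y0 * y1
     + (W 0 1 k * W 1 1 l - W 1 1 k * W 0 1 l) * y1\<^sup>2 = 0"
    using binary_quadratic_zero by blast
  have "(W 0 0 k * y0 + W 0 1 k * y1) * (W 1 0 l * y0 + W 1 1 l * y1)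
      - (W 1 0 k * y0 + W 1 1 k * y1) * (W 0 0 l * y0 + W 0 1 l * y1) = 0"
    using eq by (simp add: power2_eq_square algebra_simps)
  from linear2_zero[OF this] obtain x0 x1 where x: "(x0, x1) \<noteq> (0, 0)"
    and k: "(W 0 0 k * y0 + W 0 1 k * y1) * x0 + (W 1 0 k * y0 + W 1 1 k * y1) * x1 = 0"
    and l: "(W 0 0 l * y0 + W 0 1 l * y1) * x0 + (W 1 0 l * y0 + W 1 1 l * y1) * x1 = 0"
    by blast
  have q: "q_form W j x0 x1 y0 y1 =
      (W 0 0 j * y0 + W 0 1 j * y1) * x0 + (W 1 0 j * y0 + W 1 1 j * y1) * x1" for j
    by (simp add: q_form_def algebra_simps)
  have "q_form W k x0 x1 y0 y1 = 0" "q_form W l x0 x1 y0 y1 = 0"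
    using k l by (simp_all only: q)
  with x y show ?thesis by blast
qed

lemma row_dependency:
  fixes u v w :: "'i \<Rightarrow> complex"
  assumes minors: "\<And>a b c. u a * (v b * w c - v c * w b) - u b * (v a * w c - v c * w a)
                   + u c * (v a * w b - v b * w a) = 0"
  shows "\<exists>r s t. (r, s, t) \<noteq> (0, 0, 0) \<and> (\<forall>a. r * u a + s * v a + t * w a = 0)"
proof (cases "\<exists>a b. v a * w b - v b * w a \<noteq> 0 \<or> u a * w b - u b * w a \<noteq> 0 \<or> u a * v b - u b * v a \<noteq> 0")
  case True
  then obtain a b where ab:
    "v a * w b - v b * w a \<noteq> 0 \<or> u a * w b - u b * w a \<noteq> 0 \<or> u a * v b - u b * v a \<noteq> 0" by blast
  have "(v a * w b - v b * w a) * u c + (- (u a * w b - u b * w a)) * v c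
          + (u a * v b - u b * v a) * w c = 0" for c
    using minors[of a b c] by (simp add: algebra_simps)
  with ab show ?thesis
    by (intro exI[of _ "v a * w b - v b * w a"] exI[of _ "- (u a * w b - u b * w a)"]
          exI[of _ "u a * v b - u b * v a"]) auto
next
  case False
  then have z: "u a * v b - u b * v a = 0" for a b by blast
  show ?thesis
  proof (cases "\<forall>a. u a = 0")
    case True
    then show ?thesis by (intro exI[of _ 1] exI[of _ 0]) auto
  next
    case False
    then obtain a where "u a \<noteq> 0" by blast
    moreover have "(- v a) * u c + u a * v c + 0 * w c = 0" for c
      using z[of a c] by (simp add: algebra_simps)
    ultimately show ?thesis
      by (intro exI[of _ "- v a"] exI[of _ "u a"] exI[of _ 0]) auto
  qed
qed

lemma tensor_factor:
  fixes v00 v01 v10 v11 :: complex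
  assumes eq: "v00 * v11 = v01 * v10" and nz: "(v00, v01, v10, v11) \<noteq> (0, 0, 0, 0)"
  shows "\<exists>x0 x1 y0 y1 r. (x0, x1) \<noteq> (0, 0) \<and> (y0, y1) \<noteq> (0, 0) \<and>
           x0 * y0 = r * v00 \<and> x0 * y1 = r * v01 \<and> x1 * y0 = r * v10 \<and> x1 * y1 = r * v11"
proof -
  consider "v00 \<noteq> 0" | "v01 \<noteq> 0" | "v10 \<noteq> 0" | "v11 \<noteq> 0" using nz by auto
  then show ?thesis
  proof cases
    case 1
    with eq show ?thesis
      by (intro exI[of _ v00] exI[of _ v10] exI[of _ v00] exI[of _ v01] exI[of _ v00]) (simp add: ac_simps)
  next
    case 2
    with eq show ?thesis
      by (intro exI[of _ v01] exI[of _ v11] exI[of _ v00] exI[of _ v01] exI[of _ v01]) (simp add: ac_simps)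
  next
    case 3
    with eq show ?thesis
      by (intro exI[of _ v00] exI[of _ v10] exI[of _ v10] exI[of _ v11] exI[of _ v10]) (simp add: ac_simps)
  next
    case 4
    with eq show ?thesis
      by (intro exI[of _ v01] exI[of _ v11] exI[of _ v10] exI[of _ v11] exI[of _ v11]) (simp add: ac_simps)
  qed
qed

lemma kernel_proportional:
  fixes u v w :: "'i \<Rightarrow> complex"
  defines "m \<equiv> \<lambda>a b c. u a * (v b * w c - v c * w b) - u b * (v a * w c - v c * w a)
                   + u c * (v a * w b - v b * w a)"
  assumes u: "u a * pa + u b * pb + u c * pc + u d * pd = 0"
    and v: "v a * pa + v b * pb + v c * pc + v d * pd = 0"
    and w: "w a * pa + w b * pb + w c * pc + w d * pd = 0"
  shows "m a c d * pa + m b c d * pb = 0"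
proof -
  have "m a c d * pa + m b c d * pb =
      (u a * pa + u b * pb + u c * pc + u d * pd) * (v c * w d - v d * w c)
    - (v a * pa + v b * pb + v c * pc + v d * pd) * (u c * w d - u d * w c)
    + (w a * pa + w b * pb + w c * pc + w d * pd) * (u c * v d - u d * v c)"
    unfolding m_def by (simp add: algebra_simps)
  then show ?thesis by (simp add: u v w)
qed

lemma hyperdet223_eq_0_iff:
  "hyperdet223 k1 k2 k3 W = 0 \<longleftrightarrow>
     (\<exists>x0 x1 y0 y1. (x0, x1) \<noteq> (0, 0) \<and> (y0, y1) \<noteq> (0, 0) \<and>
        q_form W k1 x0 x1 y0 y1 = 0 \<and> q_form W k2 x0 x1 y0 y1 = 0 \<and> q_form W k3 x0 x1 y0 y1 = 0)"
  (is "_ \<longleftrightarrow> ?sol")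
proof -
  define u where "u = (\<lambda>k p. W (fst p) (snd p) k)"
  define m where "m = (\<lambda>a b c. u k1 a * (u k2 b * u k3 c - u k2 c * u k3 b)
      - u k1 b * (u k2 a * u k3 c - u k2 c * u k3 a) + u k1 c * (u k2 a * u k3 b - u k2 b * u k3 a))"
  define v00 v01 v10 v11 where v:
    "v00 = m (0,1) (1,0) (1,1)" "v01 = - m (0,0) (1,0) (1,1)"
    "v10 = m (0,0) (0,1) (1,1)" "v11 = - m (0,0) (0,1) (1,0)"
  have minor: "minor3 k1 k2 k3 a b c W = m a b c" for a b c
    by (simp add: minor3_expand m_def u_def Let_def)
  have H: "hyperdet223 k1 k2 k3 W = v00 * v11 - v01 * v10"
    by (simp add: hyperdet223_def minor v)
  have q: "q_form W k x0 x1 y0 y1 =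
      u k (0,0) * (x0 * y0) + u k (0,1) * (x0 * y1) + u k (1,0) * (x1 * y0) + u k (1,1) * (x1 * y1)"
    for k x0 x1 y0 y1
    by (simp add: q_form_def u_def mult.assoc)
  have kernel: "u k (0,0) * v00 + u k (0,1) * v01 + u k (1,0) * v10 + u k (1,1) * v11 = 0"
    if "k \<in> {k1, k2, k3}" for k
    using that by (auto simp: v m_def algebra_simps)
  show ?thesis
  proof
    assume "hyperdet223 k1 k2 k3 W = 0"
    then have vv: "v00 * v11 = v01 * v10" by (simp add: H)
    show ?sol
    proof (cases "(v00, v01, v10, v11) = (0, 0, 0, 0)")
      case False
      then obtain x0 x1 y0 y1 r where xy: "(x0, x1) \<noteq> (0, 0)" "(y0, y1) \<noteq> (0, 0)"
        and t: "x0 * y0 = r * v00" "x0 * y1 = r * v01" "x1 * y0 = r * v10" "x1 * y1 = r * v11"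
        using tensor_factor[OF vv] by blast
      have "q_form W k x0 x1 y0 y1 =
          r * (u k (0,0) * v00 + u k (0,1) * v01 + u k (1,0) * v10 + u k (1,1) * v11)" for k
        unfolding q t by (simp add: algebra_simps)
      with kernel have "q_form W k x0 x1 y0 y1 = 0" if "k \<in> {k1, k2, k3}" for k
        using that by simp
      with xy show ?sol by blast
    next
      case True
      define e :: "nat \<Rightarrow> nat \<times> nat" where "e = (\<lambda>i. (i div 2 mod 2, i mod 2))"
      have m0: "m (0,1) (1,0) (1,1) = 0" "m (0,0) (1,0) (1,1) = 0"
        "m (0,0) (0,1) (1,1) = 0" "m (0,0) (0,1) (1,0) = 0"
        using True by (simp_all add: v)
      have perm: "m b a c = 0 \<and> m a c b = 0 \<and> m b c a = 0 \<and> m c a b = 0 \<and> m c b a = 0"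
        if "m a b c = 0"
        for a b c
      proof -
        have "m b a c = - m a b c" "m a c b = - m a b c" "m b c a = m a b c" "m c a b = m a b c"
          "m c b a = - m a b c"
          by (simp_all add: m_def algebra_simps)
        then show ?thesis using that by simp
      qed
      have rep: "m a a c = 0" "m a c a = 0" "m c a a = 0" for a c
        by (simp_all add: m_def algebra_simps)
      have me: "m (e i) (e j) (e l) = 0" for i j l
      proof -
        have cols: "e i \<in> {(0,0), (0,1), (1,0), (1,1)}" for i
          by (auto simp: e_def)
        show ?thesis
          using cols[of i] cols[of j] cols[of l] m0[THEN perm] m0 rep
          by (elim insertE emptyE) simp_all
      qed
      obtain r s t where rst: "(r, s, t) \<noteq> (0, 0, 0)"
        and dep': "\<And>i. r * u k1 (e i) + s * u k2 (e i) + t * u k3 (e i) = 0"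
        using row_dependency[of "\<lambda>i. u k1 (e i)" "\<lambda>i. u k2 (e i)" "\<lambda>i. u k3 (e i)",
          OF me[unfolded m_def]]
        by blast
      have dep: "r * u k1 p + s * u k2 p + t * u k3 p = 0" if "p \<in> {(0,0), (0,1), (1,0), (1,1)}" for p
        using that dep'[of 0] dep'[of 1] dep'[of 2] dep'[of 3] by (auto simp: e_def)
      have qdep: "r * q_form W k1 x0 x1 y0 y1 + s * q_form W k2 x0 x1 y0 y1
          + t * q_form W k3 x0 x1 y0 y1 = 0" for x0 x1 y0 y1
      proof -
        have "r * q_form W k1 x0 x1 y0 y1 + s * q_form W k2 x0 x1 y0 y1 + t * q_form W k3 x0 x1 y0 y1
          = (r * u k1 (0,0) + s * u k2 (0,0) + t * u k3 (0,0)) * (x0 * y0)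
          + (r * u k1 (0,1) + s * u k2 (0,1) + t * u k3 (0,1)) * (x0 * y1)
          + (r * u k1 (1,0) + s * u k2 (1,0) + t * u k3 (1,0)) * (x1 * y0)
          + (r * u k1 (1,1) + s * u k2 (1,1) + t * u k3 (1,1)) * (x1 * y1)"
          unfolding q by (simp add: algebra_simps)
        then show ?thesis by (simp add: dep)
      qed
      consider "r \<noteq> 0" | "s \<noteq> 0" | "t \<noteq> 0" using rst by auto
      then show ?sol
      proof cases
        case 1
        obtain x0 x1 y0 y1 where *: "(x0, x1) \<noteq> (0, 0)" "(y0, y1) \<noteq> (0, 0)"
          "q_form W k2 x0 x1 y0 y1 = 0" "q_form W k3 x0 x1 y0 y1 = 0"
          using two_bilinear_zero[of W k2 k3] by blast
        moreover have "q_form W k1 x0 x1 y0 y1 = 0" using qdep[of x0 x1 y0 y1] * 1 by simp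
        ultimately show ?sol by blast
      next
        case 2
        obtain x0 x1 y0 y1 where *: "(x0, x1) \<noteq> (0, 0)" "(y0, y1) \<noteq> (0, 0)"
          "q_form W k1 x0 x1 y0 y1 = 0" "q_form W k3 x0 x1 y0 y1 = 0"
          using two_bilinear_zero[of W k1 k3] by blast
        moreover have "q_form W k2 x0 x1 y0 y1 = 0" using qdep[of x0 x1 y0 y1] * 2 by simp
        ultimately show ?sol by blast
      next
        case 3
        obtain x0 x1 y0 y1 where *: "(x0, x1) \<noteq> (0, 0)" "(y0, y1) \<noteq> (0, 0)"
          "q_form W k1 x0 x1 y0 y1 = 0" "q_form W k2 x0 x1 y0 y1 = 0"
          using two_bilinear_zero[of W k1 k2] by blast
        moreover have "q_form W k3 x0 x1 y0 y1 = 0" using qdep[of x0 x1 y0 y1] * 3 by simp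
        ultimately show ?sol by blast
      qed
    qed
  next
    assume ?sol
    then obtain x0 x1 y0 y1 where xy: "(x0, x1) \<noteq> (0, 0)" "(y0, y1) \<noteq> (0, 0)"
      and qs: "\<And>k. k \<in> {k1, k2, k3} \<Longrightarrow> q_form W k x0 x1 y0 y1 = 0" by blast
    define p00 p01 p10 p11 where p:
      "p00 = x0 * y0" "p01 = x0 * y1" "p10 = x1 * y0" "p11 = x1 * y1"
    have pp: "p00 * p11 = p01 * p10" by (simp add: p)
    have nz: "p00 \<noteq> 0 \<or> p01 \<noteq> 0 \<or> p10 \<noteq> 0 \<or> p11 \<noteq> 0" using xy by (auto simp: p)
    have Q: "u k (0,0) * p00 + u k (0,1) * p01 + u k (1,0) * p10 + u k (1,1) * p11 = 0"
      if "k \<in> {k1, k2, k3}" for k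
      using qs[OF that] unfolding q p .
    have K: "m a c d * pa + m b c d * pb = 0"
      if "u k1 a * pa + u k1 b * pb + u k1 c * pc + u k1 d * pd = 0"
        and "u k2 a * pa + u k2 b * pb + u k2 c * pc + u k2 d * pd = 0"
        and "u k3 a * pa + u k3 b * pb + u k3 c * pc + u k3 d * pd = 0"
      for a b c d pa pb pc pd
      unfolding m_def by (rule kernel_proportional[OF that])
    have m_v: "m (0,1) (1,0) (1,1) = v00" "m (0,0) (1,0) (1,1) = - v01"
      "m (0,0) (0,1) (1,1) = v10" "m (0,0) (0,1) (1,0) = - v11"
      "m (1,0) (0,1) (1,1) = - v00" "m (1,1) (0,1) (1,0) = v00"
      "m (0,1) (0,0) (1,1) = - v10" "m (1,0) (0,0) (1,1) = v01"
      "m (0,1) (0,0) (1,0) = v11" "m (1,1) (0,0) (1,0) = - v01"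
      "m (1,0) (0,0) (0,1) = - v11" "m (1,1) (0,0) (0,1) = v10"
      by (simp_all add: v m_def algebra_simps)
    note Q3 = Q[of k1, simplified] Q[of k2, simplified] Q[of k3, simplified]
    have P1: "v00 * p01 = v01 * p00"
      using K[of "(0,0)" p00 "(0,1)" p01 "(1,0)" p10 "(1,1)" p11] Q3
      by (simp add: m_v[simplified] algebra_simps)
    have P2: "v00 * p10 = v10 * p00"
      using K[of "(0,0)" p00 "(1,0)" p10 "(0,1)" p01 "(1,1)" p11] Q3
      by (simp add: m_v[simplified] algebra_simps)
    have P3: "v00 * p11 = v11 * p00"
      using K[of "(0,0)" p00 "(1,1)" p11 "(0,1)" p01 "(1,0)" p10] Q3
      by (simp add: m_v[simplified] algebra_simps)
    have P4: "v01 * p10 = v10 * p01"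
      using K[of "(0,1)" p01 "(1,0)" p10 "(0,0)" p00 "(1,1)" p11] Q3
      by (simp add: m_v[simplified] algebra_simps)
    have P5: "v01 * p11 = v11 * p01"
      using K[of "(0,1)" p01 "(1,1)" p11 "(0,0)" p00 "(1,0)" p10] Q3
      by (simp add: m_v[simplified] algebra_simps)
    have P6: "v10 * p11 = v11 * p10"
      using K[of "(1,0)" p10 "(1,1)" p11 "(0,0)" p00 "(0,1)" p01] Q3
      by (simp add: m_v[simplified] algebra_simps)
    have zero: "(v00 * v11 - v01 * v10) * p\<^sup>2 = 0"
      if "v00 * p = c * p00" "v01 * p = c * p01" "v10 * p = c * p10" "v11 * p = c * p11" for p c
    proof -
      have "(v00 * v11 - v01 * v10) * p\<^sup>2 = (v00 * p) * (v11 * p) - (v01 * p) * (v10 * p)"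
        by (simp add: power2_eq_square algebra_simps)
      also have "\<dots> = c\<^sup>2 * (p00 * p11 - p01 * p10)"
        unfolding that by (simp add: power2_eq_square algebra_simps)
      finally show ?thesis by (simp add: pp)
    qed
    have "(v00 * v11 - v01 * v10) * p00\<^sup>2 = 0" "(v00 * v11 - v01 * v10) * p01\<^sup>2 = 0"
      "(v00 * v11 - v01 * v10) * p10\<^sup>2 = 0" "(v00 * v11 - v01 * v10) * p11\<^sup>2 = 0"
      using zero[of p00 v00] zero[of p01 v01] zero[of p10 v10] zero[of p11 v11] P1 P2 P3 P4 P5 P6
      by simp_all
    with nz show "hyperdet223 k1 k2 k3 W = 0" by (auto simp: H)
  qed
qed

end

(* In the coordinates X = 1 / x, Y = 1 - 1 / y the forms used here are, up to a common unit,
   (X - 1) Y, (X + 2) Y + 1 and (2 X + d) Y + 1, the last one repeated for all k >= 2. All of them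
   vanish at the boundary point x = 0, y = 1, so all 2x2x3 hyperdeterminants are 0. The remaining
   factors do not distinguish d = 1 from d = 3, but for d = 1 the three curves form a pencil, with a
   second common point inside the torus, while for d = 3 they do not.

   If U is the complement of the curves in the torus, then chi(Y) = (-1)^(n-1) chi(U), and chi(U) is
   7 for d = 1 and 8 for d = 3. These values come from the additivity chi(X) = chi(X - Z) + chi(Z) for
   a divisor Z with a chart around it, which follows from Mayer-Vietoris because a punctured disc
   bundle has Euler characteristic 0. Over the second base point of the pencil no such chart exists, as
   the hypersurface is singular there; instead, scaling the local equations of the pencil contracts a
   neighbourhood to the fibre over that point. *)

theory Submission
  imports Defs
begin

section \<open>Ranks of abelian groups\<close>

text \<open>A 2x2x3 hyperdeterminant only records that three curves meet somewhere in P^1 x P^1. A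
  common point forced on the boundary makes all these factors vanish and hides any further common
  point in the torus, which the Euler characteristic still sees. Since
  \<open>line2 d - line0 - line1\<close> is (d - 1) Y, that further point X = 1, Y = -1/3 lies on
  all three curves exactly for d = 1. The factors that do depend on d are d - 2, d + 2, d - 4, d +
  3, d - 5, so d = 3 is simply a small value, other than 1, at which none of them vanishes and all
  coefficients are nonzero.

  The factor (-1)^(n-1) comes from the fibres: for n = 2 the fibre over a point of U is a plane
  minus two points, and over any other point it is empty or a power of C^* .

  For singular homology chi(X) = chi(X - Z) + chi(Z) is not a general law (a real line minus a point
  violates it). Every removed set therefore needs a complex normal coordinate, and the order of the
  removals is chosen so that the removed set is a graph over a known set or has a factor C^* .
  Finite total rank has to be carried along throughout.\<close>

definition int_comb :: "('a, 'b) monoid_scheme \<Rightarrow> 'i set \<Rightarrow> ('i \<Rightarrow> 'a) \<Rightarrow> ('i \<Rightarrow> int) \<Rightarrow> 'a" where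
  "int_comb G J g c = (\<Otimes>\<^bsub>G\<^esub>i\<in>J. g i [^]\<^bsub>G\<^esub> c i)"

definition indep_family :: "('a, 'b) monoid_scheme \<Rightarrow> 'i set \<Rightarrow> ('i \<Rightarrow> 'a) \<Rightarrow> bool" where
  "indep_family G J g \<longleftrightarrow> (\<forall>c. int_comb G J g c = \<one>\<^bsub>G\<^esub> \<longrightarrow> (\<forall>i\<in>J. c i = 0))"

lemma indep_familyD:
  "indep_family G J g \<Longrightarrow> int_comb G J g c = \<one>\<^bsub>G\<^esub> \<Longrightarrow> i \<in> J \<Longrightarrow> c i = 0"
  by (simp add: indep_family_def)

text \<open>Independence is taken for families with values in a subset \<open>S\<close>, so that
  kernels and images need not be made into groups and repeated values need no special treatment.
  Natural numbers suffice as indices because only the size of the family matters.\<close>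

definition rank_ge :: "('a, 'b) monoid_scheme \<Rightarrow> 'a set \<Rightarrow> nat \<Rightarrow> bool" where
  "rank_ge G S r \<longleftrightarrow> (\<exists>(J :: nat set) g. finite J \<and> card J = r \<and> g \<in> J \<rightarrow> S \<and> indep_family G J g)"

text \<open>Reaching \<open>r\<close> and failing at \<open>Suc r\<close> makes finiteness part of
  the relation: a group of infinite rank has no \<open>r\<close> at all, whereas the supremum in
  \<open>abelian_rank\<close> would be unspecified.\<close>

definition has_rank :: "('a, 'b) monoid_scheme \<Rightarrow> 'a set \<Rightarrow> nat \<Rightarrow> bool" where
  "has_rank G S r \<longleftrightarrow> rank_ge G S r \<and> \<not> rank_ge G S (Suc r)"

context comm_group
begin

lemma int_comb_closed: "g \<in> J \<rightarrow> carrier G \<Longrightarrow> int_comb G J g c \<in> carrier G"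
  unfolding int_comb_def by (intro finprod_closed) auto

lemma int_comb_add:
  assumes "g \<in> J \<rightarrow> carrier G"
  shows "int_comb G J g (\<lambda>i. c i + d i) = int_comb G J g c \<otimes> int_comb G J g d"
proof -
  have "int_comb G J g (\<lambda>i. c i + d i) = (\<Otimes>i\<in>J. g i [^] c i \<otimes> g i [^] d i)"
    unfolding int_comb_def using assms by (intro finprod_cong') (auto simp: int_pow_mult Pi_iff)
  also have "\<dots> = int_comb G J g c \<otimes> int_comb G J g d"
    unfolding int_comb_def using assms by (intro finprod_multf) auto
  finally show ?thesis .
qed

lemma int_comb_scale:
  assumes "finite J" "g \<in> J \<rightarrow> carrier G"
  shows "int_comb G J g (\<lambda>i. k * c i) = int_comb G J g c [^] (k::int)"
  using assms
proof (induction J rule: finite_induct)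
  case empty
  then show ?case by (simp add: int_comb_def)
next
  case (insert x J)
  then have "int_comb G (insert x J) g (\<lambda>i. k * c i) = g x [^] (k * c x) \<otimes> int_comb G J g (\<lambda>i. k * c i)"
    unfolding int_comb_def by (subst finprod_insert) auto
  also have "\<dots> = (g x [^] c x) [^] k \<otimes> int_comb G J g c [^] k"
    using insert by (auto simp: int_pow_pow mult.commute)
  also have "\<dots> = (g x [^] c x \<otimes> int_comb G J g c) [^] k"
    using insert int_comb_closed[of g J c] by (subst int_pow_distrib) auto
  also have "g x [^] c x \<otimes> int_comb G J g c = int_comb G (insert x J) g c"
    using insert unfolding int_comb_def by (subst finprod_insert) auto
  finally show ?case .
qed

lemma int_comb_zero: "int_comb G J g (\<lambda>i. 0) = \<one>"
  unfolding int_comb_def by simp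

lemma int_comb_int_comb:
  assumes "finite J" "g \<in> J \<rightarrow> carrier G"
  shows "int_comb G {..<m::nat} (\<lambda>j. int_comb G J g (c j)) d = int_comb G J g (\<lambda>i. \<Sum>j<m. d j * c j i)"
proof (induction m)
  case 0
  then show ?case by (simp add: int_comb_def)
next
  case (Suc m)
  have "int_comb G {..<Suc m} (\<lambda>j. int_comb G J g (c j)) d
     = int_comb G J g (c m) [^] d m \<otimes> int_comb G {..<m} (\<lambda>j. int_comb G J g (c j)) d"
    unfolding int_comb_def lessThan_Suc using int_comb_closed[OF assms(2)]
    by (subst finprod_insert) (auto simp: int_comb_def)
  also have "\<dots> = int_comb G J g (\<lambda>i. d m * c m i) \<otimes> int_comb G J g (\<lambda>i. \<Sum>j<m. d j * c j i)"
    by (simp add: Suc int_comb_scale[OF assms])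
  also have "\<dots> = int_comb G J g (\<lambda>i. d m * c m i + (\<Sum>j<m. d j * c j i))"
    by (simp add: int_comb_add[OF assms(2)])
  finally show ?case by (simp add: add.commute)
qed

lemma int_comb_mono_neutral:
  assumes "finite J" "I \<subseteq> J" "g \<in> J \<rightarrow> carrier G" "\<And>i. i \<in> J - I \<Longrightarrow> c i = 0"
  shows "int_comb G J g c = int_comb G I g c"
  unfolding int_comb_def using assms by (intro finprod_mono_neutral_cong_right) (auto simp: Pi_iff)

lemma int_comb_cong:
  assumes "g' \<in> J \<rightarrow> carrier G" "\<And>i. i \<in> J \<Longrightarrow> g i = g' i" "\<And>i. i \<in> J \<Longrightarrow> c i = c' i"
  shows "int_comb G J g c = int_comb G J g' c'"
  unfolding int_comb_def using assms by (intro finprod_cong') auto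

lemma int_comb_reindex:
  assumes "inj_on h J" "g \<in> h ` J \<rightarrow> carrier G"
  shows "int_comb G (h ` J) g c = int_comb G J (g \<circ> h) (c \<circ> h)"
  unfolding int_comb_def using assms by (subst finprod_reindex) (auto simp: o_def)

lemma int_comb_Un:
  assumes "finite J" "finite I" "J \<inter> I = {}" "g \<in> J \<union> I \<rightarrow> carrier G"
  shows "int_comb G (J \<union> I) g c = int_comb G J g c \<otimes> int_comb G I g c"
  unfolding int_comb_def using assms by (intro finprod_Un_disjoint) auto

lemma indep_family_subset:
  assumes "finite J" "I \<subseteq> J" "g \<in> J \<rightarrow> carrier G" "indep_family G J g"
  shows "indep_family G I g"
  unfolding indep_family_def
proof (intro allI impI)
  fix c assume c: "int_comb G I g c = \<one>"
  let ?c = "\<lambda>i. if i \<in> I then c i else 0"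
  have "int_comb G J g ?c = int_comb G I g ?c"
    by (rule int_comb_mono_neutral) (use assms in auto)
  also have "\<dots> = int_comb G I g c"
    by (rule int_comb_cong) (use assms in auto)
  finally have "int_comb G J g ?c = \<one>" using c by simp
  from indep_familyD[OF assms(4) this] show "\<forall>i\<in>I. c i = 0" using assms(2) by (force split: if_splits)
qed

lemma rank_geI:
  assumes "finite J" "card J = r" "g \<in> J \<rightarrow> S" "indep_family G J g" "S \<subseteq> carrier G"
  shows "rank_ge G S r"
proof -
  obtain h where h: "bij_betw h {..<r} J"
    using assms(1,2) by (metis bij_betw_from_nat_into_finite)
  have inj: "inj_on h {..<r}" and im: "J = h ` {..<r}" using h by (auto simp: bij_betw_def)
  have gc: "g \<in> J \<rightarrow> carrier G" using assms(3,5) by auto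
  have "indep_family G {..<r} (g \<circ> h)"
    unfolding indep_family_def
  proof (intro allI impI)
    fix c assume c: "int_comb G {..<r} (g \<circ> h) c = \<one>"
    let ?c = "c \<circ> the_inv_into {..<r} h"
    have "int_comb G J g ?c = int_comb G {..<r} (g \<circ> h) (?c \<circ> h)"
      unfolding im by (rule int_comb_reindex) (use inj im gc in auto)
    also have "\<dots> = int_comb G {..<r} (g \<circ> h) c"
      by (rule int_comb_cong) (use inj im gc in \<open>auto simp: the_inv_into_f_f\<close>)
    finally have "\<forall>i\<in>J. ?c i = 0" using c assms(4) unfolding indep_family_def by metis
    then show "\<forall>i\<in>{..<r}. c i = 0" using inj im by (auto simp: the_inv_into_f_f)
  qed
  moreover have "g \<circ> h \<in> {..<r} \<rightarrow> S" using assms im by auto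
  ultimately show ?thesis unfolding rank_ge_def by (intro exI[of _ "{..<r}"] exI[of _ "g \<circ> h"]) auto
qed

lemma rank_ge_mono:
  assumes "rank_ge G S r" "r' \<le> r" "S \<subseteq> T" "T \<subseteq> carrier G"
  shows "rank_ge G T r'"
proof -
  obtain J :: "nat set" and g where J: "finite J" "card J = r" "g \<in> J \<rightarrow> S" "indep_family G J g"
    using assms unfolding rank_ge_def by blast
  obtain I where I: "I \<subseteq> J" "card I = r'" by (metis J(2) assms(2) obtain_subset_with_card_n)
  show ?thesis
    by (rule rank_geI[of I _ g])
       (use I J assms indep_family_subset[of J I g] finite_subset in auto)
qed

lemma has_rank_unique:
  assumes "has_rank G S a" "has_rank G S b" "S \<subseteq> carrier G" shows "a = b"
  using assms rank_ge_mono[of S _ _ S] unfolding has_rank_def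
  by (metis linorder_neqE_nat Suc_leI order_refl)

lemma rank_ge_0: "rank_ge G S 0"
  unfolding rank_ge_def by (intro exI[of _ "{}"]) (auto simp: indep_family_def)

lemma has_rank_exists:
  assumes "\<not> rank_ge G S n"
  shows "\<exists>r<n. has_rank G S r"
  using assms
proof (induction n)
  case 0 then show ?case using rank_ge_0 by blast
next
  case (Suc n) then show ?case unfolding has_rank_def by (metis less_Suc_eq)
qed

text \<open>Bridge from families to the sets counted by \<open>abelian_rank\<close>. An independent
  family is injective, since a repeated value would give a relation with coefficients 1 and -1;
  hence its image is an independent set of the same size.\<close>

lemma abelian_rank_eq:
  assumes "has_rank G (carrier G) r"
  shows "abelian_rank G = r"
proof -
  have le: "card S \<le> r" if "int_independent G S" for S
  proof -
    have "rank_ge G (carrier G) (card S)"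
      by (rule rank_geI[of S _ id])
         (use that in \<open>auto simp: int_independent_def indep_family_def int_comb_def\<close>)
    then show ?thesis using assms rank_ge_mono[of "carrier G" "card S" "Suc r" "carrier G"]
      by (force simp: has_rank_def not_less_eq_eq)
  qed
  obtain J :: "nat set" and g where J: "finite J" "card J = r" "g \<in> J \<rightarrow> carrier G" "indep_family G J g"
    using assms unfolding has_rank_def rank_ge_def by blast
  have inj: "inj_on g J"
  proof (rule inj_onI)
    fix i j assume ij: "i \<in> J" "j \<in> J" "g i = g j"
    show "i = j"
    proof (rule ccontr)
      assume ne: "i \<noteq> j"
      let ?c = "\<lambda>k. if k = i then 1 else if k = j then -1 else (0::int)"
      have "int_comb G J g ?c = int_comb G {i,j} g ?c"
        by (rule int_comb_mono_neutral) (use J ij in auto)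
      also have "\<dots> = g i [^] (1::int) \<otimes> g j [^] (-1::int)"
        unfolding int_comb_def using J ij ne by (auto simp: Pi_iff)
      also have "\<dots> = \<one>" using ij J by (auto simp: int_pow_neg Pi_iff)
      finally have "?c i = 0" using J(4) ij unfolding indep_family_def by blast
      then show False by simp
    qed
  qed
  have "int_independent G (g ` J)"
    unfolding int_independent_def
  proof (intro conjI allI impI)
    show "finite (g ` J)" "g ` J \<subseteq> carrier G" using J by auto
    fix c :: "_ \<Rightarrow> int"
    assume "(\<Otimes>x\<in>g ` J. x [^] c x) = \<one>"
    then have "int_comb G J g (c \<circ> g) = \<one>"
      unfolding int_comb_def using J inj by (subst (asm) finprod_reindex) auto
    then show "\<forall>x\<in>g ` J. c x = 0" using J(4) unfolding indep_family_def by auto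
  qed
  moreover have "card (g ` J) = r" using inj J by (simp add: card_image)
  ultimately show ?thesis unfolding abelian_rank_def
    using le by (intro cSup_eq_maximum) auto
qed

end

section \<open>Ranks of kernels and images\<close>

lemma int_comb_hom:
  assumes "comm_group G" "comm_group H" "f \<in> hom G H" "finite J" "g \<in> J \<rightarrow> carrier G"
  shows "f (int_comb G J g c) = int_comb H J (f \<circ> g) c"
proof -
  interpret G: comm_group G by fact
  interpret H: comm_group H by fact
  interpret f: group_hom G H f using assms by unfold_locales auto
  show ?thesis using assms(4,5)
  proof (induction J rule: finite_induct)
    case (insert x J)
    have "int_comb G (insert x J) g c = g x [^]\<^bsub>G\<^esub> c x \<otimes>\<^bsub>G\<^esub> int_comb G J g c"
      using insert unfolding int_comb_def by (subst G.finprod_insert) auto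
    moreover have "int_comb H (insert x J) (f \<circ> g) c = f (g x) [^]\<^bsub>H\<^esub> c x \<otimes>\<^bsub>H\<^esub> int_comb H J (f \<circ> g) c"
      using insert unfolding int_comb_def by (subst H.finprod_insert) (auto simp: Pi_iff)
    ultimately show ?case using insert G.int_comb_closed[of g J c]
      by (simp add: Pi_iff f.hom_int_pow del: o_apply)
  qed (simp add: int_comb_def)
qed

text \<open>The relations form a triangular array, with pivots \<open>p\<close>, hence are independent.\<close>

lemma (in comm_group) triangular_relations:
  assumes "\<not> rank_ge G S (Suc b)" "S \<subseteq> carrier G"
  shows "finite (J :: nat set) \<Longrightarrow> card J = b + m \<Longrightarrow> g \<in> J \<rightarrow> S \<Longrightarrow>
     \<exists>c p. \<forall>j<m. p j \<in> J \<and> int_comb G J g (c j) = \<one> \<and> c j (p j) \<noteq> 0 \<and>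
        (\<forall>k. j < k \<longrightarrow> k < m \<longrightarrow> c k (p j) = 0)"
proof (induction m arbitrary: J)
  case 0 then show ?case by auto
next
  case (Suc m)
  have "Suc b \<le> card J" using Suc.prems by simp
  then obtain I where I: "I \<subseteq> J" "card I = Suc b" by (meson obtain_subset_with_card_n)
  have gI: "g \<in> I \<rightarrow> S" and gc: "g \<in> J \<rightarrow> carrier G" using I Suc.prems assms(2) by auto
  have "finite I" using I Suc.prems finite_subset by blast
  then have "\<not> indep_family G I g" using assms(1) gI I(2) unfolding rank_ge_def by blast
  then obtain c0 p0 where c0: "int_comb G I g c0 = \<one>" "p0 \<in> I" "c0 p0 \<noteq> 0"
    unfolding indep_family_def by blast
  define c0' where "c0' = (\<lambda>i. if i \<in> I then c0 i else 0)"
  have "int_comb G J g c0' = int_comb G I g c0'"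
    by (rule int_comb_mono_neutral) (use I Suc.prems gc in \<open>auto simp: c0'_def\<close>)
  also have "\<dots> = int_comb G I g c0"
    by (rule int_comb_cong) (use I Suc.prems gc in \<open>auto simp: c0'_def\<close>)
  finally have c0': "int_comb G J g c0' = \<one>" "c0' p0 \<noteq> 0" using c0 by (auto simp: c0'_def)
  have p0: "p0 \<in> J" using c0 I by auto
  have "\<exists>c p. \<forall>j<m. p j \<in> J - {p0} \<and> int_comb G (J - {p0}) g (c j) = \<one> \<and> c j (p j) \<noteq> 0 \<and>
        (\<forall>k. j < k \<longrightarrow> k < m \<longrightarrow> c k (p j) = 0)"
    by (rule Suc.IH) (use Suc.prems p0 in auto)
  then obtain c p where cp: "\<And>j. j < m \<Longrightarrow> p j \<in> J - {p0} \<and> int_comb G (J - {p0}) g (c j) = \<one> \<and>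
        c j (p j) \<noteq> 0 \<and> (\<forall>k. j < k \<longrightarrow> k < m \<longrightarrow> c k (p j) = 0)" by blast
  \<comment> \<open>The relations found for \<open>J - {p0}\<close> are set to 0 at
    \<open>p0\<close>; these are the zeros behind the first pivot.\<close>
  define c' where "c' = (\<lambda>j. case j of 0 \<Rightarrow> c0' | Suc j \<Rightarrow> (\<lambda>i. if i = p0 then 0 else c j i))"
  define p' where "p' = (\<lambda>j. case j of 0 \<Rightarrow> p0 | Suc j \<Rightarrow> p j)"
  have "int_comb G J g (c' (Suc j)) = \<one>" if "j < m" for j
  proof -
    have "int_comb G J g (c' (Suc j)) = int_comb G (J - {p0}) g (c' (Suc j))"
      by (rule int_comb_mono_neutral) (use Suc.prems gc in \<open>auto simp: c'_def\<close>)
    also have "\<dots> = int_comb G (J - {p0}) g (c j)"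
      by (rule int_comb_cong) (use Suc.prems gc in \<open>auto simp: c'_def\<close>)
    finally show ?thesis using cp[OF that] by simp
  qed
  then have "\<forall>j<Suc m. p' j \<in> J \<and> int_comb G J g (c' j) = \<one> \<and> c' j (p' j) \<noteq> 0 \<and>
        (\<forall>k. j < k \<longrightarrow> k < Suc m \<longrightarrow> c' k (p' j) = 0)"
    using cp c0' p0 by (auto simp: c'_def p'_def split: nat.split)
  then show ?case by blast
qed

text \<open>A rank-nullity inequality without division. The images of \<open>b + m\<close>
  independent elements satisfy \<open>m\<close> independent integer relations, and the combinations
  of the elements with these coefficients lie in the kernel.\<close>

lemma rank_ge_kernel:
  assumes "comm_group G" "comm_group H" "f \<in> hom G H"
    and "rank_ge G (carrier G) (b + m)" "\<not> rank_ge H (f ` carrier G) (Suc b)"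
  shows "rank_ge G (kernel G H f) m"
proof -
  interpret G: comm_group G by fact
  interpret H: comm_group H by fact
  interpret f: group_hom G H f using assms by unfold_locales auto
  obtain J :: "nat set" and g where J: "finite J" "card J = b + m" "g \<in> J \<rightarrow> carrier G" "indep_family G J g"
    using assms unfolding rank_ge_def by blast
  have fg: "f \<circ> g \<in> J \<rightarrow> f ` carrier G" using J(3) by auto
  have fI: "f ` carrier G \<subseteq> carrier H" by auto
  have "\<exists>c p. \<forall>j<m. p j \<in> J \<and> int_comb H J (f \<circ> g) (c j) = \<one>\<^bsub>H\<^esub> \<and> c j (p j) \<noteq> 0 \<and>
        (\<forall>k. j < k \<longrightarrow> k < m \<longrightarrow> c k (p j) = 0)"
    by (rule H.triangular_relations[OF assms(5) fI J(1,2) fg])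
  then obtain c p where cp': "\<forall>j<m. p j \<in> J \<and> int_comb H J (f \<circ> g) (c j) = \<one>\<^bsub>H\<^esub> \<and> c j (p j) \<noteq> 0 \<and>
        (\<forall>k. j < k \<longrightarrow> k < m \<longrightarrow> c k (p j) = 0)"
    by blast
  note cp = cp'[rule_format]
  define x where "x = (\<lambda>j. int_comb G J g (c j))"
  have "indep_family G {..<m} x"
    unfolding indep_family_def
  proof (intro allI impI)
    fix d assume d: "int_comb G {..<m} x d = \<one>\<^bsub>G\<^esub>"
    then have "int_comb G J g (\<lambda>i. \<Sum>j<m. d j * c j i) = \<one>\<^bsub>G\<^esub>"
      unfolding x_def by (subst (asm) G.int_comb_int_comb) (use J in auto)
    then have z: "(\<Sum>j<m. d j * c j i) = 0" if "i \<in> J" for i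
      using J(4) that unfolding indep_family_def by blast
    have "j < m \<Longrightarrow> d j = 0" for j
    proof (induction j rule: less_induct)
      case (less j)
      \<comment> \<open>At the pivot \<open>p j\<close> the terms with \<open>k > j\<close> vanish
        by triangularity and those with \<open>k < j\<close> by induction, which leaves
        \<open>d j * c j (p j)\<close>.\<close>
      have "(\<Sum>k<m. d k * c k (p j)) = (\<Sum>k\<in>{j}. d k * c k (p j))"
        using less cp[OF less.prems] by (intro sum.mono_neutral_right) (auto simp: not_less_iff_gr_or_eq neq_iff)
      then show ?case using z[of "p j"] cp[OF less.prems] by simp
    qed
    then show "\<forall>i\<in>{..<m}. d i = 0" by auto
  qed
  moreover have "x \<in> {..<m} \<rightarrow> kernel G H f"
    using cp J int_comb_hom[OF assms(1-3) J(1,3)] G.int_comb_closed[OF J(3)]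
    by (auto simp: kernel_def x_def)
  ultimately show ?thesis
    by (intro G.rank_geI[of "{..<m}" m x]) (auto simp: kernel_def)
qed

text \<open>A kernel family and lifts of an image family are jointly independent: \<open>f\<close>
  kills the kernel part of a relation, which forces the coefficients of the lifts to be 0, and then
  the kernel part is a relation by itself.\<close>

lemma rank_ge_kernel_image:
  assumes "comm_group G" "comm_group H" "f \<in> hom G H"
    and "rank_ge G (kernel G H f) a" "rank_ge H (f ` carrier G) b"
  shows "rank_ge G (carrier G) (a + b)"
proof -
  interpret G: comm_group G by fact
  interpret H: comm_group H by fact
  interpret f: group_hom G H f using assms by unfold_locales auto
  obtain J :: "nat set" and g where J: "finite J" "card J = a" "g \<in> J \<rightarrow> kernel G H f" "indep_family G J g"
    using assms unfolding rank_ge_def by blast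
  obtain I :: "nat set" and h where I: "finite I" "card I = b" "h \<in> I \<rightarrow> f ` carrier G" "indep_family H I h"
    using assms unfolding rank_ge_def by blast
  have "\<exists>y. \<forall>i\<in>I. y i \<in> carrier G \<and> f (y i) = h i"
    using I(3) by (intro bchoice) (auto simp: Pi_iff image_iff, metis)
  then obtain y where y: "\<And>i. i \<in> I \<Longrightarrow> y i \<in> carrier G \<and> f (y i) = h i" by blast
  define k where "k = case_sum g y"
  have gk: "g \<in> J \<rightarrow> carrier G" using J(3) by (auto simp: kernel_def)
  have kc: "k \<in> Inl ` J \<union> Inr ` I \<rightarrow> carrier G"
    using gk y by (auto simp: k_def)
  have split: "int_comb G (Inl ` J \<union> Inr ` I) k c = int_comb G J g (c \<circ> Inl) \<otimes>\<^bsub>G\<^esub> int_comb G I y (c \<circ> Inr)" for c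
  proof -
    have "int_comb G (Inl ` J \<union> Inr ` I) k c = int_comb G (Inl ` J) k c \<otimes>\<^bsub>G\<^esub> int_comb G (Inr ` I) k c"
      by (rule G.int_comb_Un) (use J I kc in auto)
    moreover have "int_comb G (Inl ` J) k c = int_comb G J g (c \<circ> Inl)"
      using kc by (subst G.int_comb_reindex) (auto simp: k_def o_def)
    moreover have "int_comb G (Inr ` I) k c = int_comb G I y (c \<circ> Inr)"
      using kc by (subst G.int_comb_reindex) (auto simp: k_def o_def)
    ultimately show ?thesis by simp
  qed
  have "indep_family G (Inl ` J \<union> Inr ` I) k"
    unfolding indep_family_def
  proof (intro allI impI)
    fix c assume c: "int_comb G (Inl ` J \<union> Inr ` I) k c = \<one>\<^bsub>G\<^esub>"
    have yc: "y \<in> I \<rightarrow> carrier G" using y by auto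
    have 1: "f (int_comb G J g (c \<circ> Inl)) = \<one>\<^bsub>H\<^esub>"
    proof -
      have "f (int_comb G J g (c \<circ> Inl)) = int_comb H J (f \<circ> g) (c \<circ> Inl)"
        by (rule int_comb_hom) (use assms J gk in auto)
      also have "\<dots> = int_comb H J (\<lambda>_. \<one>\<^bsub>H\<^esub>) (c \<circ> Inl)"
        by (rule H.int_comb_cong) (use J in \<open>auto simp: kernel_def\<close>)
      finally show ?thesis by (simp add: int_comb_def)
    qed
    have "f (int_comb G I y (c \<circ> Inr)) = int_comb H I (f \<circ> y) (c \<circ> Inr)"
      by (rule int_comb_hom) (use assms I yc in auto)
    also have "\<dots> = int_comb H I h (c \<circ> Inr)"
      by (rule H.int_comb_cong) (use I y in force)+
    finally have 2: "f (int_comb G I y (c \<circ> Inr)) = int_comb H I h (c \<circ> Inr)" .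
    have "f (int_comb G J g (c \<circ> Inl) \<otimes>\<^bsub>G\<^esub> int_comb G I y (c \<circ> Inr)) = \<one>\<^bsub>H\<^esub>"
      using c split by simp
    then have "int_comb H I h (c \<circ> Inr) = \<one>\<^bsub>H\<^esub>"
      using 1 2 G.int_comb_closed[OF gk] G.int_comb_closed[OF yc] f.hom_closed by (metis H.l_one f.hom_mult)
    then have cI: "c (Inr i) = 0" if "i \<in> I" for i
      using I(4) that unfolding indep_family_def by auto
    then have "int_comb G I y (c \<circ> Inr) = int_comb G I y (\<lambda>_. 0)"
      by (intro G.int_comb_cong) (use yc in auto)
    then have "int_comb G J g (c \<circ> Inl) = \<one>\<^bsub>G\<^esub>"
      using c split[of c] G.int_comb_closed[OF gk] by (simp add: G.int_comb_zero)
    then have "c (Inl i) = 0" if "i \<in> J" for i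
      using J(4) that unfolding indep_family_def by auto
    with cI show "\<forall>i\<in>Inl ` J \<union> Inr ` I. c i = 0" by auto
  qed
  then show ?thesis
    using J I kc card_Un_disjoint[of "Inl ` J" "Inr ` I"]
    by (intro G.rank_geI[of "Inl ` J \<union> Inr ` I" _ k]) (auto simp: card_image)
qed

text \<open>Additivity of the rank along a homomorphism. The upper bound is indirect: one
  independent element more in the group would give \<open>Suc a\<close> independent elements in the
  kernel.\<close>

lemma has_rank_carrier:
  assumes "comm_group G" "comm_group H" "f \<in> hom G H"
    and "has_rank G (kernel G H f) a" "has_rank H (f ` carrier G) b"
  shows "has_rank G (carrier G) (a + b)"
  using assms rank_ge_kernel_image[OF assms(1-3)] rank_ge_kernel[OF assms(1-3), of b "Suc a"]
  unfolding has_rank_def by (auto simp: add.commute)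

lemma rank_ge_image:
  assumes "comm_group G" "comm_group H" "f \<in> hom G H" "rank_ge H (f ` carrier G) b"
  shows "rank_ge G (carrier G) b"
  using rank_ge_kernel_image[OF assms(1-3) comm_group.rank_ge_0[OF assms(1)] assms(4)] by simp

lemma rank_ge_iso:
  assumes "comm_group G" "comm_group H" "G \<cong> H" "rank_ge G (carrier G) r"
  shows "rank_ge H (carrier H) r"
proof -
  interpret G: comm_group G by fact
  interpret H: comm_group H by fact
  have "H \<cong> G" using assms(3) G.iso_sym by blast
  then obtain f where "f \<in> iso H G" by (auto simp: is_iso_def)
  then have "f \<in> hom H G" "f ` carrier H = carrier G" by (auto simp: iso_def bij_betw_def)
  with rank_ge_image[OF assms(2,1)] assms(4) show ?thesis by auto
qed

lemma has_rank_iso: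
  assumes "comm_group G" "comm_group H" "G \<cong> H" "has_rank G (carrier G) r"
  shows "has_rank H (carrier H) r"
  using rank_ge_iso[OF assms(1-3)] assms(4)
    rank_ge_iso[OF assms(2,1) group.iso_sym[OF comm_group.axioms(2)[OF assms(1)] assms(3)]]
  unfolding has_rank_def by metis

lemma has_rank_trivial:
  assumes "comm_group G" "S \<subseteq> {\<one>\<^bsub>G\<^esub>}"
  shows "has_rank G S 0"
proof -
  interpret G: comm_group G by fact
  have False if "finite J" "card J = 1" "g \<in> J \<rightarrow> S" "indep_family G J g" for J :: "nat set" and g
  proof -
    have "int_comb G J g (\<lambda>_. 1) = int_comb G J (\<lambda>_. \<one>\<^bsub>G\<^esub>) (\<lambda>_. 1)"
      by (rule G.int_comb_cong) (use that assms in auto)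
    then have "int_comb G J g (\<lambda>_. 1) = \<one>\<^bsub>G\<^esub>" by (simp add: int_comb_def)
    then have "\<forall>i\<in>J. (1::int) = 0" using that unfolding indep_family_def by blast
    then show False using that by auto
  qed
  then show ?thesis unfolding has_rank_def using G.rank_ge_0 by (auto simp: rank_ge_def)
qed

lemma has_rank_integer_group: "has_rank integer_group (carrier integer_group) 1"
proof -
  interpret comm_group integer_group by (rule abelian_integer_group)
  have ic: "int_comb integer_group J g c = (\<Sum>i\<in>J. g i * c i)" if "finite J" for J :: "nat set" and g c
    using that
  proof (induction J rule: finite_induct)
    case (insert x J)
    have "int_comb integer_group (insert x J) g c = g x [^]\<^bsub>integer_group\<^esub> c x \<otimes>\<^bsub>integer_group\<^esub> int_comb integer_group J g c"
      unfolding int_comb_def using insert by (subst finprod_insert) auto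
    then show ?case using insert by simp
  qed (simp add: int_comb_def)
  have "rank_ge integer_group UNIV 1"
    unfolding rank_ge_def
    by (intro exI[of _ "{0}"] exI[of _ "\<lambda>_. 1"]) (simp add: indep_family_def ic)
  moreover
  have "\<not> indep_family integer_group J g" if "card J = 2" for J :: "nat set" and g
  proof
    assume ind: "indep_family integer_group J g"
    obtain i j where ij: "J = {i, j}" "i \<noteq> j" using \<open>card J = 2\<close> by (metis card_2_iff)
    have *: "\<forall>k\<in>J. c k = 0" if "g i * c i + g j * c j = 0" for c
      using ind that ij unfolding indep_family_def by (auto simp: ic)
    show False
    proof (cases "g i = 0")
      case True
      then show False using *[of "\<lambda>k. if k = i then 1 else 0"] ij by auto
    next
      case False
      \<comment> \<open>Any two integers satisfy the relation
        \<open>g i * g j - g j * g i = 0\<close>, here with the nonzero coefficient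
        \<open>- g i\<close>.\<close>
      then show False using *[of "\<lambda>k. if k = i then g j else - g i"] ij by auto
    qed
  qed
  then have "\<not> rank_ge integer_group UNIV (Suc 1)"
    unfolding rank_ge_def by (metis Suc_1)
  ultimately show ?thesis unfolding has_rank_def by simp
qed


section \<open>Additivity of the Euler characteristic\<close>

text \<open>In contrast to \<open>euler_char\<close>, which has a junk value for spaces of infinite type, this relation
  only holds if the total rank is finite.\<close>

definition graded_euler :: "(int \<Rightarrow> ('a, 'b) monoid_scheme) \<Rightarrow> int \<Rightarrow> bool" where
  "graded_euler H e \<longleftrightarrow> (\<exists>r. (\<forall>p. has_rank (H (int p)) (carrier (H (int p))) (r p)) \<and>
     finite {p. r p \<noteq> 0} \<and> e = (\<Sum>p | r p \<noteq> 0. (-1) ^ p * int (r p)))"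

definition euler_is :: "'a topology \<Rightarrow> int \<Rightarrow> bool" where
  "euler_is X = graded_euler (\<lambda>p. homology_group p X)"

lemma euler_is_imp_euler_char:
  assumes "euler_is X e"
  shows "euler_char X = e"
proof -
  obtain r where r: "\<And>p. has_rank (homology_group (int p) X) (carrier (homology_group (int p) X)) (r p)"
    "e = (\<Sum>p | r p \<noteq> 0. (-1) ^ p * int (r p))"
    using assms unfolding euler_is_def graded_euler_def by blast
  have "betti_number p X = r p" for p
    unfolding betti_number_def by (rule comm_group.abelian_rank_eq[OF abelian_homology_group r(1)])
  then show ?thesis using r(2) by (simp add: euler_char_def)
qed

lemma graded_euler_iso:
  assumes "\<And>p. comm_group (G p)" "\<And>p. comm_group (H p)" "\<And>p. G p \<cong> H p" "graded_euler G e"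
  shows "graded_euler H e"
  using assms has_rank_iso unfolding graded_euler_def by metis

lemma euler_is_homotopy_equivalent:
  assumes "X homotopy_equivalent_space Y" "euler_is X e"
  shows "euler_is Y e"
  using assms graded_euler_iso[of "\<lambda>p. homology_group p X" "\<lambda>p. homology_group p Y"]
  unfolding euler_is_def
  by (auto simp: abelian_homology_group homotopy_equivalent_space_imp_isomorphic_homology_groups)

lemma graded_eulerI:
  assumes "\<And>p. has_rank (H (int p)) (carrier (H (int p))) (r p)" "\<And>p. p \<ge> N \<Longrightarrow> r p = 0"
  shows "graded_euler H (\<Sum>p<N. (-1) ^ p * int (r p))"
proof -
  have fin: "{p. r p \<noteq> 0} \<subseteq> {..<N}" using assms(2) by (metis (mono_tags) lessThan_iff mem_Collect_eq not_le subsetI)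
  then have "(\<Sum>p | r p \<noteq> 0. (-1) ^ p * int (r p)) = (\<Sum>p<N. (-1) ^ p * int (r p))"
    by (intro sum.mono_neutral_left) auto
  then show ?thesis
    unfolding graded_euler_def using assms finite_subset[OF fin] by (intro exI[of _ r]) auto
qed

lemma graded_eulerE:
  assumes "graded_euler H e"
  obtains r N where "\<And>p. has_rank (H (int p)) (carrier (H (int p))) (r p)" "\<And>p. p \<ge> N \<Longrightarrow> r p = 0"
proof -
  obtain r where r: "\<forall>p. has_rank (H (int p)) (carrier (H (int p))) (r p)" "finite {p. r p \<noteq> 0}"
    using assms unfolding graded_euler_def by blast
  obtain N where "\<forall>p\<in>{p. r p \<noteq> 0}. p < N" using r(2) finite_nat_set_iff_bounded by blast
  then have "\<And>p. p \<ge> N \<Longrightarrow> r p = 0" using not_less by blast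
  with r(1) that show ?thesis by blast
qed

section \<open>Ranks in the long exact sequence\<close>

lemma has_rank_image_exists:
  assumes "comm_group G" "comm_group H" "f \<in> hom G H"
    and "has_rank G (carrier G) r \<or> has_rank H (carrier H) r"
  shows "\<exists>a\<le>r. has_rank H (f ` carrier G) a"
proof -
  interpret H: comm_group H by fact
  have "\<not> rank_ge H (f ` carrier G) (Suc r)"
    using assms(4)
  proof
    assume "has_rank G (carrier G) r"
    then show ?thesis using rank_ge_image[OF assms(1-3)] unfolding has_rank_def by blast
  next
    assume "has_rank H (carrier H) r"
    then show ?thesis
      using H.rank_ge_mono[of "f ` carrier G" "Suc r" "Suc r" "carrier H"] assms(3)
      unfolding has_rank_def by (auto simp: hom_def Pi_iff)
  qed
  then show ?thesis using H.has_rank_exists less_Suc_eq_le by blast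
qed

text \<open>One end of finite type suffices, because the rank of an image is bounded by the ranks of
  both source and target.\<close>

lemma rank_images_exist:
  assumes "\<And>p. comm_group (G (int p))" "\<And>p. comm_group (H (int p))" "\<And>p. f p \<in> hom (G (int p)) (H (int p))"
    and "(\<exists>e. graded_euler G e) \<or> (\<exists>e. graded_euler H e)"
  shows "\<exists>a N. (\<forall>p. has_rank (H (int p)) (f p ` carrier (G (int p))) (a p)) \<and> (\<forall>p\<ge>N. a p = (0::nat))"
proof -
  obtain r N where r: "\<And>p. has_rank (G (int p)) (carrier (G (int p))) (r p) \<or> has_rank (H (int p)) (carrier (H (int p))) (r p)"
    "\<And>p::nat. p \<ge> N \<Longrightarrow> r p = 0"
    using assms(4) by (metis graded_eulerE)
  have "\<forall>p. \<exists>a\<le>r p. has_rank (H (int p)) (f p ` carrier (G (int p))) a"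
    using has_rank_image_exists[OF assms(1-3) r(1)] by blast
  then obtain a where a: "\<And>p. a p \<le> r p \<and> has_rank (H (int p)) (f p ` carrier (G (int p))) (a p)"
    by metis
  show ?thesis using a r(2) by (intro exI[of _ a] exI[of _ N]) (metis le_zero_eq)
qed

lemma alternating_sum_telescope:
  "(\<Sum>p<N. (-1) ^ p * int (c (Suc p)) + (-1) ^ p * int (c p)) = int (c 0) - (-1) ^ N * int (c N)"
  by (induction N) (auto simp: algebra_simps)

text \<open>The three disjunctions together say that at least two of the three graded groups have
  finite total rank. With \<open>a\<close>, \<open>b\<close>, \<open>c\<close> the ranks of the
  images of the three maps, exactness gives the ranks \<open>c (Suc p) + a p\<close>,
  \<open>a p + b p\<close> and \<open>b p + c p\<close>. In the alternating sum \<open>a\<close> and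
  \<open>b\<close> cancel degree by degree, and \<open>c\<close> telescopes.\<close>

lemma euler_long_exact_sequence:
  fixes X :: "'a topology" and S
  defines "A \<equiv> \<lambda>p. homology_group p (subtopology X S)" and "R \<equiv> \<lambda>p. relative_homology_group p X S"
    and "HX \<equiv> \<lambda>p. homology_group p X"
  assumes AX: "(\<exists>e. graded_euler A e) \<or> (\<exists>e. graded_euler HX e)"
    and XR: "(\<exists>e. graded_euler HX e) \<or> (\<exists>e. graded_euler R e)"
    and AR: "(\<exists>e. graded_euler A e) \<or> (\<exists>e. graded_euler R e)"
  shows "\<exists>eA eR. graded_euler A eA \<and> graded_euler R eR \<and> graded_euler HX (eA + eR)"
proof -
  have comm: "comm_group (A p)" "comm_group (HX p)" "comm_group (R p)" for p
    by (auto simp: A_def HX_def R_def)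
  define i where "i = (\<lambda>p. hom_induced p (subtopology X S) {} X {} id)"
  define j where "j = (\<lambda>p. hom_induced p X {} X S id)"
  define d where "d = (\<lambda>p. hom_boundary p X S)"
  have hom: "i p \<in> hom (A p) (HX p)" "j p \<in> hom (HX p) (R p)" "d p \<in> hom (R p) (A (p - 1))" for p
    using homology_exactness_axiom_1[of p X S] homology_exactness_axiom_2[of p X S] homology_exactness_axiom_3[of p X S]
    unfolding A_def HX_def R_def i_def j_def d_def by (auto simp: group_hom_def group_hom_axioms_def)
  have ker: "kernel (HX p) (R p) (j p) = i p ` carrier (A p)"
    "kernel (R p) (A (p - 1)) (d p) = j p ` carrier (HX p)"
    "kernel (A (p - 1)) (HX (p - 1)) (i (p - 1)) = d p ` carrier (R p)" for p
    using homology_exactness_axiom_1[of p X S] homology_exactness_axiom_2[of p X S] homology_exactness_axiom_3[of p X S]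
    unfolding A_def HX_def R_def i_def j_def d_def by auto
  obtain a Na where a: "\<And>p. has_rank (HX (int p)) (i (int p) ` carrier (A (int p))) (a p)" "\<And>p. p \<ge> Na \<Longrightarrow> a p = 0"
    using rank_images_exist[of A HX "\<lambda>p. i (int p)", OF comm(1) comm(2) hom(1) AX] by blast
  obtain b Nb where b: "\<And>p. has_rank (R (int p)) (j (int p) ` carrier (HX (int p))) (b p)" "\<And>p. p \<ge> Nb \<Longrightarrow> b p = 0"
    using rank_images_exist[of HX R "\<lambda>p. j (int p)", OF comm(2) comm(3) hom(2) XR] by blast
  have "\<exists>c N. (\<forall>p. has_rank (A (int p)) (d (int (Suc p)) ` carrier (R (int (Suc p)))) (c p)) \<and> (\<forall>p\<ge>N. c p = (0::nat))"
    using AR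
  proof
    assume *: "\<exists>e. graded_euler A e"
    have "d (int (Suc p)) \<in> hom (R (int p + 1)) (A (int p))" for p
      using hom(3)[of "int (Suc p)"] by (simp add: add.commute)
    from rank_images_exist[of "\<lambda>p. R (p + 1)" A, OF comm(3) comm(1) this disjI2[OF *]]
    show ?thesis by (simp add: add.commute)
  next
    assume "\<exists>e. graded_euler R e"
    then obtain e where "graded_euler R e" ..
    then obtain r N where r: "\<And>p. has_rank (R (int p)) (carrier (R (int p))) (r p)" "\<And>p. p \<ge> N \<Longrightarrow> r p = 0"
      using graded_eulerE[of R e] by metis
    have "\<exists>c\<le>r (Suc p). has_rank (A (int p)) (d (int (Suc p)) ` carrier (R (int (Suc p)))) c" for p
      using has_rank_image_exists[OF comm(3) comm(1) hom(3)[of "int (Suc p)"]] r(1)[of "Suc p"] by simp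
    then obtain c where "\<And>p. c p \<le> r (Suc p) \<and> has_rank (A (int p)) (d (int (Suc p)) ` carrier (R (int (Suc p)))) (c p)"
      by metis
    then show ?thesis using r(2) by (intro exI[of _ c] exI[of _ N]) (metis le_Suc_eq le_zero_eq)
  qed
  then obtain c' Nc where c': "\<And>p. has_rank (A (int p)) (d (int (Suc p)) ` carrier (R (int (Suc p)))) (c' p)"
    "\<And>p. p \<ge> Nc \<Longrightarrow> c' p = 0"
    by blast
  \<comment> \<open>\<open>c p\<close> belongs to the boundary map that leaves degree
    \<open>p\<close>. In degree 0 its target is the homology in degree -1, which is trivial, hence
    the value 0.\<close>
  define c where "c = (\<lambda>p. case p of 0 \<Rightarrow> 0 | Suc q \<Rightarrow> c' q)"
  have c: "has_rank (A (int p - 1)) (d (int p) ` carrier (R (int p))) (c p)" for p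
  proof (cases p)
    case 0
    have "carrier (A (-1)) = {\<one>\<^bsub>A (-1)\<^esub>}"
      by (simp add: A_def relative_homology_group_def singleton_group_def)
    then have "d 0 ` carrier (R 0) \<subseteq> {\<one>\<^bsub>A (-1)\<^esub>}"
      using hom(3)[of 0] by (auto simp: hom_def)
    then show ?thesis using has_rank_trivial[OF comm(1)] 0 by (auto simp: c_def)
  next
    case (Suc q)
    then show ?thesis using c'(1)[of q] by (simp add: c_def)
  qed
  have rA: "has_rank (A (int p)) (carrier (A (int p))) (c (Suc p) + a p)" for p
    by (rule has_rank_carrier[OF comm(1) comm(2) hom(1)[of "int p"] _ a(1)])
       (use ker(3)[of "int (Suc p)"] c'(1)[of p] in \<open>simp add: c_def\<close>)
  have rX: "has_rank (HX (int p)) (carrier (HX (int p))) (a p + b p)" for p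
    by (rule has_rank_carrier[OF comm(2) comm(3) hom(2)[of "int p"] _ b(1)]) (simp add: ker a)
  have rR: "has_rank (R (int p)) (carrier (R (int p))) (b p + c p)" for p
    by (rule has_rank_carrier[OF comm(3) comm(1) hom(3)[of "int p"] _ c(1)]) (simp add: ker b)
  \<comment> \<open>The successor compensates the shift by one between \<open>c\<close> and
    \<open>c'\<close>.\<close>
  define N where "N = Suc (max Na (max Nb Nc))"
  have z: "a p = 0" "b p = 0" "c p = 0" "c (Suc p) = 0" if "p \<ge> N" for p
    using that a(2) b(2) c'(2) by (auto simp: N_def c_def split: nat.split)
  note E = graded_eulerI[of A "\<lambda>p. c (Suc p) + a p" N, OF rA] graded_eulerI[of HX "\<lambda>p. a p + b p" N, OF rX]
    graded_eulerI[of R "\<lambda>p. b p + c p" N, OF rR]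
  have "(\<Sum>p<N. (-1) ^ p * int (a p + b p))
      = (\<Sum>p<N. (-1) ^ p * int (c (Suc p) + a p)) + (\<Sum>p<N. (-1) ^ p * int (b p + c p))
        - (\<Sum>p<N. (-1) ^ p * int (c (Suc p)) + (-1) ^ p * int (c p))"
    by (simp add: sum.distrib algebra_simps)
  also have "(\<Sum>p<N. (-1) ^ p * int (c (Suc p)) + (-1) ^ p * int (c p)) = 0"
    unfolding alternating_sum_telescope using z(3)[of N] by (simp add: c_def)
  finally show ?thesis using E z by (intro exI[of _ "\<Sum>p<N. (-1) ^ p * int (c (Suc p) + a p)"]
      exI[of _ "\<Sum>p<N. (-1) ^ p * int (b p + c p)"]) auto
qed

lemma graded_euler_unique:
  assumes "\<And>p. comm_group (H p)" "graded_euler H e" "graded_euler H e'"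
  shows "e = e'"
proof -
  obtain r where r: "\<And>p. has_rank (H (int p)) (carrier (H (int p))) (r p)"
    "e = (\<Sum>p | r p \<noteq> 0. (-1) ^ p * int (r p))"
    using assms(2) unfolding graded_euler_def by blast
  obtain r' where r': "\<And>p. has_rank (H (int p)) (carrier (H (int p))) (r' p)"
    "e' = (\<Sum>p | r' p \<noteq> 0. (-1) ^ p * int (r' p))"
    using assms(3) unfolding graded_euler_def by blast
  have "r = r'" using comm_group.has_rank_unique[OF assms(1) r(1) r'(1)] by auto
  then show ?thesis using r r' by simp
qed

lemma euler_is_unique: "euler_is X e \<Longrightarrow> euler_is X e' \<Longrightarrow> e = e'"
  unfolding euler_is_def by (rule graded_euler_unique) auto

section \<open>Excision and Mayer-Vietoris\<close>

lemma euler_is_relative_excision: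
  assumes "openin X A" "openin X B" "topspace X = A \<union> B" "graded_euler (\<lambda>p. relative_homology_group p (subtopology X B) (A \<inter> B)) e"
  shows "graded_euler (\<lambda>p. relative_homology_group p X A) e"
proof (rule graded_euler_iso[OF _ _ _ assms(4)])
  fix p
  \<comment> \<open>The excised set is the complement of \<open>B\<close>: it is closed and lies in
    the open set \<open>A\<close>, as excision demands.\<close>
  define U where "U = topspace X - B"
  have AB: "A \<subseteq> topspace X" "B \<subseteq> topspace X" using assms openin_subset by auto
  have "closedin X U" unfolding U_def using assms by blast
  then have "X closure_of U \<subseteq> X interior_of A"
    using assms(1,3) by (simp add: closure_of_closedin interior_of_openin) (auto simp: U_def)
  then have "hom_induced p (subtopology X (topspace X - U)) (A - U) (subtopology X (topspace X)) A id
      \<in> iso (relative_homology_group p (subtopology X (topspace X - U)) (A - U))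
            (relative_homology_group p (subtopology X (topspace X)) A)"
    by (rule homology_excision_axiom) (use AB in auto)
  moreover have "topspace X - U = B" "A - U = A \<inter> B" using AB by (auto simp: U_def)
  ultimately show "relative_homology_group p (subtopology X B) (A \<inter> B) \<cong> relative_homology_group p X A"
    by (auto simp: is_iso_def)
qed auto

text \<open>By excision the pairs \<open>(X, A)\<close> and \<open>(B, A \<inter> B)\<close> have
  isomorphic relative groups, so their two exact sequences share the relative Euler characteristic.
  Either the value of \<open>A\<close> or that of \<open>X\<close> may be the given one, because
  removals are later used both to shrink a space and to fill it in.\<close>

lemma euler_is_union:
  assumes "openin X A" "openin X B" "topspace X = A \<union> B"
    and "euler_is (subtopology X B) b" "euler_is (subtopology X (A \<inter> B)) c"
    and "euler_is (subtopology X A) a \<or> euler_is X x" "x = a + b - c"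
  shows "euler_is (subtopology X A) a \<and> euler_is X x"
proof -
  have sub: "subtopology (subtopology X B) (A \<inter> B) = subtopology X (A \<inter> B)"
    by (simp add: subtopology_subtopology Int_ac)
  obtain eA eR where e1: "graded_euler (\<lambda>p. homology_group p (subtopology X (A \<inter> B))) eA"
    "graded_euler (\<lambda>p. relative_homology_group p (subtopology X B) (A \<inter> B)) eR"
    "graded_euler (\<lambda>p. homology_group p (subtopology X B)) (eA + eR)"
    using euler_long_exact_sequence[of "subtopology X B" "A \<inter> B"] assms(4,5) unfolding sub euler_is_def by blast
  then have "eA = c" "eA + eR = b"
    using euler_is_unique[of "subtopology X B" "eA + eR" b] euler_is_unique[of "subtopology X (A \<inter> B)" eA c] assms(4,5)
    by (auto simp: euler_is_def)
  then have R: "graded_euler (\<lambda>p. relative_homology_group p X A) (b - c)"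
    using euler_is_relative_excision[OF assms(1-3) e1(2)] by auto
  then obtain eA eR where e2: "graded_euler (\<lambda>p. homology_group p (subtopology X A)) eA"
    "graded_euler (\<lambda>p. relative_homology_group p X A) eR" "graded_euler (\<lambda>p. homology_group p X) (eA + eR)"
    using euler_long_exact_sequence[of X A] assms(6) unfolding euler_is_def by blast
  have "eR = b - c" by (rule graded_euler_unique[OF _ e2(2) R]) simp
  then have E: "euler_is (subtopology X A) eA" "euler_is X (eA + b - c)"
    using e2 by (auto simp: euler_is_def algebra_simps)
  have "eA = a"
    using assms(6)
  proof
    assume "euler_is (subtopology X A) a"
    then show ?thesis by (rule euler_is_unique[OF E(1)])
  next
    assume "euler_is X x"
    from euler_is_unique[OF E(2) this] show ?thesis using assms(7) by simp
  qed
  with E show ?thesis using assms(7) by simp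
qed

lemma euler_is_empty: "topspace X = {} \<Longrightarrow> euler_is X 0"
proof -
  assume "topspace X = {}"
  then have "trivial_group (homology_group p X)" for p by (rule trivial_homology_group_empty)
  then have "has_rank (homology_group p X) (carrier (homology_group p X)) 0" for p
    by (intro has_rank_trivial) (auto simp: trivial_group_def)
  then show ?thesis unfolding euler_is_def using graded_eulerI[of "\<lambda>p. homology_group p X" "\<lambda>_. 0" 0] by simp
qed

lemma euler_is_singleton:
  assumes "topspace X = {a}"
  shows "euler_is X 1"
proof -
  have "has_rank (homology_group (int p) X) (carrier (homology_group (int p) X)) (if p = 0 then 1 else 0)" for p
  proof (cases "p = 0")
    case True
    have "integer_group \<cong> homology_group 0 X"
      using homology_coefficients[OF assms] group.iso_sym by (metis group_relative_homology_group)
    with True show ?thesis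
      using has_rank_iso[OF abelian_integer_group abelian_homology_group _ has_rank_integer_group] by simp
  next
    case False
    then have "trivial_group (homology_group (int p) X)" by (intro homology_dimension_axiom[OF assms]) auto
    then show ?thesis using False by (intro has_rank_trivial[THEN back_subst[of "has_rank _ _"]]) (auto simp: trivial_group_def)
  qed
  from graded_eulerI[of "\<lambda>p. homology_group p X" "\<lambda>p. if p = 0 then 1 else 0" 1, OF this] show ?thesis
    by (simp add: euler_is_def)
qed


section \<open>Removing a divisor from a space\<close>

definition has_euler :: "'a::topological_space set \<Rightarrow> int \<Rightarrow> bool" where
  "has_euler S e \<longleftrightarrow> euler_is (top_of_set S) e"

lemma has_euler_homotopy_eqv:
  assumes "S homotopy_eqv T" "has_euler S e"
  shows "has_euler T e"
  using assms euler_is_homotopy_equivalent unfolding has_euler_def by blast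

lemma has_euler_homeomorphism:
  assumes "homeomorphism S T f g"
  shows "has_euler S e \<longleftrightarrow> has_euler T e"
proof -
  have "S homeomorphic T" using assms homeomorphic_def by blast
  then show ?thesis
    using has_euler_homotopy_eqv homeomorphic_imp_homotopy_eqv homotopy_equivalent_space_sym by metis
qed

lemma has_euler_deformation:
  assumes f: "continuous_on S f" "\<And>x. x \<in> S \<Longrightarrow> f x \<in> T"
    and g: "continuous_on T g" "\<And>y. y \<in> T \<Longrightarrow> g y \<in> S" and fg: "\<And>y. y \<in> T \<Longrightarrow> f (g y) = y"
    and h: "continuous_on ({0..1} \<times> S) (\<lambda>p. h (fst p) (snd p))"
      "\<And>u x. u \<in> {0..1} \<Longrightarrow> x \<in> S \<Longrightarrow> h u x \<in> S"
      "\<And>x. x \<in> S \<Longrightarrow> h (0::real) x = g (f x)" "\<And>x. x \<in> S \<Longrightarrow> h 1 x = x"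
    and T: "has_euler T e"
  shows "has_euler S e"
proof -
  have "homotopic_with (\<lambda>_. True) (top_of_set S) (top_of_set S) (g \<circ> f) id"
    using h by (subst homotopic_with)
      (auto intro!: exI[of _ "\<lambda>p. h (fst p) (snd p)"] simp: prod_topology_subtopology_eu)
  moreover have "homotopic_with (\<lambda>_. True) (top_of_set T) (top_of_set T) (f \<circ> g) id"
    by (rule homotopic_with_equal) (use f g fg in \<open>auto intro!: continuous_on_compose2[of _ f _ g] simp: o_def\<close>)
  ultimately have "T homotopy_eqv S"
    unfolding homotopy_equivalent_space_def using f g
    by (intro exI[of _ g] exI[of _ f]) auto
  then show ?thesis using T has_euler_homotopy_eqv by blast
qed

lemma has_euler_empty: "has_euler {} 0"
  by (simp add: has_euler_def euler_is_empty)

lemma has_euler_singleton: "has_euler {a} 1"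
  by (simp add: has_euler_def euler_is_singleton)

lemma has_euler_openin_Un:
  assumes "openin (top_of_set S) A" "openin (top_of_set S) B" "S = A \<union> B"
    and "has_euler B b" "has_euler (A \<inter> B) c"
  shows "has_euler A a \<longleftrightarrow> has_euler S (a + b - c)"
proof -
  have "subtopology (top_of_set S) A = top_of_set A" "subtopology (top_of_set S) B = top_of_set B"
    "subtopology (top_of_set S) (A \<inter> B) = top_of_set (A \<inter> B)"
    using assms(3) by (auto simp: subtopology_subtopology intro!: arg_cong2[of _ _ _ _ subtopology])
  then show ?thesis
    using euler_is_union[OF assms(1,2), of b c a "a + b - c"] assms(3-5) unfolding has_euler_def by auto
qed

lemma has_euler_times_starlike:
  fixes T :: "'b::real_normed_vector set"
  assumes "p \<in> T" "\<And>t u. t \<in> T \<Longrightarrow> 0 \<le> u \<Longrightarrow> u \<le> 1 \<Longrightarrow> p + u *\<^sub>R (t - p) \<in> T" "has_euler S e"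
  shows "has_euler (S \<times> T) e"
proof (rule has_euler_deformation[where f = fst and g = "\<lambda>x. (x, p)" and T = S
      and h = "\<lambda>u x. (fst x, p + u *\<^sub>R (snd x - p))"])
qed (use assms in \<open>auto intro!: continuous_intros\<close>)

text \<open>The punctured plane is covered by the planes slit along the nonnegative and the
  nonpositive real axis, which are starlike about -1 and 1 and meet in two half planes. This gives e
  + e - 2 e = 0.\<close>

lemma has_euler_times_punctured:
  assumes "has_euler S e"
  shows "has_euler (S \<times> (- {0 :: complex})) 0"
proof -
  define A where "A = {t. \<not> (Im t = 0 \<and> Re t \<ge> 0)}"
  define B where "B = {t. \<not> (Im t = 0 \<and> Re t \<le> 0)}"
  define U L where "U = {t. Im t > 0}" and "L = {t. Im t < 0}"
  have "A = {t. Im t \<noteq> 0} \<union> {t. Re t < 0}" "B = {t. Im t \<noteq> 0} \<union> {t. Re t > 0}"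
    by (auto simp: A_def B_def)
  then have op: "open A" "open B" "open U" "open L"
    by (auto simp: U_def L_def intro!: open_Un open_Collect_neq open_Collect_less continuous_intros)
  have sA: "has_euler (S \<times> A) e"
  proof (rule has_euler_times_starlike[where p = "-1"])
    fix t u assume t: "t \<in> A" and u: "0 \<le> u" "u \<le> (1::real)"
    have "u = 0 \<or> u * (Re t + 1) < 1" if "Im t = 0"
      using t that u mult_left_le_one_le[of "Re t + 1" u] mult_nonneg_nonpos[of u "Re t + 1"]
      by (force simp: A_def)
    then show "-1 + u *\<^sub>R (t - -1) \<in> A" using t by (auto simp: A_def)
  qed (use assms in \<open>auto simp: A_def\<close>)
  have sB: "has_euler (S \<times> B) e"
  proof (rule has_euler_times_starlike[where p = 1])
    fix t u assume t: "t \<in> B" and u: "0 \<le> u" "u \<le> (1::real)"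
    have "u = 0 \<or> u * (1 - Re t) < 1" if "Im t = 0"
      using t that u mult_left_le_one_le[of "1 - Re t" u] mult_nonneg_nonpos[of u "1 - Re t"]
      by (force simp: B_def)
    then show "1 + u *\<^sub>R (t - 1) \<in> B" using t by (auto simp: B_def algebra_simps)
  qed (use assms in \<open>auto simp: B_def\<close>)
  have conv: "p + u *\<^sub>R (t - p) \<in> C" if "convex C" "p \<in> C" "t \<in> C" "0 \<le> u" "u \<le> 1" for C :: "complex set" and p t u
  proof -
    have "(1 - u) *\<^sub>R p + u *\<^sub>R t \<in> C" using that by (intro convexD) auto
    then show ?thesis by (simp add: algebra_simps)
  qed
  have cUL: "convex U" "convex L"
    by (auto simp: U_def L_def convex_halfspace_Im_gt convex_halfspace_Im_lt)
  have sU: "has_euler (S \<times> U) e"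
    by (rule has_euler_times_starlike[where p = \<i>]) (use assms conv[OF cUL(1), of \<i>] in \<open>auto simp: U_def\<close>)
  have sL: "has_euler (S \<times> L) e"
    by (rule has_euler_times_starlike[where p = "-\<i>"]) (use assms conv[OF cUL(2), of "-\<i>"] in \<open>auto simp: L_def\<close>)
  have o: "openin (top_of_set (S \<times> V)) (S \<times> W)" if "open W" "W \<subseteq> V" for V W :: "complex set"
  proof -
    have "S \<times> W = (S \<times> V) \<inter> (UNIV \<times> W)" using that by auto
    then show ?thesis using that by (metis openin_open open_Times open_UNIV)
  qed
  have sUL: "has_euler (S \<times> (U \<union> L)) (e + e - 0)"
  proof (rule has_euler_openin_Un[where A = "S \<times> U" and B = "S \<times> L", THEN iffD1])
    have "(S \<times> U) \<inter> (S \<times> L) = {}" by (auto simp: U_def L_def)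
    then show "has_euler ((S \<times> U) \<inter> (S \<times> L)) 0" using has_euler_empty by simp
  qed (use o op sU sL in auto)
  have AB: "A \<inter> B = U \<union> L" "A \<union> B = - {0}" by (auto simp: A_def B_def U_def L_def complex_eq_iff)
  have "has_euler (S \<times> (- {0 :: complex})) (e + e - (e + e - 0))"
  proof (rule has_euler_openin_Un[where A = "S \<times> A" and B = "S \<times> B", THEN iffD1])
    have "(S \<times> A) \<inter> (S \<times> B) = S \<times> (U \<union> L)" using AB by auto
    then show "has_euler ((S \<times> A) \<inter> (S \<times> B)) (e + e - 0)" using sUL by simp
  qed (use o op sA sB AB in auto)
  then show ?thesis by simp
qed

section \<open>Disc bundles of variable radius\<close>

lemma homeomorphism_tube:
  fixes \<rho> :: "'b::topological_space \<Rightarrow> real"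
  assumes "continuous_on Z \<rho>" "\<And>b. b \<in> Z \<Longrightarrow> \<rho> b > 0"
  shows "homeomorphism {p. fst p \<in> Z \<and> norm (snd p :: complex) < \<rho> (fst p)} (Z \<times> UNIV)
           (\<lambda>p. (fst p, snd p / of_real (\<rho> (fst p) - norm (snd p))))
           (\<lambda>p. (fst p, of_real (\<rho> (fst p)) * snd p / of_real (1 + norm (snd p))))"
proof -
  have pos: "1 + norm t > 0" for t :: complex by (smt (verit) norm_ge_zero)
  have c1: "continuous_on {p :: 'b \<times> complex. fst p \<in> Z \<and> norm (snd p) < \<rho> (fst p)} (\<lambda>p. \<rho> (fst p))"
    by (rule continuous_on_compose2[OF assms(1)]) (auto intro!: continuous_intros)
  have c2: "continuous_on (Z \<times> (UNIV :: complex set)) (\<lambda>p. \<rho> (fst p))"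
    by (rule continuous_on_compose2[OF assms(1)]) (auto intro!: continuous_intros)
  have lt: "\<rho> b * norm t / (1 + norm t) < \<rho> b" if "b \<in> Z" for b and t :: complex
    using assms(2)[OF that] pos[of t] by (simp add: field_simps)
  \<comment> \<open>Directions are kept, and radii change by r -> r / (\<rho> - r), an increasing
    bijection of [0, \<rho>) onto the nonnegative reals with inverse r -> \<rho> r / (1 + r). Discs
    of varying radius thus become full planes.\<close>
  let ?f = "\<lambda>p :: 'b \<times> complex. (fst p, snd p / of_real (\<rho> (fst p) - norm (snd p)))"
  let ?g = "\<lambda>p :: 'b \<times> complex. (fst p, of_real (\<rho> (fst p)) * snd p / of_real (1 + norm (snd p)))"
  let ?S = "{p :: 'b \<times> complex. fst p \<in> Z \<and> norm (snd p) < \<rho> (fst p)}"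
  have fg: "?g (?f p) = p" if pS: "p \<in> ?S" for p
  proof -
    obtain b t where p: "p = (b, t)" "b \<in> Z" "norm t < \<rho> b" using pS by (cases p) auto
    define s where "s = \<rho> b - norm t"
    have s: "s > 0" "\<rho> b = s + norm t" using p by (auto simp: s_def)
    have n: "norm (t / of_real s) = norm t / s" using s by (simp add: norm_divide)
    have "1 + norm t / s = \<rho> b / s" using s by (simp add: field_simps)
    then have "of_real (\<rho> b) * (t / of_real s) / of_real (1 + norm (t / of_real s)) = t"
      using s assms(2)[OF p(2)] n by (simp del: of_real_add)
    then show ?thesis
      using p by (simp add: s_def del: of_real_add of_real_diff)
  qed
  have gf: "?f (?g p) = p" if pS: "p \<in> Z \<times> UNIV" for p
  proof -
    obtain b t where p: "p = (b, t)" "b \<in> Z" using pS by (cases p) auto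
    define q where "q = 1 + norm t"
    have q: "q > 0" using pos[of t] by (simp add: q_def)
    define w where "w = of_real (\<rho> b) * t / of_real q"
    have "norm w = \<rho> b * norm t / q" using q assms(2)[OF p(2)] by (simp add: w_def norm_mult norm_divide)
    then have "\<rho> b - norm w = \<rho> b / q" using q by (simp add: field_simps q_def)
    then have "w / of_real (\<rho> b - norm w) = t" using q assms(2)[OF p(2)] by (simp add: w_def del: of_real_diff)
    then show ?thesis
      using p by (simp add: w_def q_def del: of_real_add of_real_diff)
  qed
  have im: "?g ` (Z \<times> UNIV) \<subseteq> ?S"
  proof
    fix p assume "p \<in> ?g ` (Z \<times> UNIV)"
    then obtain b t where p: "p = ?g (b, t)" and b: "b \<in> Z" by auto
    have "norm (complex_of_real (1 + norm t)) = 1 + norm t"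
      using pos[of t] by (simp only: norm_of_real abs_of_pos)
    then have "norm (snd p) = \<rho> b * norm t / (1 + norm t)"
      using assms(2)[OF b] by (simp add: p norm_mult norm_divide del: of_real_add)
    then show "p \<in> ?S" using lt[OF b, of t] b by (simp add: p)
  qed
  show ?thesis
  proof (rule homeomorphismI)
    show "continuous_on ?S ?f"
      by (intro continuous_intros c1) auto
    show "continuous_on (Z \<times> UNIV) ?g"
      by (intro continuous_intros c2) (metis less_irrefl of_real_eq_0_iff pos)
    show "?f ` ?S \<subseteq> Z \<times> UNIV" by auto
  qed (use fg gf im in blast)+
qed

lemma has_euler_tube:
  fixes \<rho> :: "'b::topological_space \<Rightarrow> real"
  assumes "continuous_on Z \<rho>" "\<And>b. b \<in> Z \<Longrightarrow> \<rho> b > 0" "has_euler Z e"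
  shows "has_euler {p. fst p \<in> Z \<and> norm (snd p :: complex) < \<rho> (fst p)} e"
  using has_euler_homeomorphism[OF homeomorphism_tube[OF assms(1,2)]]
    has_euler_times_starlike[of 0 UNIV Z e] assms(3) by simp

text \<open>Straightening the tube preserves the zero section, so the punctured tube becomes a
  product with the punctured plane.\<close>

lemma has_euler_punctured_tube:
  fixes \<rho> :: "'b::topological_space \<Rightarrow> real"
  assumes "continuous_on Z \<rho>" "\<And>b. b \<in> Z \<Longrightarrow> \<rho> b > 0" "has_euler Z e"
  shows "has_euler {p. fst p \<in> Z \<and> norm (snd p :: complex) < \<rho> (fst p) \<and> snd p \<noteq> 0} 0"
proof -
  have image_restrict: "f ` {x \<in> A. f x \<in> C'} = C'" if "f ` A = C" "C' \<subseteq> C"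
    for f :: "'x \<Rightarrow> 'y" and A C C'
    using that by auto
  have "{p. fst p \<in> Z \<and> norm (snd p :: complex) < \<rho> (fst p) \<and> snd p \<noteq> 0}
      = {p \<in> {p. fst p \<in> Z \<and> norm (snd p :: complex) < \<rho> (fst p)}.
          (fst p, snd p / of_real (\<rho> (fst p) - norm (snd p))) \<in> Z \<times> (- {0})}"
    by auto
  moreover have hom: "homeomorphism \<dots> (Z \<times> (- {0}))
           (\<lambda>p. (fst p, snd p / of_real (\<rho> (fst p) - norm (snd p))))
           (\<lambda>p. (fst p, of_real (\<rho> (fst p)) * snd p / of_real (1 + norm (snd p))))"
  proof (rule homeomorphism_of_subsets[OF homeomorphism_tube[OF assms(1,2)]])
    let ?f = "\<lambda>p :: 'b \<times> complex. (fst p, snd p / of_real (\<rho> (fst p) - norm (snd p)))"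
    let ?S = "{p. fst p \<in> Z \<and> norm (snd p :: complex) < \<rho> (fst p)}"
    have "?f ` ?S = Z \<times> UNIV" by (rule homeomorphism_image1[OF homeomorphism_tube[OF assms(1,2)]])
    then show "?f ` {p \<in> ?S. ?f p \<in> Z \<times> (- {0})} = Z \<times> (- {0})"
      by (rule image_restrict) blast
  qed blast+
  ultimately show ?thesis
    using has_euler_homeomorphism[OF hom] has_euler_times_punctured[OF assms(3)] by simp
qed

text \<open>The role of a tubular neighbourhood is played by a chart \<open>N \<cong> V\<close> onto an open set of a product
  \<open>B \<times> \<complex>\<close>, in which the removed set is the zero section. The punctured disc bundle around it has
  Euler characteristic 0.\<close>

lemma has_euler_remove_closed:
  fixes X :: "'a::topological_space set" and B :: "'b::metric_space set"
  assumes Z: "closedin (top_of_set X) Z" "Z \<subseteq> N" and N: "openin (top_of_set X) N"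
    and V: "openin (top_of_set (B \<times> UNIV)) V"
    and hom: "homeomorphism N V (\<lambda>x. (\<phi> x, \<tau> x :: complex)) \<psi>"
    and \<tau>: "\<And>x. x \<in> N \<Longrightarrow> x \<in> Z \<longleftrightarrow> \<tau> x = 0"
    and d: "has_euler {b. (b, 0) \<in> V} d"
  shows "has_euler (X - Z) e \<longleftrightarrow> has_euler X (e + d)"
proof -
  obtain T where T: "open T" "V = (B \<times> UNIV) \<inter> T" using V by (auto simp: openin_open)
  \<comment> \<open>The distance of \<open>(b, 0)\<close> from the complement of \<open>T\<close>,
    so that the disc of this radius over \<open>b\<close> stays inside \<open>T\<close>. For an
    empty complement \<open>infdist\<close> would be 0, hence the separate value 1.\<close>
  define \<rho> where "\<rho> = (\<lambda>b. if - T = {} then 1 else infdist (b, 0 :: complex) (- T))"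
  have c\<rho>: "continuous_on S \<rho>" for S
    unfolding \<rho>_def by (cases "- T = {}") (auto intro!: continuous_intros)
  define Z0 where "Z0 = {b. (b, 0) \<in> V}"
  have pos: "\<rho> b > 0" if "(b, 0) \<in> T" for b
  proof (cases "- T = {}")
    case False
    then show ?thesis using that T(1) infdist_pos_not_in_closed[of "- T" "(b, 0)"]
      by (auto simp: \<rho>_def closed_def)
  qed (simp add: \<rho>_def)
  have inT: "(b, t) \<in> T" if "norm t < \<rho> b" for b t
  proof (rule ccontr)
    assume n: "(b, t) \<notin> T"
    then have "infdist (b, 0) (- T) \<le> dist (b, 0) (b, t)" by (intro infdist_le) auto
    also have "\<dots> = norm t" by (simp add: dist_Pair_Pair dist_norm)
    finally show False using that n by (auto simp: \<rho>_def split: if_splits)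
  qed
  define K where "K = {p :: 'b \<times> complex. fst p \<in> Z0 \<and> norm (snd p) < \<rho> (fst p)}"
  have KV: "K \<subseteq> V" using inT by (auto simp: K_def Z0_def T)
  have K: "openin (top_of_set (B \<times> UNIV)) K"
  proof -
    have "open {p :: 'b \<times> complex. (fst p, 0) \<in> T}"
    proof -
      have "open ((\<lambda>p :: 'b \<times> complex. (fst p, 0 :: complex)) -` T)"
        by (rule open_vimage[OF T(1)]) (intro continuous_intros)
      then show ?thesis by (simp add: vimage_def)
    qed
    moreover have "open {p :: 'b \<times> complex. norm (snd p) < \<rho> (fst p)}"
      by (intro open_Collect_less continuous_intros continuous_on_compose2[OF c\<rho>[of UNIV]]) auto
    ultimately have "open ({p :: 'b \<times> complex. (fst p, 0) \<in> T} \<inter> {p. norm (snd p) < \<rho> (fst p)})" by blast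
    moreover have "K = (B \<times> UNIV) \<inter> ({p. (fst p, 0) \<in> T} \<inter> {p. norm (snd p) < \<rho> (fst p)})"
      using inT by (auto simp: K_def Z0_def T)
    ultimately show ?thesis unfolding openin_open by blast
  qed
  have hom': "homeomorphism V N \<psi> (\<lambda>x. (\<phi> x, \<tau> x))" using hom homeomorphism_symD by blast
  have NV: "\<psi> ` V = N" "\<And>p. p \<in> V \<Longrightarrow> (\<phi> (\<psi> p), \<tau> (\<psi> p)) = p" "\<And>x. x \<in> N \<Longrightarrow> \<psi> (\<phi> x, \<tau> x) = x"
    "\<And>x. x \<in> N \<Longrightarrow> (\<phi> x, \<tau> x) \<in> V"
    using hom by (auto simp: homeomorphism_def)
  define M where "M = \<psi> ` K"
  have MN: "M \<subseteq> N" using NV(1) KV by (auto simp: M_def)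
  have "openin (top_of_set V) K"
    using K KV T(2) by (meson inf_le1 openin_subset_trans)
  then have "openin (top_of_set N) M"
    unfolding M_def using homeomorphism_imp_open_map[OF hom'] by blast
  then have M: "openin (top_of_set X) M" using N openin_trans by blast
  have ZM: "Z \<subseteq> M"
  proof
    fix x assume "x \<in> Z"
    then have x: "x \<in> N" "\<tau> x = 0" using Z(2) \<tau> by auto
    then have "(\<phi> x, 0) \<in> V" using NV(4)[of x] by simp
    then have "(\<phi> x, \<tau> x) \<in> K" using pos T(2) x by (auto simp: K_def Z0_def)
    then show "x \<in> M" unfolding M_def using NV(3)[OF x(1)] by (metis imageI)
  qed
  have hK: "homeomorphism K M \<psi> (\<lambda>x. (\<phi> x, \<tau> x))"
    by (rule homeomorphism_of_subsets[OF hom' KV]) (auto simp: M_def MN[unfolded M_def])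
  have m1: "has_euler M d"
    using has_euler_homeomorphism[OF hK] has_euler_tube[of Z0 \<rho> d] c\<rho> pos d
    by (auto simp: K_def Z0_def T)
  let ?K' = "{p :: 'b \<times> complex. fst p \<in> Z0 \<and> norm (snd p) < \<rho> (fst p) \<and> snd p \<noteq> 0}"
  have "homeomorphism ?K' (M - Z) \<psi> (\<lambda>x. (\<phi> x, \<tau> x))"
  proof (rule homeomorphism_of_subsets[OF hK])
    show "\<psi> ` ?K' = M - Z"
    proof safe
      fix b :: 'b and t :: complex assume bt: "fst (b, t) \<in> Z0" "norm (snd (b, t)) < \<rho> (fst (b, t))" "snd (b, t) \<noteq> 0"
      then have k: "(b, t) \<in> K" by (auto simp: K_def)
      then show m: "\<psi> (b, t) \<in> M" by (auto simp: M_def)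
      assume "\<psi> (b, t) \<in> Z"
      then have "\<tau> (\<psi> (b, t)) = 0" using \<tau> m MN by blast
      then show False using NV(2)[of "(b, t)"] KV k bt by auto
    next
      fix x assume x: "x \<in> M" "x \<notin> Z"
      then obtain p where p: "p \<in> K" "x = \<psi> p" by (auto simp: M_def)
      then have "\<tau> x = snd p" using NV(2)[of p] KV by (metis snd_conv subsetD)
      then have "snd p \<noteq> 0" using \<tau> x MN by auto
      then show "x \<in> \<psi> ` ?K'" using p by (auto simp: K_def)
    qed
  qed (auto simp: K_def)
  then have m2: "has_euler (M - Z) 0"
    using has_euler_homeomorphism has_euler_punctured_tube[of Z0 \<rho> d] c\<rho> pos d
    by (fastforce simp: Z0_def T)
  have sub: "M \<subseteq> X" "Z \<subseteq> X" using M Z(1) openin_subset closedin_subset by force+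
  have "(X - Z) \<inter> M = M - Z" "X = (X - Z) \<union> M" using ZM sub by auto
  moreover have "openin (top_of_set X) (X - Z)" using Z(1) by (metis openin_diff openin_subtopology_self)
  ultimately show ?thesis
    using has_euler_openin_Un[of X "X - Z" M d 0 e] M m1 m2 by simp
qed

text \<open>The chart is the shear that subtracts \<open>g b\<close> from the last coordinate.
  \<open>D\<close> is allowed to be smaller than \<open>B\<close> because a curve given by an
  equation linear in the last coordinate runs off to infinity where the leading coefficient
  vanishes. The equivalence lets the unknown be the smaller or the larger space.\<close>

lemma has_euler_remove_graph:
  fixes B :: "'b::metric_space set" and g :: "'b \<Rightarrow> complex" and h :: "'b \<times> complex \<Rightarrow> complex"
  assumes X: "openin (top_of_set (B \<times> UNIV)) X" and D: "openin (top_of_set B) D"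
    and g: "continuous_on D g" and h: "continuous_on X h"
    and hg: "\<And>b t. (b, t) \<in> X \<Longrightarrow> h (b, t) = 0 \<longleftrightarrow> b \<in> D \<and> t = g b"
    and d: "has_euler {b \<in> D. (b, g b) \<in> X} d"
  shows "has_euler {p \<in> X. h p \<noteq> 0} e \<longleftrightarrow> has_euler X (e + d)"
proof -
  define Z where "Z = {p \<in> X. h p = 0}"
  define N where "N = {p \<in> X. fst p \<in> D}"
  define V where "V = {p \<in> D \<times> UNIV. (fst p, snd p + g (fst p)) \<in> X}"
  have cg: "continuous_on S (\<lambda>p. g (fst p))" if "fst ` S \<subseteq> D" for S :: "('b \<times> complex) set"
    by (rule continuous_on_compose2[OF g]) (use that in \<open>auto intro!: continuous_intros\<close>)
  obtain U where U: "open U" "D = B \<inter> U" using D by (auto simp: openin_open)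
  obtain T where T: "open T" "X = (B \<times> UNIV) \<inter> T" using X by (auto simp: openin_open)
  have "has_euler (X - Z) e \<longleftrightarrow> has_euler X (e + d)"
  proof (rule has_euler_remove_closed[where N = N and V = V and B = D and \<phi> = fst
        and \<tau> = "\<lambda>p. snd p - g (fst p)" and \<psi> = "\<lambda>p. (fst p, snd p + g (fst p))"])
    show "closedin (top_of_set X) Z"
      unfolding Z_def by (rule continuous_closedin_preimage_constant[OF h])
    show "Z \<subseteq> N" using hg by (auto simp: Z_def N_def)
    have "N = X \<inter> (U \<times> UNIV)" using T U by (auto simp: N_def)
    then show "openin (top_of_set X) N" using U(1) by (metis openin_open open_Times open_UNIV)
    have "V = (D \<times> UNIV) \<inter> (\<lambda>p. (fst p, snd p + g (fst p))) -` T" using T U by (auto simp: V_def)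
    moreover have "openin (top_of_set (D \<times> UNIV)) \<dots>"
      by (rule continuous_openin_preimage_gen[OF _ T(1)]) (intro continuous_intros cg, auto)
    ultimately show "openin (top_of_set (D \<times> UNIV)) V" by simp
    show "homeomorphism N V (\<lambda>p. (fst p, snd p - g (fst p))) (\<lambda>p. (fst p, snd p + g (fst p)))"
    proof (rule homeomorphismI)
    qed (auto simp: N_def V_def intro!: continuous_intros cg)
    show "p \<in> Z \<longleftrightarrow> snd p - g (fst p) = 0" if "p \<in> N" for p
      using that hg by (cases p) (auto simp: Z_def N_def)
    have "{b. (b, 0) \<in> V} = {b \<in> D. (b, g b) \<in> X}" by (auto simp: V_def)
    then show "has_euler {b. (b, 0) \<in> V} d" using d by simp
  qed
  moreover have "X - Z = {p \<in> X. h p \<noteq> 0}" by (auto simp: Z_def)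
  ultimately show ?thesis by simp
qed

lemma has_euler_graph_complement:
  fixes B :: "'b::metric_space set" and g :: "'b \<Rightarrow> complex" and h :: "'b \<times> complex \<Rightarrow> complex"
  assumes "openin (top_of_set (B \<times> UNIV)) X" "openin (top_of_set B) D"
    and "continuous_on D g" "continuous_on X h"
    and "\<And>b t. (b, t) \<in> X \<Longrightarrow> h (b, t) = 0 \<longleftrightarrow> b \<in> D \<and> t = g b"
    and "has_euler {b \<in> D. (b, g b) \<in> X} d" and "has_euler X e"
  shows "has_euler {p \<in> X. h p \<noteq> 0} (e - d)"
  using has_euler_remove_graph[OF assms(1-6), of "e - d"] assms(7) by simp

section \<open>Products with a plane minus finitely many points\<close>

lemma has_euler_times_cofinite:
  fixes S :: "'b::metric_space set" and F :: "complex set"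
  assumes "finite F" "has_euler S e"
  shows "has_euler (S \<times> (- F)) (e * (1 - int (card F)))"
  using assms(1)
proof (induction F rule: finite_induct)
  case empty
  then show ?case using has_euler_times_starlike[of 0 "UNIV :: complex set" S e] assms(2) by simp
next
  case (insert a F)
  have "S \<times> - F = (S \<times> UNIV) \<inter> (UNIV \<times> - F)" by auto
  then have "openin (top_of_set (S \<times> UNIV)) (S \<times> - F)"
    using insert.hyps(1) by (metis openin_open open_Times open_UNIV open_Compl finite_imp_closed)
  \<comment> \<open>The point \<open>a\<close> is removed as the graph of a constant function, a
    copy of \<open>S\<close>.\<close>
  then have "has_euler {p \<in> S \<times> - F. snd p - a \<noteq> 0} (e * (1 - int (card F)) - e)
      \<longleftrightarrow> has_euler (S \<times> - F) (e * (1 - int (card F)) - e + e)"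
    by (rule has_euler_remove_graph[where D = S and g = "\<lambda>_. a"])
       (use assms(2) insert.hyps in \<open>auto intro!: continuous_intros\<close>)
  moreover have "{p \<in> S \<times> - F. snd p - a \<noteq> 0} = S \<times> - insert a F" by auto
  ultimately show ?case using insert by (simp add: algebra_simps)
qed

lemma has_euler_cofinite:
  fixes F :: "complex set"
  assumes "finite F"
  shows "has_euler (- F) (1 - int (card F))"
proof -
  have "homeomorphism ({0::complex} \<times> - F) (- F) snd (\<lambda>t. (0, t))"
    by (rule homeomorphismI) (auto intro!: continuous_intros)
  from has_euler_homeomorphism[OF this] show ?thesis
    using has_euler_times_cofinite[OF assms has_euler_singleton, of "0::complex"] by simp
qed


section \<open>Complements of the three curves\<close>

lemma has_euler_iff_maps:
  assumes "continuous_on S f" "continuous_on T g"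
    "\<And>x. x \<in> S \<Longrightarrow> f x \<in> T \<and> g (f x) = x" "\<And>y. y \<in> T \<Longrightarrow> g y \<in> S \<and> f (g y) = y"
  shows "has_euler S e \<longleftrightarrow> has_euler T e"
proof -
  have "homeomorphism S T f g" by (rule homeomorphismI) (use assms in auto)
  then show ?thesis by (rule has_euler_homeomorphism)
qed

text \<open>For fixed \<open>x\<close> the forms \<open>line1\<close> and \<open>line2\<close> are
  affine in \<open>y\<close>, so their curves are graphs over an open part of the
  \<open>x\<close>-plane. The zero set of \<open>line0\<close> splits into the lines x = 1 and y =
  0.\<close>

definition line0 :: "complex \<Rightarrow> complex \<Rightarrow> complex" where "line0 x y = (x - 1) * y"
definition line1 :: "complex \<Rightarrow> complex \<Rightarrow> complex" where "line1 x y = (x + 2) * y + 1"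
definition line2 :: "complex \<Rightarrow> complex \<Rightarrow> complex \<Rightarrow> complex" where "line2 d x y = (2 * x + d) * y + 1"

lemmas line_defs = line0_def line1_def line2_def

lemma linear_root: "a * t + 1 = 0 \<longleftrightarrow> a \<noteq> 0 \<and> t = - 1 / a" for a t :: complex
proof (cases "a = 0")
  case False
  have "t = - 1 / a \<longleftrightarrow> a * t = - 1"
    using nonzero_eq_divide_eq[OF False, of t "- 1"] by (simp only: mult.commute[of a t])
  then show ?thesis using False eq_neg_iff_add_eq_0[of "a * t" 1] by simp
qed simp

lemma double_eq_iff: "2 * x + d = 0 \<longleftrightarrow> x = - d / 2" for x d :: complex
  by (auto simp: field_simps eq_neg_iff_add_eq_0)

lemma slope_root:
  assumes "2 * x + d \<noteq> (0 :: complex)"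
  shows "- 1 / (2 * x + d) = 1 \<longleftrightarrow> x = - (1 + d) / 2"
proof -
  have "- 1 / (2 * x + d) = 1 \<longleftrightarrow> - 1 = 1 * (2 * x + d)"
    by (rule nonzero_divide_eq_eq[OF assms])
  also have "\<dots> \<longleftrightarrow> 1 + 1 * (2 * x + d) = 0" by (rule neg_eq_iff_add_eq_0)
  also have "1 + 1 * (2 * x + d) = 2 * (x - (- (1 + d) / 2))" by (simp add: field_simps)
  also have "\<dots> = 0 \<longleftrightarrow> x = - (1 + d) / 2" by (simp only: mult_eq_0_iff right_minus_eq) simp
  finally show ?thesis .
qed

text \<open>\<open>F\<close> and \<open>Q\<close> are the forbidden values of \<open>x\<close> and
  \<open>y\<close>. The values x = 0 and y = 1 bound the torus in the new coordinates, while x = 1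
  and y = 0 form the zero set of \<open>line0\<close>. Taking {0, 1} twice gives U; {0} and {1} keep
  the points with \<open>line0 = 0\<close>.\<close>

definition curve_complement :: "complex \<Rightarrow> complex set \<Rightarrow> complex set \<Rightarrow> (complex \<times> complex) set" where
  "curve_complement d F Q = {(x, y). x \<notin> F \<and> y \<notin> Q \<and> line1 x y \<noteq> 0 \<and> line2 d x y \<noteq> 0}"

text \<open>Both curves are removed as graphs over the \<open>x\<close>-plane, so it remains to list
  the values of \<open>x\<close> without a point of the curve. For \<open>line1\<close> these are
  the pole -2 and -3, where y = 1. For \<open>line2\<close> they are the pole -d/2, then -(1 + d)/2,
  where y = 1, and 2 - d, where it meets the first curve. Neither curve meets y = 0.\<close>

lemma has_euler_curve_complement:
  assumes "finite F" "finite Q" "1 \<in> Q" "Q \<subseteq> {0, 1}"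
  shows "has_euler (curve_complement d F Q)
    ((1 - int (card F)) * (1 - int (card Q)) - (1 - int (card (F \<union> {-2, -3})))
       - (1 - int (card (F \<union> {- d / 2, - (1 + d) / 2, 2 - d}))))"
proof -
  define X0 where "X0 = (- F) \<times> (- Q)"
  define X1 where "X1 = {p \<in> X0. line1 (fst p) (snd p) \<noteq> 0}"
  define X2 where "X2 = {p \<in> X1. line2 d (fst p) (snd p) \<noteq> 0}"
  have o0: "open X0" unfolding X0_def using assms by (intro open_Times open_Compl finite_imp_closed)
  have "X1 = X0 \<inter> {p. line1 (fst p) (snd p) \<noteq> 0}" by (auto simp: X1_def)
  moreover have "open {p. line1 (fst p) (snd p) \<noteq> 0}"
    unfolding line_defs by (intro open_Collect_neq continuous_intros)
  ultimately have o1: "open X1" using o0 by auto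
  have D: "open {x :: complex. x + 2 \<noteq> 0}" "open {x. 2 * x + d \<noteq> 0}"
    by (auto intro!: open_Collect_neq continuous_intros)
  have e0: "has_euler X0 ((1 - int (card F)) * (1 - int (card Q)))"
    unfolding X0_def by (intro has_euler_times_cofinite has_euler_cofinite assms)
  have s1: "{b \<in> {x. x + 2 \<noteq> 0}. (b, - 1 / (b + 2)) \<in> X0} = - (F \<union> {-2, -3})"
  proof -
    have "- 1 / (b + 2) = 1 \<longleftrightarrow> b = -3" if "b + 2 \<noteq> 0" for b :: complex
      using that by (auto simp: field_simps eq_neg_iff_add_eq_0)
    moreover have "b + 2 \<noteq> 0 \<longleftrightarrow> b \<noteq> -2" for b :: complex by (simp add: add_eq_0_iff2)
    ultimately show ?thesis using assms by (auto simp: X0_def)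
  qed
  have e1: "has_euler X1 ((1 - int (card F)) * (1 - int (card Q)) - (1 - int (card (F \<union> {-2, -3}))))"
    unfolding X1_def
  proof (rule has_euler_graph_complement[where B = UNIV and D = "{x. x + 2 \<noteq> 0}" and g = "\<lambda>x. - 1 / (x + 2)"])
    show "line1 (fst (b, t)) (snd (b, t)) = 0 \<longleftrightarrow> b \<in> {x. x + 2 \<noteq> 0} \<and> t = - 1 / (b + 2)" for b t
      using linear_root[of "b + 2" t] by (simp add: line_defs)
    show "has_euler {b \<in> {x. x + 2 \<noteq> 0}. (b, - 1 / (b + 2)) \<in> X0} (1 - int (card (F \<union> {-2, -3})))"
      unfolding s1 by (rule has_euler_cofinite) (use assms in auto)
  qed (use o0 D e0 in \<open>auto intro!: continuous_intros simp: line_defs\<close>)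
  have s2: "{b \<in> {x. 2 * x + d \<noteq> 0}. (b, - 1 / (2 * b + d)) \<in> X1} = - (F \<union> {- d / 2, - (1 + d) / 2, 2 - d})"
  proof -
    have "x \<in> {x. 2 * x + d \<noteq> 0} \<and> (x, - 1 / (2 * x + d)) \<in> X1 \<longleftrightarrow> x \<notin> F \<union> {- d / 2, - (1 + d) / 2, 2 - d}" for x
    proof (cases "2 * x + d = 0")
      case True
      then show ?thesis using double_eq_iff[of x d] by simp
    next
      case False
      define y where "y = - 1 / (2 * x + d)"
      have "y = 1 \<longleftrightarrow> x = - (1 + d) / 2" unfolding y_def by (rule slope_root[OF False])
      moreover have "line1 x y \<noteq> 0 \<longleftrightarrow> x \<noteq> 2 - d" using False by (auto simp: y_def line_defs field_simps)
      moreover have "y \<noteq> 0" using False by (simp add: y_def)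
      moreover have "x \<noteq> - d / 2" using False double_eq_iff by blast
      moreover have "x \<in> {x. 2 * x + d \<noteq> 0} \<and> (x, - 1 / (2 * x + d)) \<in> X1 \<longleftrightarrow> x \<notin> F \<and> y \<notin> Q \<and> line1 x y \<noteq> 0"
        using False by (simp add: X0_def X1_def y_def)
      ultimately show ?thesis using assms(3,4) by (simp only: ) auto
    qed
    then show ?thesis by blast
  qed
  have e2: "has_euler X2 ((1 - int (card F)) * (1 - int (card Q)) - (1 - int (card (F \<union> {-2, -3})))
       - (1 - int (card (F \<union> {- d / 2, - (1 + d) / 2, 2 - d}))))"
    unfolding X2_def
  proof (rule has_euler_graph_complement[where B = UNIV and D = "{x. 2 * x + d \<noteq> 0}" and g = "\<lambda>x. - 1 / (2 * x + d)"])
    show "line2 d (fst (b, t)) (snd (b, t)) = 0 \<longleftrightarrow> b \<in> {x. 2 * x + d \<noteq> 0} \<and> t = - 1 / (2 * b + d)" for b t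
      using linear_root[of "2 * b + d" t] by (simp add: line_defs)
    show "has_euler {b \<in> {x. 2 * x + d \<noteq> 0}. (b, - 1 / (2 * b + d)) \<in> X1}
        (1 - int (card (F \<union> {- d / 2, - (1 + d) / 2, 2 - d})))"
      unfolding s2 by (rule has_euler_cofinite) (use assms in auto)
  qed (use o1 D e1 in \<open>auto intro!: continuous_intros simp: line_defs\<close>)
  moreover have "X2 = curve_complement d F Q" by (auto simp: X0_def X1_def X2_def curve_complement_def)
  ultimately show ?thesis by simp
qed

section \<open>The incidence variety away from base points\<close>

definition zero_if :: "bool \<Rightarrow> complex set" where "zero_if b = (if b then {0} else {})"

lemma zero_if: "s \<in> zero_if b \<longleftrightarrow> b \<and> s = 0" "finite (zero_if b)" by (auto simp: zero_if_def)

lemma open_implies_neq: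
  fixes f g :: "'a::topological_space \<Rightarrow> complex"
  assumes "continuous_on UNIV f"
  shows "open {x. b \<longrightarrow> f x \<noteq> 0}"
  by (cases b) (auto intro!: open_Collect_neq assms)

text \<open>Over the complement T of the last two curves, the graph w = \<open>line0\<close> is
  removed from T times C or, if \<open>b\<close> holds, T times C^* . In the first case the graph is
  a copy of T and the values cancel. In the second the product has value 0, and the graph avoids w =
  0 exactly over U, which leaves - u.\<close>

lemma has_euler_residual:
  fixes d :: complex
  defines "U \<equiv> curve_complement d {0, 1} {0, 1}"
  assumes U: "has_euler U u"
  shows "has_euler {((x, y), w). x \<noteq> 0 \<and> y \<noteq> 1 \<and> line1 x y \<noteq> 0 \<and> line2 d x y \<noteq> 0 \<and> (b \<longrightarrow> w \<noteq> 0) \<and> w \<noteq> line0 x y}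
     (if b then - u else 0)" (is "has_euler ?R _")
proof -
  define T where "T = curve_complement d {0} {1}"
  define t where "t = - (1 - int (card ({0} \<union> {-2, -3 :: complex}))) - (1 - int (card ({0} \<union> {- d / 2, - (1 + d) / 2, 2 - d})))"
  have T: "has_euler T t"
    unfolding T_def t_def using has_euler_curve_complement[of "{0}" "{1}" d] by simp
  have "T = {p. fst p \<noteq> 0 \<and> snd p \<noteq> 1 \<and> line1 (fst p) (snd p) \<noteq> 0 \<and> line2 d (fst p) (snd p) \<noteq> 0}"
    by (auto simp: T_def curve_complement_def)
  then have oT: "open T"
    by (auto simp: line_defs intro!: open_Collect_neq open_Collect_conj continuous_intros)
  have oX: "open (T \<times> (- zero_if b))" using oT zero_if(2) by (intro open_Times open_Compl finite_imp_closed)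
  have X: "has_euler (T \<times> (- zero_if b)) (t * (1 - int (card (zero_if b))))"
    by (intro has_euler_times_cofinite T zero_if(2))
  have "has_euler {p \<in> T \<times> (- zero_if b). snd p - line0 (fst (fst p)) (snd (fst p)) \<noteq> 0} (if b then - u else 0)"
  proof (rule has_euler_remove_graph[where B = UNIV and D = T and g = "\<lambda>p. line0 (fst p) (snd p)", THEN iffD2])
    have "{p \<in> T. (p, line0 (fst p) (snd p)) \<in> T \<times> (- zero_if b)} = (if b then U else T)"
      by (auto simp: T_def U_def curve_complement_def zero_if_def line0_def split: if_splits)
    then show "has_euler {p \<in> T. (p, line0 (fst p) (snd p)) \<in> T \<times> (- zero_if b)} (if b then u else t)"
      using T U by simp
    show "has_euler (T \<times> (- zero_if b)) ((if b then - u else 0) + (if b then u else t))"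
      using X by (auto simp: zero_if_def split: if_splits)
  qed (use oX oT in \<open>auto intro!: continuous_intros simp: line_defs\<close>)
  moreover have "{p \<in> T \<times> (- zero_if b). snd p - line0 (fst (fst p)) (snd (fst p)) \<noteq> 0} = ?R"
    by (auto simp: T_def curve_complement_def zero_if_def split: if_splits)
  ultimately show ?thesis by simp
qed

text \<open>\<open>z\<close> is $z_1$ and \<open>s\<close> the sum $z_2 + \dots + z_n$, which multiplies one and the same form; \<open>b\<close> tells
  whether \<open>s = 0\<close> is excluded, as it is for \<open>n = 2\<close>.\<close>

definition incidence :: "complex \<Rightarrow> bool \<Rightarrow> (complex \<times> complex \<times> complex \<times> complex) set" where
  "incidence d b = {(x, y, z, s). x \<noteq> 0 \<and> y \<noteq> 1 \<and> z \<noteq> 0 \<and> (b \<longrightarrow> s \<noteq> 0) \<and> line0 x y + z * line1 x y + s * line2 d x y = 0}"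

text \<open>On this part \<open>line1\<close> and \<open>line2\<close> do not vanish together, since
  the equation would force \<open>line0 = 0\<close> as well. Hence the equation can be solved for
  \<open>z\<close> or for \<open>s\<close> near every point.\<close>

definition incidence_reg :: "complex \<Rightarrow> bool \<Rightarrow> (complex \<times> complex \<times> complex \<times> complex) set" where
  "incidence_reg d b = {(x, y, z, s) \<in> incidence d b. line0 x y \<noteq> 0 \<or> line1 x y \<noteq> 0 \<or> line2 d x y \<noteq> 0}"

text \<open>Where \<open>line2\<close> is nonzero, w = - s * \<open>line2\<close> can replace
  \<open>s\<close>; the condition that \<open>z\<close> is nonzero then becomes w \<noteq>
  \<open>line0\<close>.\<close>

lemma has_euler_rescale:
  "has_euler {((x, s), y). x \<noteq> 0 \<and> y \<noteq> 1 \<and> (b \<longrightarrow> s \<noteq> 0) \<and> line1 x y \<noteq> 0 \<and> line0 x y + s * line2 d x y \<noteq> 0 \<and> line2 d x y \<noteq> 0} e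
   \<longleftrightarrow> has_euler {((x, y), w). x \<noteq> 0 \<and> y \<noteq> 1 \<and> line1 x y \<noteq> 0 \<and> line2 d x y \<noteq> 0 \<and> (b \<longrightarrow> w \<noteq> 0) \<and> w \<noteq> line0 x y} e"
  by (rule has_euler_iff_maps[where f = "\<lambda>((x, s), y). ((x, y), - (s * line2 d x y))"
        and g = "\<lambda>((x, y), w). ((x, - w / line2 d x y), y)"])
     (auto simp: split_beta line_defs intro!: continuous_intros simp: add_eq_0_iff2)

text \<open>Where \<open>line1\<close> is nonzero, \<open>z\<close> has been eliminated and only its
  nonvanishing remains as a condition. With \<open>y\<close> as last coordinate,
  \<open>line2 = 0\<close> is a graph over the plane of \<open>(x, s)\<close> on which
  \<open>s\<close> is free. If \<open>b\<close> holds, this graph has a factor C^* and removing it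
  costs nothing.\<close>

lemma has_euler_off_line1:
  assumes U: "has_euler (curve_complement d {0, 1} {0, 1}) u"
  shows "\<exists>c. has_euler {((x, s), y). x \<noteq> 0 \<and> y \<noteq> 1 \<and> (b \<longrightarrow> s \<noteq> 0) \<and> line1 x y \<noteq> 0 \<and> line0 x y + s * line2 d x y \<noteq> 0} c
     \<and> (b \<longrightarrow> c = - u)"
proof -
  define G where "G = {((x, s), y). x \<noteq> 0 \<and> y \<noteq> 1 \<and> (b \<longrightarrow> s \<noteq> 0) \<and> line1 x y \<noteq> 0 \<and> line0 x y + s * line2 d x y \<noteq> 0}"
  have G': "G = {p. fst (fst p) \<noteq> 0 \<and> snd p \<noteq> 1 \<and> (b \<longrightarrow> snd (fst p) \<noteq> 0) \<and> line1 (fst (fst p)) (snd p) \<noteq> 0 \<and>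
      line0 (fst (fst p)) (snd p) + snd (fst p) * line2 d (fst (fst p)) (snd p) \<noteq> 0}"
    by (auto simp: G_def)
  have oG: "open G"
    unfolding G' line_defs by (intro open_Collect_neq open_Collect_conj open_implies_neq continuous_intros)
  \<comment> \<open>The values of \<open>x\<close> lost on the curve \<open>line2 = 0\<close>: the
    torus boundary 0, the pole, the point with y = 1, the meeting point with
    \<open>line1 = 0\<close>, and 1, where \<open>line0\<close> and with it \<open>z\<close>
    vanishes.\<close>
  define F where "F = {0, - d / 2, - (1 + d) / 2, 2 - d, 1}"
  define k where "k = (1 - int (card F)) * (1 - int (card (zero_if b)))"
  have D: "open {p :: complex \<times> complex. 2 * fst p + d \<noteq> 0}"
    by (intro open_Collect_neq continuous_intros)
  have s: "{p \<in> {p. 2 * fst p + d \<noteq> 0}. (p, - 1 / (2 * fst p + d)) \<in> G} = (- F) \<times> (- zero_if b)"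
  proof -
    have "(x, s) \<in> {p \<in> {p. 2 * fst p + d \<noteq> 0}. (p, - 1 / (2 * fst p + d)) \<in> G} \<longleftrightarrow> (x, s) \<in> (- F) \<times> (- zero_if b)" for x s
    proof (cases "2 * x + d = 0")
      case True
      then show ?thesis using double_eq_iff[of x d] by (simp add: F_def)
    next
      case False
      define y where "y = - 1 / (2 * x + d)"
      have "y = 1 \<longleftrightarrow> x = - (1 + d) / 2" unfolding y_def by (rule slope_root[OF False])
      moreover have "line1 x y \<noteq> 0 \<longleftrightarrow> x \<noteq> 2 - d" using False by (auto simp: y_def line_defs field_simps)
      moreover have "line2 d x y = 0" using False linear_root[of "2 * x + d" y] by (simp add: line2_def y_def)
      moreover have "line0 x y = 0 \<longleftrightarrow> x = 1" using False by (auto simp: line0_def y_def)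
      moreover have "x \<noteq> - d / 2" using False double_eq_iff by blast
      moreover have "(x, s) \<in> {p \<in> {p. 2 * fst p + d \<noteq> 0}. (p, - 1 / (2 * fst p + d)) \<in> G}
          \<longleftrightarrow> x \<noteq> 0 \<and> y \<noteq> 1 \<and> (b \<longrightarrow> s \<noteq> 0) \<and> line1 x y \<noteq> 0 \<and> line0 x y + s * line2 d x y \<noteq> 0"
        using False by (simp add: G_def y_def)
      ultimately show ?thesis by (simp only: ) (auto simp: F_def zero_if)
    qed
    then have mem: "p \<in> {p \<in> {p. 2 * fst p + d \<noteq> 0}. (p, - 1 / (2 * fst p + d)) \<in> G} \<longleftrightarrow> p \<in> (- F) \<times> (- zero_if b)" for p
      by (cases p) (simp only:)
    show ?thesis by (rule Set.set_eqI) (rule mem)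
  qed
  have iff: "has_euler {p \<in> G. line2 d (fst (fst p)) (snd p) \<noteq> 0} e \<longleftrightarrow> has_euler G (e + k)" for e
  proof (rule has_euler_remove_graph[where B = UNIV and D = "{p. 2 * fst p + d \<noteq> 0}" and g = "\<lambda>p. - 1 / (2 * fst p + d)"])
    show "line2 d (fst (fst (p, t))) (snd (p, t)) = 0 \<longleftrightarrow> p \<in> {p. 2 * fst p + d \<noteq> 0} \<and> t = - 1 / (2 * fst p + d)"
      for p :: "complex \<times> complex" and t
      using linear_root[of "2 * fst p + d" t] by (simp add: line_defs)
    show "has_euler {p \<in> {p. 2 * fst p + d \<noteq> 0}. (p, - 1 / (2 * fst p + d)) \<in> G} k"
      unfolding s k_def by (intro has_euler_times_cofinite has_euler_cofinite zero_if) (simp add: F_def)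
  qed (use oG D in \<open>auto intro!: continuous_intros simp: line_defs\<close>)
  have eq: "{p \<in> G. line2 d (fst (fst p)) (snd p) \<noteq> 0}
      = {((x, s), y). x \<noteq> 0 \<and> y \<noteq> 1 \<and> (b \<longrightarrow> s \<noteq> 0) \<and> line1 x y \<noteq> 0 \<and> line0 x y + s * line2 d x y \<noteq> 0 \<and> line2 d x y \<noteq> 0}"
    by (auto simp: G_def)
  have "has_euler G ((if b then - u else 0) + k)"
    unfolding iff[symmetric] eq has_euler_rescale by (rule has_euler_residual[OF U])
  moreover have "b \<longrightarrow> (if b then - u else 0) + k = - u" by (simp add: k_def zero_if_def)
  ultimately show ?thesis unfolding G_def by blast
qed

text \<open>The divisor \<open>line1 = 0\<close> is filled in. On it \<open>s\<close> is determined
  and \<open>z\<close> is free in the punctured plane, so its Euler characteristic is 0. In the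
  chart t = \<open>line1\<close> is the normal coordinate: \<open>x\<close> and \<open>t\<close>
  give \<open>y\<close>, and the equation gives \<open>s\<close>.\<close>

lemma has_euler_incidence_reg:
  assumes U: "has_euler (curve_complement d {0, 1} {0, 1}) u"
  shows "\<exists>c. has_euler (incidence_reg d b) c \<and> (b \<longrightarrow> c = - u)"
proof -
  \<comment> \<open>The values of \<open>x\<close> lost on \<open>line1 = 0\<close>: the torus
    boundary 0, the pole -2, then -3 with y = 1, the point 2 - d with \<open>line2 = 0\<close>, and,
    if \<open>b\<close> holds, also 1, where \<open>line0\<close> and hence \<open>s\<close>
    vanishes.\<close>
  define F where "F = {0, -2, -3, 2 - d} \<union> (if b then {1} else {})"
  define Z where "Z = {p \<in> incidence_reg d b. line1 (fst p) (fst (snd p)) = 0}"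
  define N where "N = {p \<in> incidence_reg d b. fst p + 2 \<noteq> 0 \<and> line2 d (fst p) (fst (snd p)) \<noteq> 0}"
  \<comment> \<open>The conditions y \<noteq> 1, \<open>line2\<close> \<noteq> 0 and s \<noteq> 0
    with y = (t - 1) / (x + 2) substituted and the denominator x + 2 cleared.\<close>
  define V where "V = {((x, z), t). x + 2 \<noteq> 0 \<and> x \<noteq> 0 \<and> z \<noteq> 0 \<and> t - 1 \<noteq> x + 2 \<and>
     (2 * x + d) * (t - 1) + (x + 2) \<noteq> 0 \<and> (b \<longrightarrow> (x - 1) * (t - 1) + z * t * (x + 2) \<noteq> 0)}"
  have V': "V = {p. fst (fst p) + 2 \<noteq> 0 \<and> fst (fst p) \<noteq> 0 \<and> snd (fst p) \<noteq> 0 \<and> snd p - 1 \<noteq> fst (fst p) + 2 \<and>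
     (2 * fst (fst p) + d) * (snd p - 1) + (fst (fst p) + 2) \<noteq> 0 \<and>
     (b \<longrightarrow> (fst (fst p) - 1) * (snd p - 1) + snd (fst p) * snd p * (fst (fst p) + 2) \<noteq> 0)}"
    by (auto simp: V_def)
  have oV: "open V"
    unfolding V' by (intro open_Collect_neq open_Collect_conj open_implies_neq continuous_intros)
  have "has_euler (incidence_reg d b - Z) e \<longleftrightarrow> has_euler (incidence_reg d b) (e + 0)" for e
  proof (rule has_euler_remove_closed[where N = N and B = UNIV and V = V
        and \<phi> = "\<lambda>(x, y, z, s). (x, z)" and \<tau> = "\<lambda>(x, y, z, s). line1 x y"
        and \<psi> = "\<lambda>((x, z), t). (x, (t - 1) / (x + 2), z, - (line0 x ((t - 1) / (x + 2)) + z * t) / line2 d x ((t - 1) / (x + 2)))"])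
    show "closedin (top_of_set (incidence_reg d b)) Z"
      unfolding Z_def line_defs by (intro continuous_closedin_preimage_constant continuous_intros)
    show "Z \<subseteq> N"
      by (auto simp: Z_def N_def incidence_reg_def incidence_def line1_def)
    have "N = incidence_reg d b \<inter> {p. fst p + 2 \<noteq> 0 \<and> line2 d (fst p) (fst (snd p)) \<noteq> 0}" by (auto simp: N_def)
    moreover have "open {p :: complex \<times> complex \<times> complex \<times> complex. fst p + 2 \<noteq> 0 \<and> line2 d (fst p) (fst (snd p)) \<noteq> 0}"
      unfolding line_defs by (intro open_Collect_neq open_Collect_conj continuous_intros)
    ultimately show "openin (top_of_set (incidence_reg d b)) N" by (simp only: openin_open_Int)
    show "openin (top_of_set (UNIV \<times> UNIV)) V" using oV by simp
    show "homeomorphism N V (\<lambda>p. ((\<lambda>(x, y, z, s). (x, z)) p, (\<lambda>(x, y, z, s). line1 x y) p))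
       (\<lambda>((x, z), t). (x, (t - 1) / (x + 2), z, - (line0 x ((t - 1) / (x + 2)) + z * t) / line2 d x ((t - 1) / (x + 2))))"
      (is "homeomorphism N V ?f ?g")
    proof (rule homeomorphismI)
      show "continuous_on N ?f"
        unfolding line_defs split_beta by (intro continuous_intros)
      have V2: "line2 d x ((t - 1) / (x + 2)) \<noteq> 0 \<and> x + 2 \<noteq> 0" if "((x, z), t) \<in> V" for x z t
        using that by (auto simp: V_def line2_def field_simps)
      then show "continuous_on V ?g"
        unfolding split_beta line_defs by (intro continuous_intros) auto
      have NV: "?f p \<in> V \<and> ?g (?f p) = p" if p: "p \<in> N" for p
      proof -
        obtain x y z s where xy: "p = (x, y, z, s)" "x \<noteq> 0" "y \<noteq> 1" "z \<noteq> 0" "b \<longrightarrow> s \<noteq> 0"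
          and eq: "line0 x y + z * line1 x y + s * line2 d x y = 0" and n: "x + 2 \<noteq> 0" "line2 d x y \<noteq> 0"
          using p by (cases p) (auto simp: N_def incidence_reg_def incidence_def)
        have t: "line1 x y - 1 = (x + 2) * y" by (simp add: line_defs)
        then have y: "(line1 x y - 1) / (x + 2) = y" using n by simp
        have "line0 x y + z * line1 x y = - s * line2 d x y" using eq by (simp add: eq_neg_iff_add_eq_0)
        then have s: "- (line0 x y + z * line1 x y) / line2 d x y = s" using n by simp
        have "(2 * x + d) * (line1 x y - 1) + (x + 2) = (x + 2) * line2 d x y"
          unfolding t by (simp add: line_defs algebra_simps)
        moreover have "(x - 1) * (line1 x y - 1) + z * line1 x y * (x + 2) = (x + 2) * (- s * line2 d x y)"
          unfolding t \<open>line0 x y + z * line1 x y = - s * line2 d x y\<close>[symmetric] by (simp add: line0_def algebra_simps)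
        moreover have "line1 x y - 1 \<noteq> x + 2" unfolding t using n xy by simp
        ultimately have "?f p \<in> V" using xy n by (auto simp: V_def)
        then show ?thesis using y s by (simp add: xy)
      qed
      have VN: "?g q \<in> N \<and> ?f (?g q) = q" if q: "q \<in> V" for q
      proof -
        obtain x z t where xz: "q = ((x, z), t)" "x + 2 \<noteq> 0" "x \<noteq> 0" "z \<noteq> 0" "t - 1 \<noteq> x + 2"
          "(2 * x + d) * (t - 1) + (x + 2) \<noteq> 0" "b \<longrightarrow> (x - 1) * (t - 1) + z * t * (x + 2) \<noteq> 0"
          using q by (cases q) (auto simp: V_def)
        define y where "y = (t - 1) / (x + 2)"
        have ty: "t - 1 = (x + 2) * y" using xz by (simp add: y_def)
        then have t: "t = line1 x y" by (simp add: line1_def algebra_simps)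
        have "(2 * x + d) * (t - 1) + (x + 2) = (x + 2) * line2 d x y"
          unfolding ty by (simp add: line_defs algebra_simps)
        then have n: "line2 d x y \<noteq> 0" using xz by auto
        have "(x - 1) * (t - 1) + z * t * (x + 2) = (x + 2) * (line0 x y + z * t)"
          unfolding ty by (simp add: line0_def algebra_simps)
        then have s: "b \<longrightarrow> line0 x y + z * t \<noteq> 0" using xz by auto
        have y: "y \<noteq> 1" using xz ty by auto
        have g: "?g q = (x, y, z, - (line0 x y + z * t) / line2 d x y)" by (simp add: xz(1) y_def)
        have "- (line0 x y + z * t) / line2 d x y * line2 d x y = - (line0 x y + z * t)" using n by simp
        then have "line0 x y + z * line1 x y + - (line0 x y + z * t) / line2 d x y * line2 d x y = 0"
          by (simp only: t) simp
        moreover have "b \<longrightarrow> - (line0 x y + z * t) / line2 d x y \<noteq> 0"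
          using s n by (simp only: divide_eq_0_iff neg_equal_0_iff_equal) simp
        ultimately have "?g q \<in> N" unfolding g N_def incidence_reg_def incidence_def
          using n y xz(2-4) by (simp only: mem_Collect_eq prod.case fst_conv snd_conv) simp
        then show ?thesis unfolding g by (simp add: xz(1) t)
      qed
      show "?f ` N \<subseteq> V" "?g ` V \<subseteq> N" using NV VN by blast+
      show "?g (?f p) = p" if "p \<in> N" for p using NV[OF that] by blast
      show "?f (?g q) = q" if "q \<in> V" for q using VN[OF that] by blast
    qed
    show "p \<in> Z \<longleftrightarrow> (\<lambda>(x, y, z, s). line1 x y) p = 0" if "p \<in> N" for p
      using that by (cases p) (simp add: Z_def N_def)
    have "{p. (p, 0) \<in> V} = (- F) \<times> (- {0})"
      by (auto simp: V_def F_def add_eq_0_iff2 algebra_simps)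
    then show "has_euler {p. (p, 0) \<in> V} 0"
      using has_euler_times_punctured has_euler_cofinite[of F] by (auto simp: F_def)
  qed
  moreover have "has_euler (incidence_reg d b - Z) e \<longleftrightarrow>
     has_euler {((x, s), y). x \<noteq> 0 \<and> y \<noteq> 1 \<and> (b \<longrightarrow> s \<noteq> 0) \<and> line1 x y \<noteq> 0 \<and> line0 x y + s * line2 d x y \<noteq> 0} e" for e
  proof (rule has_euler_iff_maps[where f = "\<lambda>(x, y, z, s). ((x, s), y)"
        and g = "\<lambda>((x, s), y). (x, y, - (line0 x y + s * line2 d x y) / line1 x y, s)"])
    fix p assume "p \<in> incidence_reg d b - Z"
    then obtain x y z s where xy: "p = (x, y, z, s)" "x \<noteq> 0" "y \<noteq> 1" "z \<noteq> 0" "b \<longrightarrow> s \<noteq> 0"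
      and eq: "line0 x y + z * line1 x y + s * line2 d x y = 0" and n: "line1 x y \<noteq> 0"
      by (cases p) (auto simp: Z_def incidence_reg_def incidence_def)
    have z: "line0 x y + s * line2 d x y = - z * line1 x y"
      using eq by (simp add: eq_neg_iff_add_eq_0 algebra_simps)
    have q: "- (line0 x y + s * line2 d x y) / line1 x y = z" unfolding z using n by simp
    show "(\<lambda>(x, y, z, s). ((x, s), y)) p \<in> {((x, s), y). x \<noteq> 0 \<and> y \<noteq> 1 \<and> (b \<longrightarrow> s \<noteq> 0) \<and> line1 x y \<noteq> 0 \<and> line0 x y + s * line2 d x y \<noteq> 0} \<and>
      (\<lambda>((x, s), y). (x, y, - (line0 x y + s * line2 d x y) / line1 x y, s)) ((\<lambda>(x, y, z, s). ((x, s), y)) p) = p"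
      unfolding xy(1) prod.case q using xy n z by simp
  next
    show "continuous_on (incidence_reg d b - Z) (\<lambda>(x, y, z, s). ((x, s), y))"
      unfolding split_beta by (intro continuous_intros)
    show "continuous_on {((x, s), y). x \<noteq> 0 \<and> y \<noteq> 1 \<and> (b \<longrightarrow> s \<noteq> 0) \<and> line1 x y \<noteq> 0 \<and> line0 x y + s * line2 d x y \<noteq> 0}
      (\<lambda>((x, s), y). (x, y, - (line0 x y + s * line2 d x y) / line1 x y, s))"
      unfolding split_beta line_defs by (intro continuous_intros) auto
  qed (auto simp: Z_def incidence_reg_def incidence_def neg_eq_iff_add_eq_0 eq_neg_iff_add_eq_0)
  ultimately show ?thesis using has_euler_off_line1[OF U, of b] by auto
qed


section \<open>The base point of the pencil\<close>

text \<open>For \<open>d = 1\<close> the forms \<open>line0\<close> and \<open>line1\<close> are local coordinates \<open>\<sigma>\<close> and \<open>t\<close> at the base point, and the third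
  form is \<open>\<sigma> + t\<close>. The following sets are the slices \<open>t = g \<sigma>\<close> and \<open>\<sigma> = g t\<close> of the resulting cone.\<close>

definition cone_link :: "bool \<Rightarrow> bool \<Rightarrow> (complex \<times> complex \<times> complex) set" where
  "cone_link b c = {(g, z, s). (c \<longrightarrow> g \<noteq> 0) \<and> z \<noteq> 0 \<and> (b \<longrightarrow> s \<noteq> 0) \<and> 1 + s + (z + s) * g = 0}"

definition cone_link' :: "bool \<Rightarrow> (complex \<times> complex \<times> complex) set" where
  "cone_link' b = {(g, z, s). z \<noteq> 0 \<and> (b \<longrightarrow> s \<noteq> 0) \<and> (1 + s) * g + (z + s) = 0}"

text \<open>Only finite total rank is claimed: a punctured disc bundle over the link has Euler
  characteristic 0 whatever the value of the link. With v = z + s the link becomes an open set of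
  pairs (g, v). For v \<noteq> 0 the slope g is a function of (z, s), and these pairs fill a product
  of cofinite sets minus the line z + s = 0.\<close>

lemma cone_link_finite_type: "\<exists>e. has_euler (cone_link b c) e"
proof -
  define V where "V = {(g, v). (c \<longrightarrow> g \<noteq> 0) \<and> v + 1 + v * g \<noteq> 0 \<and> (b \<longrightarrow> - 1 - v * g \<noteq> (0::complex))}"
  \<comment> \<open>If g = 0 is excluded, then so is s = -1, because g = - (1 + s) / (z +
    s).\<close>
  define F where "F = zero_if b \<union> (if c then {-1} else {})"
  define R where "R = (- {0 :: complex}) \<times> (- F)"
  have finF: "finite F" by (simp add: F_def zero_if)
  have 1: "has_euler (cone_link b c) e \<longleftrightarrow> has_euler V e" for e
  proof (rule has_euler_iff_maps[where f = "\<lambda>(g, z, s). (g, z + s)" and g = "\<lambda>(g, v). (g, v + 1 + v * g, - 1 - v * g)"])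
    fix p assume "p \<in> cone_link b c"
    then obtain g z s where p: "p = (g, z, s)" "c \<longrightarrow> g \<noteq> 0" "z \<noteq> 0" "b \<longrightarrow> s \<noteq> 0" "1 + s + (z + s) * g = 0"
      by (cases p) (auto simp: cone_link_def)
    have "(z + s) * g = (1 + s + (z + s) * g) - 1 - s" by simp
    then have "(z + s) * g = - 1 - s" by (simp only: p(5)) simp
    then show "(\<lambda>(g, z, s). (g, z + s)) p \<in> V \<and> (\<lambda>(g, v). (g, v + 1 + v * g, - 1 - v * g)) ((\<lambda>(g, z, s). (g, z + s)) p) = p"
      unfolding p(1) prod.case V_def using p(2-4) by simp
  next
    fix q assume "q \<in> V"
    then obtain g v where q: "q = (g, v)" "c \<longrightarrow> g \<noteq> 0" "v + 1 + v * g \<noteq> 0" "b \<longrightarrow> - 1 - v * g \<noteq> 0"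
      by (cases q) (auto simp: V_def)
    then show "(\<lambda>(g, v). (g, v + 1 + v * g, - 1 - v * g)) q \<in> cone_link b c \<and> (\<lambda>(g, z, s). (g, z + s)) ((\<lambda>(g, v). (g, v + 1 + v * g, - 1 - v * g)) q) = q"
      unfolding q(1) prod.case cone_link_def by (simp add: diff_diff_eq)
  qed (auto simp: split_beta intro!: continuous_intros)
  have "V = {p. (c \<longrightarrow> fst p \<noteq> 0) \<and> snd p + 1 + snd p * fst p \<noteq> 0 \<and> (b \<longrightarrow> - 1 - snd p * fst p \<noteq> 0)}"
    by (auto simp: V_def)
  moreover have "open \<dots>"
    by (intro open_Collect_neq open_Collect_conj open_implies_neq continuous_intros)
  ultimately have oV: "open V" by simp
  have 2: "has_euler {p \<in> V. snd p \<noteq> 0} e \<longleftrightarrow> has_euler V (e + (1 - int (card (zero_if c))))" for e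
  proof (rule has_euler_remove_graph[where B = UNIV and D = "- zero_if c" and g = "\<lambda>_. 0"])
    have "{g \<in> - zero_if c. (g, 0) \<in> V} = - zero_if c" by (auto simp: V_def zero_if)
    then show "has_euler {g \<in> - zero_if c. (g, 0) \<in> V} (1 - int (card (zero_if c)))"
      using has_euler_cofinite zero_if(2) by simp
  qed (use oV in \<open>auto intro!: continuous_intros finite_imp_closed simp: zero_if V_def\<close>)
  have 3: "has_euler {p \<in> V. snd p \<noteq> 0} e \<longleftrightarrow> has_euler {p \<in> R. fst p + snd p \<noteq> 0} e" for e
  proof (rule has_euler_iff_maps[where f = "\<lambda>(g, v). (v + 1 + v * g, - 1 - v * g)" and g = "\<lambda>(z, s). (- (1 + s) / (z + s), z + s)"])
    fix q assume "q \<in> {p \<in> V. snd p \<noteq> 0}"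
    then obtain g v where q: "q = (g, v)" "c \<longrightarrow> g \<noteq> 0" "v + 1 + v * g \<noteq> 0" "b \<longrightarrow> - 1 - v * g \<noteq> 0" "v \<noteq> 0"
      by (cases q) (auto simp: V_def)
    then show "(\<lambda>(g, v). (v + 1 + v * g, - 1 - v * g)) q \<in> {p \<in> R. fst p + snd p \<noteq> 0} \<and>
      (\<lambda>(z, s). (- (1 + s) / (z + s), z + s)) ((\<lambda>(g, v). (v + 1 + v * g, - 1 - v * g)) q) = q"
      unfolding q(1) prod.case R_def F_def by (auto simp: zero_if)
  next
    fix p assume "p \<in> {p \<in> R. fst p + snd p \<noteq> 0}"
    then obtain z s where p: "p = (z, s)" "z \<noteq> 0" "b \<longrightarrow> s \<noteq> 0" "c \<longrightarrow> s \<noteq> - 1" "z + s \<noteq> 0"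
      by (cases p) (auto simp: R_def F_def zero_if split: if_splits)
    have "(z + s) * (- (1 + s) / (z + s)) = - 1 - s" using p(5) by simp
    moreover have "c \<longrightarrow> - (1 + s) / (z + s) \<noteq> 0" using p(4,5) by (auto simp: add_eq_0_iff)
    ultimately show "(\<lambda>(z, s). (- (1 + s) / (z + s), z + s)) p \<in> {p \<in> V. snd p \<noteq> 0} \<and>
      (\<lambda>(g, v). (v + 1 + v * g, - 1 - v * g)) ((\<lambda>(z, s). (- (1 + s) / (z + s), z + s)) p) = p"
      unfolding p(1) prod.case V_def mem_Collect_eq fst_conv snd_conv using p(2-5) by simp
  qed (auto simp: split_beta intro!: continuous_intros)
  have "\<exists>e. has_euler {p \<in> R. fst p + snd p \<noteq> 0} e"
  proof -
    have "has_euler R (0 * (1 - int (card F)))"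
      unfolding R_def using has_euler_cofinite[of "{0}"] finF by (intro has_euler_times_cofinite) auto
    then have "has_euler {p \<in> R. fst p + snd p \<noteq> 0} (0 * (1 - int (card F)) - (1 - int (card ({0} \<union> uminus ` F))))"
    proof (rule has_euler_graph_complement[where B = UNIV and D = "- {0}" and g = "\<lambda>z. - z", rotated -1])
      have "{z \<in> - {0}. (z, - z) \<in> R} = - ({0} \<union> uminus ` F)"
        by (auto simp: R_def image_iff) (metis minus_minus)
      then show "has_euler {z \<in> - {0}. (z, - z) \<in> R} (1 - int (card ({0} \<union> uminus ` F)))"
        using has_euler_cofinite[of "{0} \<union> uminus ` F"] finF by simp
      show "openin (top_of_set (UNIV \<times> UNIV)) R"
        unfolding R_def using finF by (auto intro!: open_Times finite_imp_closed)
    qed (auto intro!: continuous_intros simp: R_def add_eq_0_iff)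
    then show ?thesis by blast
  qed
  then show ?thesis using 1 2 3 by blast
qed

text \<open>The same device with u = 1 + s, the coefficient of g. For u \<noteq> 0 the pairs (z, s)
  now fill a full product of cofinite sets.\<close>

lemma cone_link'_finite_type: "\<exists>e. has_euler (cone_link' b) e"
proof -
  define V where "V = {(g, u). 1 - u - u * g \<noteq> 0 \<and> (b \<longrightarrow> u - 1 \<noteq> (0::complex))}"
  define F where "F = {-1} \<union> zero_if b"
  define R where "R = (- {0 :: complex}) \<times> (- F)"
  have finF: "finite F" by (simp add: F_def zero_if)
  have 1: "has_euler (cone_link' b) e \<longleftrightarrow> has_euler V e" for e
  proof (rule has_euler_iff_maps[where f = "\<lambda>(g, z, s). (g, 1 + s)" and g = "\<lambda>(g, u). (g, 1 - u - u * g, u - 1)"])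
    fix p assume "p \<in> cone_link' b"
    then obtain g z s where p: "p = (g, z, s)" "z \<noteq> 0" "b \<longrightarrow> s \<noteq> 0" "(1 + s) * g + (z + s) = 0"
      by (cases p) (auto simp: cone_link'_def)
    have "(1 + s) * g = ((1 + s) * g + (z + s)) - z - s" by simp
    then have "(1 + s) * g = - z - s" by (simp only: p(4)) simp
    then show "(\<lambda>(g, z, s). (g, 1 + s)) p \<in> V \<and> (\<lambda>(g, u). (g, 1 - u - u * g, u - 1)) ((\<lambda>(g, z, s). (g, 1 + s)) p) = p"
      unfolding p(1) prod.case V_def using p(2,3) by simp
  next
    fix q assume "q \<in> V"
    then show "(\<lambda>(g, u). (g, 1 - u - u * g, u - 1)) q \<in> cone_link' b \<and> (\<lambda>(g, z, s). (g, 1 + s)) ((\<lambda>(g, u). (g, 1 - u - u * g, u - 1)) q) = q"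
      by (cases q) (simp add: V_def cone_link'_def)
  qed (auto simp: split_beta intro!: continuous_intros)
  have "V = {p. 1 - snd p - snd p * fst p \<noteq> 0 \<and> (b \<longrightarrow> snd p - 1 \<noteq> 0)}"
    by (auto simp: V_def)
  moreover have "open \<dots>"
    by (intro open_Collect_neq open_Collect_conj open_implies_neq continuous_intros)
  ultimately have oV: "open V" by simp
  have 2: "has_euler {p \<in> V. snd p \<noteq> 0} e \<longleftrightarrow> has_euler V (e + 1)" for e
  proof (rule has_euler_remove_graph[where B = UNIV and D = UNIV and g = "\<lambda>_. 0"])
    have "{g \<in> UNIV. (g, 0) \<in> V} = - {}" by (auto simp: V_def)
    then show "has_euler {g \<in> UNIV. (g, 0) \<in> V} 1"
      using has_euler_cofinite[of "{}"] by simp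
  qed (use oV in \<open>auto intro!: continuous_intros\<close>)
  have 3: "has_euler {p \<in> V. snd p \<noteq> 0} e \<longleftrightarrow> has_euler R e" for e
  proof (rule has_euler_iff_maps[where f = "\<lambda>(g, u). (1 - u - u * g, u - 1)" and g = "\<lambda>(z, s). (- (z + s) / (1 + s), 1 + s)"])
    fix q assume "q \<in> {p \<in> V. snd p \<noteq> 0}"
    then show "(\<lambda>(g, u). (1 - u - u * g, u - 1)) q \<in> R \<and>
      (\<lambda>(z, s). (- (z + s) / (1 + s), 1 + s)) ((\<lambda>(g, u). (1 - u - u * g, u - 1)) q) = q"
      by (cases q) (auto simp: V_def R_def F_def zero_if)
  next
    fix p assume "p \<in> R"
    then obtain z s where p: "p = (z, s)" "z \<noteq> 0" "b \<longrightarrow> s \<noteq> 0" "1 + s \<noteq> 0"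
      by (cases p) (auto simp: R_def F_def zero_if add_eq_0_iff)
    have "(1 + s) * (- (z + s) / (1 + s)) = - z - s" using p(4) by simp
    then show "(\<lambda>(z, s). (- (z + s) / (1 + s), 1 + s)) p \<in> {p \<in> V. snd p \<noteq> 0} \<and>
      (\<lambda>(g, u). (1 - u - u * g, u - 1)) ((\<lambda>(z, s). (- (z + s) / (1 + s), 1 + s)) p) = p"
      unfolding p(1) prod.case V_def mem_Collect_eq fst_conv snd_conv using p(2-4) by simp
  qed (auto simp: split_beta intro!: continuous_intros simp: R_def F_def add_eq_0_iff)
  have "has_euler R (0 * (1 - int (card F)))"
    unfolding R_def using has_euler_cofinite[of "{0}"] finF by (intro has_euler_times_cofinite) auto
  then show ?thesis using 1 2 3 by blast
qed

section \<open>The cone around the fibre over the base point\<close>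

definition cone_nbhd :: "bool \<Rightarrow> (complex \<times> complex \<times> complex \<times> complex) set" where
  "cone_nbhd b = {(\<sigma>, t, z, s). norm \<sigma> < 1 / 10 \<and> norm t < 1 / 10 \<and> z \<noteq> 0 \<and> (b \<longrightarrow> s \<noteq> 0) \<and>
     \<sigma> + z * t + s * (\<sigma> + t) = 0}"

text \<open>For fixed z and s the equation is homogeneous in \<sigma> and t, so scaling these two
  preserves it. The fibre over the vertex has the factor C^* of the coordinate z, hence the value
  0.\<close>

lemma has_euler_cone_nbhd: "has_euler (cone_nbhd b) 0"
proof (rule has_euler_deformation[where T = "(- {0 :: complex}) \<times> (- zero_if b)"
      and f = "\<lambda>(\<sigma>, t, z, s). (z, s)" and g = "\<lambda>(z, s). (0, 0, z, s)"
      and h = "\<lambda>u (\<sigma>, t, z, s). (of_real u * \<sigma>, of_real u * t, z, s)"])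
  show "(case p of (\<sigma>, t, z, s) \<Rightarrow> (of_real u * \<sigma>, of_real u * t, z, s)) \<in> cone_nbhd b"
    if u: "u \<in> {0..1}" and p: "p \<in> cone_nbhd b" for u p
  proof -
    obtain \<sigma> t z s where p': "p = (\<sigma>, t, z, s)" by (cases p)
    have "norm (of_real u * w) < 1 / 10" if "norm w < 1 / 10" for w :: complex
      using u that mult_left_le_one_le[of "norm w" u] by (simp add: norm_mult)
    moreover have "of_real u * \<sigma> + z * (of_real u * t) + s * (of_real u * \<sigma> + of_real u * t)
       = of_real u * (\<sigma> + z * t + s * (\<sigma> + t))" by (simp add: algebra_simps)
    ultimately show ?thesis using p by (simp add: cone_nbhd_def p')
  qed
  show "has_euler ((- {0 :: complex}) \<times> (- zero_if b)) 0"
    using has_euler_times_cofinite[OF zero_if(2)[of b] has_euler_cofinite[of "{0}"]] by simp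
qed (auto simp: cone_nbhd_def zero_if split_beta intro!: continuous_intros)

lemma has_euler_cone_sector:
  fixes L :: "(complex \<times> complex \<times> complex) set"
  assumes "\<exists>e. has_euler L e"
  shows "has_euler {(\<sigma>, g, z, s). \<sigma> \<noteq> 0 \<and> norm \<sigma> < 1 / 10 \<and> norm (\<sigma> * g) < 1 / 10 \<and> (g, z, s) \<in> L} 0" (is "has_euler ?S 0")
proof -
  \<comment> \<open>The bounds on \<sigma> and \<sigma> g merge into one radius that depends
    continuously on g, so the sector is a punctured tube over \<open>L\<close>.\<close>
  define \<rho> where "\<rho> = (\<lambda>p :: complex \<times> complex \<times> complex. 1 / (10 * max 1 (norm (fst p))))"
  obtain e where e: "has_euler L e" using assms by blast
  have "has_euler {p. fst p \<in> L \<and> norm (snd p :: complex) < \<rho> (fst p) \<and> snd p \<noteq> 0} 0" (is "has_euler ?T 0")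
    by (rule has_euler_punctured_tube[OF _ _ e]) (auto simp: \<rho>_def intro!: continuous_intros)
  moreover have lt: "norm \<sigma> < \<rho> (g, z, s) \<longleftrightarrow> norm \<sigma> < 1 / 10 \<and> norm (\<sigma> * g) < 1 / 10" for \<sigma> g z s
  proof -
    have "norm \<sigma> < \<rho> (g, z, s) \<longleftrightarrow> norm \<sigma> * max 1 (norm g) < 1 / 10"
      by (simp add: \<rho>_def field_simps)
    also have "norm \<sigma> * max 1 (norm g) = max (norm \<sigma>) (norm (\<sigma> * g))"
      by (simp add: max_mult_distrib_left norm_mult)
    finally show ?thesis by auto
  qed
  have "has_euler ?S 0 \<longleftrightarrow> has_euler ?T 0"
    by (rule has_euler_iff_maps[where f = "\<lambda>(\<sigma>, g, z, s). ((g, z, s), \<sigma>)" and g = "\<lambda>((g, z, s), \<sigma>). (\<sigma>, g, z, s)"])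
      (auto simp: lt split_beta intro!: continuous_intros)
  ultimately show ?thesis by simp
qed

text \<open>The slopes t / \<sigma> and \<sigma> / t are the two charts of the blow-up of the
  vertex. In each of them, and on their overlap, the cone becomes a sector over a link of finite
  type, so Mayer-Vietoris only combines zeros.\<close>

lemma has_euler_punctured_cone: "has_euler {(\<sigma>, t, z, s) \<in> cone_nbhd b. \<sigma> \<noteq> 0 \<or> t \<noteq> 0} 0"
proof -
  define W where "W = {(\<sigma>, t, z, s) \<in> cone_nbhd b. \<sigma> \<noteq> 0 \<or> t \<noteq> 0}"
  define A where "A = {(\<sigma>, t, z, s) \<in> cone_nbhd b. \<sigma> \<noteq> 0}"
  define B where "B = {(\<sigma>, t, z, s) \<in> cone_nbhd b. t \<noteq> 0}"
  have op: "open {p :: complex \<times> complex \<times> complex \<times> complex. fst p \<noteq> 0}"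
    "open {p :: complex \<times> complex \<times> complex \<times> complex. fst (snd p) \<noteq> 0}"
    by (auto intro!: open_Collect_neq continuous_intros)
  have W: "A = W \<inter> {p. fst p \<noteq> 0}" "B = W \<inter> {p. fst (snd p) \<noteq> 0}" "W = A \<union> B"
    by (auto simp: W_def A_def B_def)
  have part: "has_euler {(\<sigma>, t, z, s) \<in> cone_nbhd b. \<sigma> \<noteq> 0 \<and> (c \<longrightarrow> t \<noteq> 0)} 0" for c
  proof -
    have "has_euler {(\<sigma>, t, z, s) \<in> cone_nbhd b. \<sigma> \<noteq> 0 \<and> (c \<longrightarrow> t \<noteq> 0)} 0 \<longleftrightarrow>
      has_euler {(\<sigma>, g, z, s). \<sigma> \<noteq> 0 \<and> norm \<sigma> < 1 / 10 \<and> norm (\<sigma> * g) < 1 / 10 \<and> (g, z, s) \<in> cone_link b c} 0"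
      (is "_ \<longleftrightarrow> has_euler ?R 0")
    proof (rule has_euler_iff_maps[where f = "\<lambda>(\<sigma>, t, z, s). (\<sigma>, t / \<sigma>, z, s)" and g = "\<lambda>(\<sigma>, g, z, s). (\<sigma>, \<sigma> * g, z, s)"])
      have eq: "\<sigma> + z * (\<sigma> * g) + s * (\<sigma> + \<sigma> * g) = \<sigma> * (1 + s + (z + s) * g)" for \<sigma> g z s :: complex
        by (simp add: algebra_simps)
      fix p assume "p \<in> {(\<sigma>, t, z, s) \<in> cone_nbhd b. \<sigma> \<noteq> 0 \<and> (c \<longrightarrow> t \<noteq> 0)}"
      then obtain \<sigma> t z s where p: "p = (\<sigma>, t, z, s)" "(\<sigma>, t, z, s) \<in> cone_nbhd b" "\<sigma> \<noteq> 0" "c \<longrightarrow> t \<noteq> 0"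
        by (cases p) auto
      then show "(\<lambda>(\<sigma>, t, z, s). (\<sigma>, t / \<sigma>, z, s)) p \<in> ?R \<and> (\<lambda>(\<sigma>, g, z, s). (\<sigma>, \<sigma> * g, z, s)) ((\<lambda>(\<sigma>, t, z, s). (\<sigma>, t / \<sigma>, z, s)) p) = p"
        using eq[of \<sigma> z "t / \<sigma>" s] by (simp add: cone_nbhd_def cone_link_def)
    next
      have eq: "\<sigma> + z * (\<sigma> * g) + s * (\<sigma> + \<sigma> * g) = \<sigma> * (1 + s + (z + s) * g)" for \<sigma> g z s :: complex
        by (simp add: algebra_simps)
      fix q assume "q \<in> ?R"
      then show "(\<lambda>(\<sigma>, g, z, s). (\<sigma>, \<sigma> * g, z, s)) q \<in> {(\<sigma>, t, z, s) \<in> cone_nbhd b. \<sigma> \<noteq> 0 \<and> (c \<longrightarrow> t \<noteq> 0)} \<and>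
          (\<lambda>(\<sigma>, t, z, s). (\<sigma>, t / \<sigma>, z, s)) ((\<lambda>(\<sigma>, g, z, s). (\<sigma>, \<sigma> * g, z, s)) q) = q"
        by (cases q) (simp add: cone_nbhd_def cone_link_def eq)
    qed (auto simp: split_beta intro!: continuous_intros)
    then show ?thesis using has_euler_cone_sector[OF cone_link_finite_type] by simp
  qed
  have "has_euler B 0 \<longleftrightarrow>
      has_euler {(\<sigma>, g, z, s). \<sigma> \<noteq> 0 \<and> norm \<sigma> < 1 / 10 \<and> norm (\<sigma> * g) < 1 / 10 \<and> (g, z, s) \<in> cone_link' b} 0"
    (is "_ \<longleftrightarrow> has_euler ?R 0")
  proof (rule has_euler_iff_maps[where f = "\<lambda>(\<sigma>, t, z, s). (t, \<sigma> / t, z, s)" and g = "\<lambda>(\<sigma>, g, z, s). (\<sigma> * g, \<sigma>, z, s)"])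
    have eq: "\<sigma> * g + z * \<sigma> + s * (\<sigma> * g + \<sigma>) = \<sigma> * ((1 + s) * g + (z + s))" for \<sigma> g z s :: complex
      by (simp add: algebra_simps)
    fix p assume "p \<in> B"
    then obtain \<sigma> t z s where p: "p = (\<sigma>, t, z, s)" "(\<sigma>, t, z, s) \<in> cone_nbhd b" "t \<noteq> 0"
      by (cases p) (auto simp: B_def)
    then show "(\<lambda>(\<sigma>, t, z, s). (t, \<sigma> / t, z, s)) p \<in> ?R \<and> (\<lambda>(\<sigma>, g, z, s). (\<sigma> * g, \<sigma>, z, s)) ((\<lambda>(\<sigma>, t, z, s). (t, \<sigma> / t, z, s)) p) = p"
      using eq[of t "\<sigma> / t" z s] by (simp add: cone_nbhd_def cone_link'_def)
  next
    have eq: "\<sigma> * g + z * \<sigma> + s * (\<sigma> * g + \<sigma>) = \<sigma> * ((1 + s) * g + (z + s))" for \<sigma> g z s :: complex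
      by (simp add: algebra_simps)
    fix q assume "q \<in> ?R"
    then show "(\<lambda>(\<sigma>, g, z, s). (\<sigma> * g, \<sigma>, z, s)) q \<in> B \<and>
        (\<lambda>(\<sigma>, t, z, s). (t, \<sigma> / t, z, s)) ((\<lambda>(\<sigma>, g, z, s). (\<sigma> * g, \<sigma>, z, s)) q) = q"
      by (cases q) (simp add: B_def cone_nbhd_def cone_link'_def eq)
  qed (auto simp: split_beta B_def intro!: continuous_intros)
  then have "has_euler B 0" using has_euler_cone_sector[OF cone_link'_finite_type] by simp
  moreover have "has_euler A 0" using part[of False] by (simp add: A_def)
  moreover have "A \<inter> B = {(\<sigma>, t, z, s) \<in> cone_nbhd b. \<sigma> \<noteq> 0 \<and> (True \<longrightarrow> t \<noteq> 0)}"
    by (auto simp: A_def B_def)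
  then have "has_euler (A \<inter> B) 0" using part[of True] by simp
  moreover have "openin (top_of_set W) A" "openin (top_of_set W) B"
    unfolding W(1,2) using op by (auto intro: openin_open_Int)
  ultimately have "has_euler W (0 + 0 - 0)"
    using has_euler_openin_Un[of W A B 0 0 0] W(3) by blast
  then show ?thesis by (simp add: W_def)
qed

text \<open>The original coordinates are y = (t - \<sigma> - 1) / 3 and x = 1 + \<sigma> / y, and
  the claims read y \<noteq> 0, y \<noteq> 1 and x y \<noteq> 0. The radius 1/10 is thus small
  enough to keep the neighbourhood inside the torus.\<close>

lemma cone_bounds:
  fixes \<sigma> t :: complex
  assumes "norm \<sigma> < 1 / 10" "norm t < 1 / 10"
  shows "t - \<sigma> - 1 \<noteq> 0" "t - \<sigma> - 1 \<noteq> 3" "\<sigma> + (t - \<sigma> - 1) / 3 \<noteq> 0"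
proof -
  have a: "norm (t - \<sigma>) < 1 / 5" using norm_triangle_ineq4[of t \<sigma>] assms by simp
  then show "t - \<sigma> - 1 \<noteq> 0" by auto
  show "t - \<sigma> - 1 \<noteq> 3"
  proof
    assume "t - \<sigma> - 1 = 3"
    then have "t - \<sigma> = 4" by (simp add: algebra_simps)
    then show False using a by simp
  qed
  have b: "norm (2 * \<sigma> + t) < 1"
    using norm_triangle_ineq[of "2 * \<sigma>" t] assms by (simp add: norm_mult)
  show "\<sigma> + (t - \<sigma> - 1) / 3 \<noteq> 0"
  proof
    assume "\<sigma> + (t - \<sigma> - 1) / 3 = 0"
    then have "2 * \<sigma> + t = 1" by (simp add: field_simps)
    then show False using b by simp
  qed
qed

text \<open>Since \<open>line1 - line0\<close> is 3 y + 1, the two forms determine y and then x, so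
  they are coordinates near x = 1, y = -1/3. For d = 1 the third form is their sum. The predicate
  \<open>P\<close> covers the full and the punctured neighbourhood at once.\<close>

lemma has_euler_near_base_point:
  "has_euler {(x, y, z, s) \<in> incidence 1 b. norm (line0 x y) < 1 / 10 \<and> norm (line1 x y) < 1 / 10 \<and> P (line0 x y) (line1 x y)} e
    \<longleftrightarrow> has_euler {(\<sigma>, t, z, s) \<in> cone_nbhd b. P \<sigma> t} e" (is "has_euler ?M e \<longleftrightarrow> has_euler ?C e")
proof (rule has_euler_iff_maps[where f = "\<lambda>(x, y, z, s). (line0 x y, line1 x y, z, s)"
      and g = "\<lambda>(\<sigma>, t, z, s). (1 + \<sigma> / ((t - \<sigma> - 1) / 3), (t - \<sigma> - 1) / 3, z, s)"])
  show "continuous_on ?M (\<lambda>(x, y, z, s). (line0 x y, line1 x y, z, s))"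
    unfolding split_beta line_defs by (intro continuous_intros)
  show "continuous_on ?C (\<lambda>(\<sigma>, t, z, s). (1 + \<sigma> / ((t - \<sigma> - 1) / 3), (t - \<sigma> - 1) / 3, z, s))"
    unfolding split_beta using cone_bounds(1) by (intro continuous_intros) (auto simp: cone_nbhd_def)
next
  fix p assume "p \<in> ?M"
  then obtain x y z s where p: "p = (x, y, z, s)" "x \<noteq> 0" "y \<noteq> 1" "z \<noteq> 0" "b \<longrightarrow> s \<noteq> 0"
    "line0 x y + z * line1 x y + s * line2 1 x y = 0" "norm (line0 x y) < 1 / 10" "norm (line1 x y) < 1 / 10" "P (line0 x y) (line1 x y)"
    by (cases p) (auto simp: incidence_def)
  have third: "line2 1 x y = line0 x y + line1 x y" by (simp add: line_defs algebra_simps)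
  have y: "(line1 x y - line0 x y - 1) / 3 = y" by (simp add: line_defs field_simps)
  then have "y \<noteq> 0" using cone_bounds(1)[OF p(7,8)] by auto
  then have x: "1 + line0 x y / y = x" by (simp add: line0_def field_simps)
  show "(\<lambda>(x, y, z, s). (line0 x y, line1 x y, z, s)) p \<in> ?C \<and>
    (\<lambda>(\<sigma>, t, z, s). (1 + \<sigma> / ((t - \<sigma> - 1) / 3), (t - \<sigma> - 1) / 3, z, s)) ((\<lambda>(x, y, z, s). (line0 x y, line1 x y, z, s)) p) = p"
    unfolding p(1) prod.case y x using p third by (simp add: cone_nbhd_def)
next
  fix q assume "q \<in> ?C"
  then obtain \<sigma> t z s where q: "q = (\<sigma>, t, z, s)" "norm \<sigma> < 1 / 10" "norm t < 1 / 10" "z \<noteq> 0" "b \<longrightarrow> s \<noteq> 0"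
    "\<sigma> + z * t + s * (\<sigma> + t) = 0" "P \<sigma> t"
    by (cases q) (auto simp: cone_nbhd_def)
  define y where "y = (t - \<sigma> - 1) / 3"
  define x where "x = 1 + \<sigma> / y"
  have y: "y \<noteq> 0" "y \<noteq> 1" "\<sigma> + y \<noteq> 0" using cone_bounds[OF q(2,3)] by (auto simp: y_def)
  have s: "line0 x y = \<sigma>" using y by (simp add: line0_def x_def)
  have t: "line1 x y = t" using y by (simp add: line1_def x_def algebra_simps) (simp add: y_def field_simps)
  have third: "line2 1 x y = line0 x y + line1 x y" by (simp add: line_defs algebra_simps)
  have "x = (\<sigma> + y) / y" using y by (simp add: x_def field_simps)
  then have "x \<noteq> 0" using y by simp
  then show "(\<lambda>(\<sigma>, t, z, s). (1 + \<sigma> / ((t - \<sigma> - 1) / 3), (t - \<sigma> - 1) / 3, z, s)) q \<in> ?M \<and>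
    (\<lambda>(x, y, z, s). (line0 x y, line1 x y, z, s)) ((\<lambda>(\<sigma>, t, z, s). (1 + \<sigma> / ((t - \<sigma> - 1) / 3), (t - \<sigma> - 1) / 3, z, s)) q) = q"
    unfolding q(1) prod.case y_def[symmetric] x_def[symmetric] using y q s t third by (simp add: incidence_def)
qed

text \<open>The neighbourhood of the fibre over the base point has Euler characteristic 0 both with
  and without that fibre, so inserting the fibre changes nothing.\<close>

lemma has_euler_incidence_pencil: "has_euler (incidence 1 b) e \<longleftrightarrow> has_euler (incidence_reg 1 b) e"
proof -
  let ?M = "\<lambda>P. {(x, y, z, s) \<in> incidence 1 b. norm (line0 x y) < 1 / 10 \<and> norm (line1 x y) < 1 / 10 \<and> P (line0 x y) (line1 x y)}"
  define B where "B = ?M (\<lambda>_ _. True)"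
  have reg: "incidence_reg 1 b = {(x, y, z, s) \<in> incidence 1 b. line0 x y \<noteq> 0 \<or> line1 x y \<noteq> 0}"
  proof -
    have "line2 1 x y = line0 x y + line1 x y" for x y by (simp add: line_defs algebra_simps)
    then show ?thesis by (auto simp: incidence_reg_def)
  qed
  have "incidence_reg 1 b = incidence 1 b \<inter> ({p. line0 (fst p) (fst (snd p)) \<noteq> 0} \<union> {p. line1 (fst p) (fst (snd p)) \<noteq> 0})"
    unfolding reg by auto
  moreover have "open ({p. line0 (fst p) (fst (snd p)) \<noteq> 0} \<union> {p :: complex \<times> complex \<times> complex \<times> complex. line1 (fst p) (fst (snd p)) \<noteq> 0})"
    unfolding line_defs by (intro open_Un open_Collect_neq continuous_intros)
  ultimately have A: "openin (top_of_set (incidence 1 b)) (incidence_reg 1 b)" by (simp only: openin_open_Int)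
  have "B = incidence 1 b \<inter> {p. norm (line0 (fst p) (fst (snd p))) < 1 / 10 \<and> norm (line1 (fst p) (fst (snd p))) < 1 / 10}"
    by (auto simp: B_def)
  moreover have "open {p :: complex \<times> complex \<times> complex \<times> complex. norm (line0 (fst p) (fst (snd p))) < 1 / 10 \<and> norm (line1 (fst p) (fst (snd p))) < 1 / 10}"
    unfolding line_defs by (intro open_Collect_conj open_Collect_less continuous_intros)
  ultimately have B: "openin (top_of_set (incidence 1 b)) B" by (simp only: openin_open_Int)
  have "{(\<sigma>, t, z, s) \<in> cone_nbhd b. True} = cone_nbhd b" by auto
  then have b0: "has_euler B 0"
    unfolding B_def using has_euler_cone_nbhd
    by (intro has_euler_near_base_point[where P = "\<lambda>_ _. True", THEN iffD2]) simp
  have "incidence_reg 1 b \<inter> B = ?M (\<lambda>\<sigma> t. \<sigma> \<noteq> 0 \<or> t \<noteq> 0)" unfolding reg B_def by auto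
  then have c0: "has_euler (incidence_reg 1 b \<inter> B) 0"
    by (simp only:) (rule has_euler_near_base_point[where P = "\<lambda>\<sigma> t. \<sigma> \<noteq> 0 \<or> t \<noteq> 0", THEN iffD2,
          OF has_euler_punctured_cone])
  have "incidence 1 b = incidence_reg 1 b \<union> B" unfolding reg B_def by auto
  from has_euler_openin_Un[OF A B this b0 c0, of e] show ?thesis by simp
qed

section \<open>The two parameter values\<close>

lemma incidence_3_eq_reg: "incidence 3 b = incidence_reg 3 b"
proof -
  have "line0 x y \<noteq> 0 \<or> line1 x y \<noteq> 0 \<or> line2 3 x y \<noteq> 0" for x y
  proof (rule ccontr)
    assume "\<not> ?thesis"
    then have "line0 x y = 0" "line1 x y = 0" "line2 3 x y = 0" by auto
    \<comment> \<open>The instance d = 3 of the difference (d - 1) y. A common zero would have y =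
      0, where \<open>line1\<close> is 1.\<close>
    moreover have "2 * y = line2 3 x y - line1 x y - line0 x y" by (simp add: line_defs algebra_simps)
    ultimately have "y = 0" by simp
    then show False using \<open>line1 x y = 0\<close> by (simp add: line1_def)
  qed
  then show ?thesis by (auto simp: incidence_reg_def)
qed

text \<open>The whole difference is one coincidence: for d = 1 the value x = 2 - d, where the last
  two curves meet, equals 1 and is already excluded by \<open>line0\<close>. The curve
  \<open>line2 = 0\<close> then loses four points instead of five.\<close>

lemma curve_complement_euler_values:
  "has_euler (curve_complement 1 {0, 1} {0, 1}) 7" "has_euler (curve_complement 3 {0, 1} {0, 1}) 8"
proof -
  have "- (1 / 2) \<noteq> (1 :: complex)" "- (3 / 2) \<noteq> (1 :: complex)" by (simp_all add: complex_eq_iff)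
  then show "has_euler (curve_complement 1 {0, 1} {0, 1}) 7" "has_euler (curve_complement 3 {0, 1} {0, 1}) 8"
    using has_euler_curve_complement[of "{0, 1}" "{0, 1}" 1] has_euler_curve_complement[of "{0, 1}" "{0, 1}" 3]
    by (simp_all add: card_insert_if)
qed

lemma has_euler_incidence:
  assumes "(d, u) \<in> {(1, 7), (3, 8)}"
  shows "has_euler (incidence d True) (- u)" "\<exists>e. has_euler (incidence d False) e"
proof -
  have "has_euler (curve_complement d {0, 1} {0, 1}) u" using assms curve_complement_euler_values by auto
  moreover have "has_euler (incidence d b) e \<longleftrightarrow> has_euler (incidence_reg d b) e" for b e
    using assms has_euler_incidence_pencil incidence_3_eq_reg by auto
  ultimately show "has_euler (incidence d True) (- u)" "\<exists>e. has_euler (incidence d False) e"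
    using has_euler_incidence_reg[of d u True] has_euler_incidence_reg[of d u False] by auto
qed


section \<open>The hypersurfaces\<close>

text \<open>The variables $z_2, ..., z_{n-1}$ for \<open>n = m + 2\<close>; none are left for
  \<open>m = 0\<close>.\<close>

definition ptorus :: "nat \<Rightarrow> (nat \<Rightarrow> complex) set" where
  "ptorus m = (\<Pi>\<^sub>E k\<in>{2..m + 1}. - {0})"

text \<open>The last variable is $z_n = s - (z_2 + ... + z_{n-1})$, and the avoided value is the
  condition that it is nonzero.\<close>

definition sum_avoiding :: "'e set \<Rightarrow> ('e \<Rightarrow> complex) \<Rightarrow> nat \<Rightarrow> ('e \<times> (nat \<Rightarrow> complex)) set" where
  "sum_avoiding S s m = {(e, z). e \<in> S \<and> z \<in> ptorus m \<and> (\<Sum>k=2..m + 1. z k) \<noteq> s e}"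

lemma ptorus_0: "ptorus 0 = {\<lambda>_. undefined}"
  by (simp add: ptorus_def)

lemma continuous_on_snd_apply [continuous_intros]:
  fixes f :: "'a::topological_space \<Rightarrow> 'd::topological_space \<times> ('b \<Rightarrow> 'c::topological_space)"
  assumes "continuous_on S f"
  shows "continuous_on S (\<lambda>x. snd (f x) k)"
  by (rule continuous_on_product_then_coordinatewise) (intro continuous_intros assms)

lemma has_euler_split_last:
  fixes S :: "'e::metric_space set"
  shows "has_euler {p \<in> S \<times> ptorus (Suc m). R (fst p) (restrict (snd p) {2..m + 1}) (snd p (m + 2))} e \<longleftrightarrow>
    has_euler {q \<in> (S \<times> ptorus m) \<times> (- {0}). R (fst (fst q)) (snd (fst q)) (snd q)} e" (is "has_euler ?A e \<longleftrightarrow> has_euler ?B e")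
proof (rule has_euler_iff_maps[where f = "\<lambda>p. ((fst p, restrict (snd p) {2..m + 1}), snd p (m + 2))"
      and g = "\<lambda>q. (fst (fst q), (snd (fst q))(m + 2 := snd q))"])
  have ins: "{2..Suc m + 1} = insert (m + 2) {2..m + 1}" by auto
  have upd: "restrict (z(m + 2 := w)) {2..m + 1} = z" if "z \<in> ptorus m" for z w
    using that by (auto simp: ptorus_def PiE_def extensional_def restrict_def)
  have upd2: "(restrict z {2..m + 1})(m + 2 := z (m + 2)) = z" if "z \<in> ptorus (Suc m)" for z
    using that by (auto simp: ptorus_def PiE_def extensional_def restrict_def fun_eq_iff)
  have cr: "continuous_on C (\<lambda>p :: 'e \<times> (nat \<Rightarrow> complex). restrict (snd p) {2..m + 1})" for C
  proof (rule continuous_on_coordinatewise_then_product)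
    fix i show "continuous_on C (\<lambda>p :: 'e \<times> (nat \<Rightarrow> complex). restrict (snd p) {2..m + 1} i)"
      by (cases "i \<in> {2..m + 1}") (auto simp: restrict_def intro!: continuous_intros)
  qed
  show "continuous_on ?A (\<lambda>p. ((fst p, restrict (snd p) {2..m + 1}), snd p (m + 2)))"
    by (intro continuous_intros cr)
  have cu: "continuous_on ?B (\<lambda>q. (snd (fst q))(m + 2 := snd q))"
  proof (rule continuous_on_coordinatewise_then_product)
    fix i show "continuous_on ?B (\<lambda>q. ((snd (fst q))(m + 2 := snd q)) i)"
      by (cases "i = m + 2") (auto intro!: continuous_intros)
  qed
  show "continuous_on ?B (\<lambda>q. (fst (fst q), (snd (fst q))(m + 2 := snd q)))"
    by (rule continuous_on_Pair[OF _ cu]) (intro continuous_intros)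
  show "((fst p, restrict (snd p) {2..m + 1}), snd p (m + 2)) \<in> ?B \<and>
     (fst (fst ((fst p, restrict (snd p) {2..m + 1}), snd p (m + 2))),
      (snd (fst ((fst p, restrict (snd p) {2..m + 1}), snd p (m + 2))))
        (m + 2 := snd ((fst p, restrict (snd p) {2..m + 1}), snd p (m + 2)))) = p" if mem: "p \<in> ?A" for p
  proof -
    obtain e z where p: "p = (e, z)" "z \<in> ptorus (Suc m)" using mem by auto
    then have "z (m + 2) \<noteq> 0" "restrict z {2..m + 1} \<in> ptorus m" by (auto simp: ptorus_def)
    then show ?thesis using mem upd2[OF p(2)] by (simp add: p(1))
  qed
  show "(fst (fst q), (snd (fst q))(m + 2 := snd q)) \<in> ?A \<and>
    ((fst (fst (fst q), (snd (fst q))(m + 2 := snd q)), restrict (snd (fst (fst q), (snd (fst q))(m + 2 := snd q))) {2..m + 1}),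
      snd (fst (fst q), (snd (fst q))(m + 2 := snd q)) (m + 2)) = q" if mem: "q \<in> ?B" for q
  proof -
    obtain e z w where q: "q = ((e, z), w)" "z \<in> ptorus m" "w \<noteq> 0" using mem by auto
    then have "z(m + 2 := w) \<in> ptorus (Suc m)"
      unfolding ptorus_def ins by (intro PiE_fun_upd) auto
    then show ?thesis using mem upd[OF q(2), of w] by (simp add: q(1))
  qed
qed

lemma has_euler_times_ptorus:
  fixes S :: "'e::metric_space set"
  assumes "has_euler S e"
  shows "\<exists>c. has_euler (S \<times> ptorus m) c"
proof (induction m)
  case 0
  have "has_euler (S \<times> ptorus 0) e \<longleftrightarrow> has_euler S e"
    by (rule has_euler_iff_maps[where f = fst and g = "\<lambda>e. (e, \<lambda>_. undefined)"])
       (auto simp: ptorus_0 intro!: continuous_intros)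
  with assms show ?case by blast
next
  case (Suc m)
  then have "has_euler ((S \<times> ptorus m) \<times> (- {0 :: complex})) 0"
    using has_euler_times_punctured by blast
  then have "has_euler {q \<in> (S \<times> ptorus m) \<times> (- {0 :: complex}). True} 0" by simp
  then have "has_euler {p \<in> S \<times> ptorus (Suc m). True} 0"
    using has_euler_split_last[where R = "\<lambda>_ _ _. True"] by blast
  then show ?case by auto
qed

text \<open>The next variable w ranges over C^* , so the full product has Euler characteristic 0.
  The removed set is the graph of w = s - (sum of the earlier variables), and w \<noteq> 0 on it
  says precisely that the earlier variables avoid s. Each step therefore changes the sign; the empty
  sum at the start gives s \<noteq> 0.\<close>

lemma has_euler_sum_avoiding:
  fixes S :: "'e::metric_space set"
  assumes S: "has_euler S e" and s: "continuous_on S s" and c: "has_euler {e \<in> S. s e \<noteq> 0} c"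
  shows "has_euler (sum_avoiding S s m) ((-1) ^ m * c)"
proof (induction m)
  case 0
  have "has_euler (sum_avoiding S s 0) c \<longleftrightarrow> has_euler {e \<in> S. s e \<noteq> 0} c"
    by (rule has_euler_iff_maps[where f = fst and g = "\<lambda>e. (e, \<lambda>_. undefined)"])
       (auto simp: ptorus_0 sum_avoiding_def intro!: continuous_intros)
  with c show ?case by simp
next
  case (Suc m)
  let ?B = "S \<times> ptorus m" and ?g = "\<lambda>b. s (fst b) - (\<Sum>k=2..m + 1. snd b k)"
  define X where "X = ?B \<times> (- {0 :: complex})"
  have ins: "{2..Suc m + 1} = insert (m + 2) {2..m + 1}" by auto
  obtain b where "has_euler ?B b" using has_euler_times_ptorus[OF S] by blast
  then have X: "has_euler X 0" unfolding X_def by (rule has_euler_times_punctured)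
  have cg: "continuous_on ?B ?g"
    by (intro continuous_intros continuous_on_compose2[OF s]) auto
  have "has_euler {p \<in> X. snd p - ?g (fst p) \<noteq> 0} (0 - ((-1) ^ m * c))"
  proof (rule has_euler_graph_complement[where B = ?B and D = ?B and g = ?g, rotated -1])
    show "openin (top_of_set (?B \<times> UNIV)) X"
    proof -
      have "X = (?B \<times> UNIV) \<inter> (UNIV \<times> (- {0}))" by (auto simp: X_def)
      moreover have "open (UNIV \<times> (- {0 :: complex}) :: (('e \<times> (nat \<Rightarrow> complex)) \<times> complex) set)"
        by (intro open_Times) auto
      ultimately show ?thesis by (simp only: openin_open_Int)
    qed
    have "{b \<in> ?B. (b, ?g b) \<in> X} = sum_avoiding S s m"
      by (auto simp: X_def sum_avoiding_def)
    then show "has_euler {b \<in> ?B. (b, ?g b) \<in> X} ((-1) ^ m * c)" using Suc by simp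
    have cgX: "continuous_on X (\<lambda>p. ?g (fst p))"
      by (rule continuous_on_compose2[OF cg]) (auto simp: X_def intro!: continuous_intros)
    show "continuous_on X (\<lambda>p. snd p - ?g (fst p))"
      by (rule continuous_on_diff[OF _ cgX]) (intro continuous_intros)
  qed (use cg X in \<open>auto simp: X_def\<close>)
  then have "has_euler {q \<in> ?B \<times> (- {0 :: complex}). snd q + (\<Sum>k=2..m + 1. snd (fst q) k) \<noteq> s (fst (fst q))} ((-1) ^ Suc m * c)"
    by (simp add: X_def algebra_simps)
  then have "has_euler {p \<in> S \<times> ptorus (Suc m). snd p (m + 2) + (\<Sum>k=2..m + 1. restrict (snd p) {2..m + 1} k) \<noteq> s (fst p)} ((-1) ^ Suc m * c)"
    using has_euler_split_last[where R = "\<lambda>e z w. w + (\<Sum>k=2..m + 1. z k) \<noteq> s e"] by blast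
  moreover have "sum_avoiding S s (Suc m) = {p \<in> S \<times> ptorus (Suc m). snd p (m + 2) + (\<Sum>k=2..m + 1. restrict (snd p) {2..m + 1} k) \<noteq> s (fst p)}"
    unfolding sum_avoiding_def ins by auto
  ultimately show ?case by simp
qed

section \<open>The hypersurface as a subspace of a type-class topology\<close>

lemma topology_eq_if_continuous_id:
  assumes "continuous_map X Y id" "continuous_map Y X id"
  shows "X = Y"
proof -
  have top: "topspace X = topspace Y"
    using assms by (auto simp: continuous_map_def)
  have "openin Y U" if "openin X U" "continuous_map Y X id" "topspace X = topspace Y" for X Y :: "'a topology" and U
  proof -
    have "openin Y {x \<in> topspace Y. id x \<in> U}" using that(1,2) by (rule openin_continuous_map_preimage[rotated])
    moreover have "{x \<in> topspace Y. id x \<in> U} = U" using openin_subset[OF that(1)] that(3) by auto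
    ultimately show ?thesis by simp
  qed
  then show ?thesis using assms top unfolding topology_eq by metis
qed

text \<open>An extensional function has a fixed value outside \<open>I\<close>, so the coordinates
  there are continuous too, and the product over \<open>I\<close> carries the topology of pointwise
  convergence on the whole index type.\<close>

lemma product_topology_euclidean_eq:
  "product_topology (\<lambda>_. euclidean) I = top_of_set (PiE I (\<lambda>_. UNIV) :: ('i \<Rightarrow> 'a::topological_space) set)"
    (is "?X = top_of_set ?S")
proof (rule topology_eq_if_continuous_id)
  have "continuous_map ?X euclidean (\<lambda>f. f k)" for k
  proof (cases "k \<in> I")
    case False
    have "continuous_map ?X euclidean (\<lambda>f. undefined)" by simp
    then show ?thesis
    proof (rule continuous_map_eq)
      fix f assume "f \<in> topspace ?X"
      then have "f \<in> PiE I (\<lambda>_. UNIV)" by simp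
      then show "undefined = f k" using False by (metis PiE_arb)
    qed
  qed (rule continuous_map_product_projection)
  then have "continuous_map ?X (product_topology (\<lambda>_. euclidean) UNIV) id"
    unfolding continuous_map_componentwise_UNIV by simp
  then show "continuous_map ?X (top_of_set ?S) id"
    unfolding euclidean_product_topology by (simp add: continuous_map_in_subtopology)
  have "continuous_map (top_of_set ?S) euclidean (\<lambda>f. f k)" for k
    using continuous_on_product_then_coordinatewise[OF continuous_on_id] by simp
  then show "continuous_map (top_of_set ?S) ?X id"
    unfolding continuous_map_componentwise by (simp add: PiE_def)
qed

lemma prod_topology_euclidean_top_of_set:
  "prod_topology euclidean (top_of_set A) = top_of_set (UNIV \<times> A)"
  using prod_topology_subtopology_eu[of UNIV A] by simp

lemma Y_top_eq: "Y_top n W = top_of_set (Y_set n W)"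
proof -
  have "prod_topology euclidean (prod_topology euclidean (product_topology (\<lambda>_. euclidean) {1..n}))
      = (top_of_set (UNIV \<times> UNIV \<times> (PiE {1..n} (\<lambda>_. UNIV))) :: (complex \<times> complex \<times> (nat \<Rightarrow> complex)) topology)"
    unfolding product_topology_euclidean_eq
    by (simp only: prod_topology_euclidean_top_of_set)
  then have "Y_top n W = top_of_set ((UNIV \<times> UNIV \<times> (PiE {1..n} (\<lambda>_. UNIV))) \<inter> Y_set n W)"
    by (simp add: Y_top_def subtopology_subtopology)
  also have "(UNIV \<times> UNIV \<times> (PiE {1..n} (\<lambda>_. UNIV))) \<inter> Y_set n W = Y_set n W"
    by (auto simp: Y_set_def PiE_def extensional_def)
  finally show ?thesis .
qed

text \<open>With \<open>X = 1 / x\<close> and \<open>Y = 1 - 1 / y\<close>, the form \<open>f\<^sub>k\<close> is \<open>x y\<close> times \<open>\<alpha> X Y + \<delta> Y + \<beta>\<close>.\<close>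

definition coeffs_of :: "complex \<Rightarrow> coeffs" where
  "coeffs_of d i j k =
     (let \<alpha> = (if k \<le> 1 then 1 else 2); \<delta> = (if k = 0 then -1 else if k = 1 then 2 else d); \<beta> = (if k = 0 then 0 else 1)
      in if i = 0 then (if j = 0 then - \<alpha> else \<alpha>) else (if j = 0 then - \<delta> else \<delta> + \<beta>))"

lemma f_form_coeffs_of:
  assumes "x \<noteq> 0" "y \<noteq> 0"
  shows "f_form (coeffs_of d) k x y =
    x * y * (if k = 0 then line0 (1 / x) (1 - 1 / y) else if k = 1 then line1 (1 / x) (1 - 1 / y) else line2 d (1 / x) (1 - 1 / y))"
  using assms by (simp add: f_form_def coeffs_of_def line_defs Let_def) (simp add: field_simps)

lemma Y_equation:
  assumes "x \<noteq> 0" "y \<noteq> 0"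
  shows "f_form (coeffs_of d) 0 x y + (\<Sum>k=1..m + 2. z k * f_form (coeffs_of d) k x y) = 0 \<longleftrightarrow>
    line0 (1 / x) (1 - 1 / y) + z 1 * line1 (1 / x) (1 - 1 / y) + (\<Sum>k=2..m + 2. z k) * line2 d (1 / x) (1 - 1 / y) = 0"
proof -
  let ?l0 = "line0 (1 / x) (1 - 1 / y)" and ?l1 = "line1 (1 / x) (1 - 1 / y)" and ?l2 = "line2 d (1 / x) (1 - 1 / y)"
  have "{1..m + 2} = insert 1 {2..m + 2}" by auto
  then have "(\<Sum>k=1..m + 2. z k * f_form (coeffs_of d) k x y)
      = z 1 * f_form (coeffs_of d) 1 x y + (\<Sum>k=2..m + 2. z k * f_form (coeffs_of d) k x y)" by simp
  also have "(\<Sum>k=2..m + 2. z k * f_form (coeffs_of d) k x y) = (\<Sum>k=2..m + 2. z k * (x * y * ?l2))"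
    by (intro sum.cong refl) (simp add: f_form_coeffs_of[OF assms])
  finally have "f_form (coeffs_of d) 0 x y + (\<Sum>k=1..m + 2. z k * f_form (coeffs_of d) k x y)
    = x * y * (?l0 + z 1 * ?l1 + (\<Sum>k=2..m + 2. z k) * ?l2)"
    by (simp add: f_form_coeffs_of[OF assms] sum_distrib_right[symmetric]) (simp add: algebra_simps)
  then show ?thesis using assms by simp
qed

text \<open>The incidence variety is taken with \<open>False\<close>, since the sum s may vanish for
  n > 2 as long as $z_n$ does not. For \<open>m = 0\<close> the avoided sum is empty, which brings
  back s \<noteq> 0.\<close>

lemma has_euler_Y_set:
  "has_euler (Y_set (m + 2) (coeffs_of d)) e \<longleftrightarrow> has_euler (sum_avoiding (incidence d False) (\<lambda>(x, y, z, s). s) m) e"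
proof (rule has_euler_iff_maps[where
      f = "\<lambda>(x, y, z). ((1 / x, 1 - 1 / y, z 1, \<Sum>k=2..m + 2. z k), restrict z {2..m + 1})" and
      g = "\<lambda>((x, y, z1, s), z). (1 / x, 1 / (1 - y), (z(1 := z1))(m + 2 := s - (\<Sum>k=2..m + 1. z k)))"])
  let ?Y = "Y_set (m + 2) (coeffs_of d)" and ?Q = "sum_avoiding (incidence d False) (\<lambda>(x, y, z, s). s) m"
  have ins: "{2..m + 2} = insert (m + 2) {2..m + 1}" by auto
  have cr: "continuous_on C (\<lambda>p :: complex \<times> complex \<times> (nat \<Rightarrow> complex). restrict (snd (snd p)) {2..m + 1})" for C
  proof (rule continuous_on_coordinatewise_then_product)
    fix i show "continuous_on C (\<lambda>p :: complex \<times> complex \<times> (nat \<Rightarrow> complex). restrict (snd (snd p)) {2..m + 1} i)"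
      by (cases "i \<in> {2..m + 1}") (auto simp: restrict_def intro!: continuous_intros)
  qed
  show "continuous_on ?Y (\<lambda>(x, y, z). ((1 / x, 1 - 1 / y, z 1, \<Sum>k=2..m + 2. z k), restrict z {2..m + 1}))"
    unfolding split_beta by (intro continuous_intros cr) (auto simp: Y_set_def)
  have cu: "continuous_on ?Q (\<lambda>q. ((snd q)(1 := fst (snd (snd (fst q)))))(m + 2 := snd (snd (snd (fst q))) - (\<Sum>k=2..m + 1. snd q k)))"
  proof (rule continuous_on_coordinatewise_then_product)
    fix i show "continuous_on ?Q (\<lambda>q. (((snd q)(1 := fst (snd (snd (fst q)))))(m + 2 := snd (snd (snd (fst q))) - (\<Sum>k=2..m + 1. snd q k))) i)"
    proof (cases "i = m + 2")
      case True
      show ?thesis unfolding True fun_upd_same by (intro continuous_intros)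
    next
      case False
      then show ?thesis by (cases "i = 1") (auto intro!: continuous_intros)
    qed
  qed
  show "continuous_on ?Q (\<lambda>((x, y, z1, s), z). (1 / x, 1 / (1 - y), (z(1 := z1))(m + 2 := s - (\<Sum>k=2..m + 1. z k))))"
    unfolding split_beta
    by (rule continuous_on_Pair[OF _ continuous_on_Pair[OF _ cu[unfolded split_beta]]]; intro continuous_intros)
       (auto simp: sum_avoiding_def incidence_def)
  show "(\<lambda>(x, y, z). ((1 / x, 1 - 1 / y, z 1, \<Sum>k=2..m + 2. z k), restrict z {2..m + 1})) p \<in> ?Q \<and>
     (\<lambda>((x, y, z1, s), z). (1 / x, 1 / (1 - y), (z(1 := z1))(m + 2 := s - (\<Sum>k=2..m + 1. z k))))
       ((\<lambda>(x, y, z). ((1 / x, 1 - 1 / y, z 1, \<Sum>k=2..m + 2. z k), restrict z {2..m + 1})) p) = p" if mem: "p \<in> ?Y" for p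
  proof -
    obtain x y z where p: "p = (x, y, z)" "x \<noteq> 0" "y \<noteq> 0" "z \<in> (\<Pi>\<^sub>E k\<in>{1..m + 2}. - {0})"
      "f_form (coeffs_of d) 0 x y + (\<Sum>k=1..m + 2. z k * f_form (coeffs_of d) k x y) = 0"
      using mem by (cases p) (auto simp: Y_set_def)
    have z: "z k \<noteq> 0" if "k \<in> {1..m + 2}" for k using p(4) that by auto
    have r: "restrict z {2..m + 1} \<in> ptorus m" using z by (auto simp: ptorus_def)
    define A where "A = (\<Sum>k=2..m + 1. restrict z {2..m + 1} k)"
    define T where "T = (\<Sum>k=2..m + 2. z k)"
    have "A = (\<Sum>k=2..m + 1. z k)" unfolding A_def by (intro sum.cong) auto
    then have T: "T = z (m + 2) + A" unfolding T_def ins by simp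
    then have "A \<noteq> T" using z[of "m + 2"] by simp
    moreover have "line0 (1 / x) (1 - 1 / y) + z 1 * line1 (1 / x) (1 - 1 / y) + T * line2 d (1 / x) (1 - 1 / y) = 0"
      using Y_equation[OF p(2,3), of d z m] p(5) unfolding T_def by blast
    ultimately have Q: "((1 / x, 1 - 1 / y, z 1, T), restrict z {2..m + 1}) \<in> ?Q"
      unfolding sum_avoiding_def incidence_def mem_Collect_eq prod.case A_def[symmetric]
      using r p(2,3) z[of 1] by simp
    have "((restrict z {2..m + 1})(1 := z 1))(m + 2 := T - A) = z"
      unfolding T using p(4) by (auto simp: fun_eq_iff restrict_def PiE_def extensional_def)
    with Q show ?thesis
      unfolding p(1) prod.case T_def[symmetric] A_def[symmetric] using p(2,3) by simp
  qed
  show "(\<lambda>((x, y, z1, s), z). (1 / x, 1 / (1 - y), (z(1 := z1))(m + 2 := s - (\<Sum>k=2..m + 1. z k)))) q \<in> ?Y \<and>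
     (\<lambda>(x, y, z). ((1 / x, 1 - 1 / y, z 1, \<Sum>k=2..m + 2. z k), restrict z {2..m + 1}))
       ((\<lambda>((x, y, z1, s), z). (1 / x, 1 / (1 - y), (z(1 := z1))(m + 2 := s - (\<Sum>k=2..m + 1. z k)))) q) = q" if mem: "q \<in> ?Q" for q
  proof -
    obtain x y z1 s z where q: "q = ((x, y, z1, s), z)" "x \<noteq> 0" "y \<noteq> 1" "z1 \<noteq> 0"
      "line0 x y + z1 * line1 x y + s * line2 d x y = 0" "z \<in> ptorus m" "(\<Sum>k=2..m + 1. z k) \<noteq> s"
      using mem by (cases q) (auto simp: sum_avoiding_def incidence_def)
    define z' where "z' = (z(1 := z1))(m + 2 := s - (\<Sum>k=2..m + 1. z k))"
    have z'1: "z' 1 = z1" by (simp add: z'_def)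
    have "(\<Sum>k=2..m + 1. z' k) = (\<Sum>k=2..m + 1. z k)" by (intro sum.cong) (auto simp: z'_def)
    then have sums: "(\<Sum>k=2..m + 2. z' k) = s" unfolding ins by (simp add: z'_def)
    have r: "restrict z' {2..m + 1} = z"
      using q(6) by (auto simp: z'_def fun_eq_iff restrict_def ptorus_def PiE_def extensional_def)
    have "z' \<in> (\<Pi>\<^sub>E k\<in>{1..m + 2}. - {0})"
    proof -
      have "{1..m + 2} = insert (m + 2) (insert 1 {2..m + 1})" by auto
      then show ?thesis unfolding z'_def
        using q(4,6,7) by (auto simp only: intro!: PiE_fun_upd) (auto simp: ptorus_def)
    qed
    moreover have "1 / (1 / x) = x" "1 - 1 / (1 / (1 - y)) = y" "1 / x \<noteq> 0" "1 / (1 - y) \<noteq> 0" using q(2,3) by auto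
    ultimately show ?thesis
      unfolding q(1) prod.case z'_def[symmetric]
      using q(5) sums r z'1 Y_equation[of "1 / x" "1 / (1 - y)" d z' m] by (simp add: Y_set_def)
  qed
qed

lemma euler_char_Y:
  assumes "(d, u) \<in> {(1, 7), (3, 8)}"
  shows "euler_char (Y_top (m + 2) (coeffs_of d)) = (-1) ^ m * (- u)"
proof -
  obtain e where e: "has_euler (incidence d False) e" using has_euler_incidence(2)[OF assms] by blast
  have "has_euler (sum_avoiding (incidence d False) (\<lambda>(x, y, z, s). s) m) ((-1) ^ m * (- u))"
  proof (rule has_euler_sum_avoiding[OF e])
    have "{p \<in> incidence d False. (\<lambda>(x, y, z, s). s) p \<noteq> 0} = incidence d True" by (auto simp: incidence_def)
    then show "has_euler {p \<in> incidence d False. (\<lambda>(x, y, z, s). s) p \<noteq> 0} (- u)"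
      using has_euler_incidence(1)[OF assms] by simp
  qed (auto simp: split_beta intro!: continuous_intros)
  then have "has_euler (Y_set (m + 2) (coeffs_of d)) ((-1) ^ m * (- u))"
    by (simp only: has_euler_Y_set)
  then show ?thesis
    unfolding has_euler_def Y_top_eq[symmetric] by (rule euler_is_imp_euler_char)
qed

text \<open>Only three coefficient patterns occur, so every factor reduces to a few polynomials in
  d. The quantifier stands inside the disjuncts so that one case split serves both parameter
  values.\<close>

lemma coeffs_of_cases:
  "(\<forall>d. coeffs_of d 0 0 k = -1 \<and> coeffs_of d 0 (Suc 0) k = 1 \<and> coeffs_of d (Suc 0) 0 k = 1 \<and> coeffs_of d (Suc 0) (Suc 0) k = -1) \<or>
   (\<forall>d. coeffs_of d 0 0 k = -1 \<and> coeffs_of d 0 (Suc 0) k = 1 \<and> coeffs_of d (Suc 0) 0 k = -2 \<and> coeffs_of d (Suc 0) (Suc 0) k = 3) \<or>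
   (\<forall>d. coeffs_of d 0 0 k = -2 \<and> coeffs_of d 0 (Suc 0) k = 2 \<and> coeffs_of d (Suc 0) 0 k = - d \<and> coeffs_of d (Suc 0) (Suc 0) k = d + 1)"
  by (cases "k = 0"; cases "k = 1") (auto simp: coeffs_of_def Let_def)

text \<open>Between pattern 0 or 1 and the last pattern, the minors involving d are d - 2, d + 2, d
  - 4, d + 3 and d - 5, none of them zero at 1 or 3. In each 2x2x2 hyperdeterminant the product term
  vanishes because of the common boundary point, and d cancels in the remaining square.\<close>

lemma EA_factors_coeffs_of:
  assumes "G \<in> EA_factors n"
  shows "G (coeffs_of 1) = 0 \<longleftrightarrow> G (coeffs_of 3) = 0"
proof -
  \<comment> \<open>The common zero has (x0, x1) = (1, 0) and (y0, y1) = (1, 1), where each form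
    takes the value \<open>W 0 0 k + W 0 1 k = 0\<close>.\<close>
  have "hyperdet223 k1 k2 k3 (coeffs_of d) = 0" for k1 k2 k3 d
    unfolding hyperdet223_eq_0_iff
    by (intro exI[of _ 1] exI[of _ 0]) (auto simp: q_form_def coeffs_of_def Let_def)
  moreover have "F_bb k (coeffs_of 1) = 0 \<longleftrightarrow> F_bb k (coeffs_of 3) = 0" for k
    using coeffs_of_cases[of k] by (elim disjE) (auto simp: F_bb_def)
  moreover have "F_ib i k l (coeffs_of 1) = 0 \<longleftrightarrow> F_ib i k l (coeffs_of 3) = 0" if "i \<in> {0, 1}" for i k l
    using that coeffs_of_cases[of k] coeffs_of_cases[of l] by (elim disjE) (auto simp: F_ib_def)
  moreover have "F_bj j k l (coeffs_of 1) = 0 \<longleftrightarrow> F_bj j k l (coeffs_of 3) = 0" if "j \<in> {0, 1}" for j k l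
    using that coeffs_of_cases[of k] coeffs_of_cases[of l] by (elim disjE) (auto simp: F_bj_def)
  moreover have "hyperdet222 k l (coeffs_of 1) = 0 \<longleftrightarrow> hyperdet222 k l (coeffs_of 3) = 0" for k l
    using coeffs_of_cases[of k] coeffs_of_cases[of l] by (elim disjE) (auto simp: hyperdet222_def F_ib_def)
  ultimately show ?thesis
    using assms unfolding EA_factors_def by auto
qed

theorem mainTheorem2:
  shows "\<forall>n\<ge>2. \<exists>W W' :: coeffs. in_torus n W \<and> in_torus n W' \<and>
           (\<forall>G\<in>EA_factors n. G W = 0 \<longleftrightarrow> G W' = 0) \<and>
           euler_char (Y_top n W) \<noteq> euler_char (Y_top n W')"
proof (intro allI impI)
  fix n :: nat assume "n \<ge> 2"
  then obtain m where n: "n = m + 2" using le_Suc_ex add.commute by metis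
  have "euler_char (Y_top n (coeffs_of 1)) \<noteq> euler_char (Y_top n (coeffs_of 3))"
    unfolding n euler_char_Y[of 1 7 m, OF insertI1] euler_char_Y[of 3 8 m, OF insertI2, OF insertI1] by simp
  moreover have "in_torus n (coeffs_of 1)" "in_torus n (coeffs_of 3)"
    by (auto simp: in_torus_def coeffs_of_def Let_def)
  ultimately show "\<exists>W W' :: coeffs. in_torus n W \<and> in_torus n W' \<and>
           (\<forall>G\<in>EA_factors n. G W = 0 \<longleftrightarrow> G W' = 0) \<and>
           euler_char (Y_top n W) \<noteq> euler_char (Y_top n W')"
    using EA_factors_coeffs_of by blast
qed


end
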